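(* Let $\omega$ be a modulus of continuity. Then there exist a $2$-dimensional integral varifold $V$ in $\mathbf{R}^3$ whose first variation $\delta V$ is representable by integration (i.e. $\|\delta V\|$ is a Radon measure), with associated map $\tau:Z\to\operatorname{Hom}(\mathbf{R}^3,\mathbf{R}^3)$, $\tau(z)=\operatorname{Tan}^2(\|V\|,z)_\natural$ for $z\in Z=\{z\in\mathbf{R}^3:\operatorname{Tan}^2(\|V\|,z)\in\mathbf{G}(3,2)\}$, and a set $C$ with $\|V\|(C)>0$, such that $$\limsup_{r\to0+}\ \omega(r)^{-1}\,r^{-4}\,(\log(1/r))^{-1}\int_{\mathbf{B}(c,r)}|\tau(z)-\tau(c)|^2\,d\|V\|z>0$$ whenever $c\in C$.
   Context: A modulus of continuity is a nondecreasing function $\omega:[0,1]\to[0,1]$ with $\lim_{t\to0+}\omega(t)=0$ and with $\omega(t)=0$ if and only if $t=0$. $\mathbf{B}(a,r)$ is the closed ball. $\mathbf{G}(n,m)$ is the set of $m$-dimensional linear subspaces of $\mathbf{R}^n$; for $S\in\mathbf{G}(n,m)$, $S_\natural\in\operatorname{Hom}(\mathbf{R}^n,\mathbf{R}^n)$ is the orthogonal projection onto $S$. On $\operatorname{Hom}(\mathbf{R}^n,\mathbf{R}^n)$, $f\bullet g=\operatorname{trace}(f^*\circ g)$ and $|f|=(f\bullet f)^{1/2}$. An $m$-dimensional varifold in an open set $U\subset\mathbf{R}^n$ is a Radon measure $V$ on $U\times\mathbf{G}(n,m)$; its weight is $\|V\|(A)=V(A\times\mathbf{G}(n,m))$. Densities: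 $\Theta^m(\mu,z)=\lim_{r\to0+}\mu(\mathbf{B}(z,r))/(\alpha(m)r^m)$, $\alpha(m)$ the Lebesgue measure of the unit ball of $\mathbf{R}^m$. Approximate tangent cone: $\operatorname{Tan}^m(\mu,z)$ is the intersection of the tangent cones $\operatorname{Tan}(S,z)$ over all $S$ with $\Theta^m(\mu\llcorner(\mathbf{R}^n\setminus S),z)=0$. $V$ is integral in Allard's sense: $\|V\|=\theta\,\mathcal{H}^m\llcorner E$ with $E$ countably $m$-rectifiable and $\theta$ positive-integer-valued and locally integrable, and $S=\operatorname{Tan}^m(\|V\|,z)$ for $V$ almost all $(z,S)$. First variation: $(\delta V)(\theta)=\int S_\natural\bullet D\theta(z)\,dV(z,S)$ for smooth compactly supported $\theta:U\to\mathbf{R}^n$; $\|\delta V\|$ is its total variation measure. *)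

theory Defs
  imports "HOL-Analysis.Analysis"
begin

text \<open>Only the values on the unit interval matter.\<close>

definition modulus_of_continuity :: "(real \<Rightarrow> real) \<Rightarrow> bool" where
  "modulus_of_continuity \<omega> \<longleftrightarrow>
     \<omega> ` {0..1} \<subseteq> {0..1} \<and> mono_on {0..1} \<omega> \<and> (\<omega> \<longlongrightarrow> 0) (at_right 0) \<and>
     (\<forall>t\<in>{0..1}. \<omega> t = 0 \<longleftrightarrow> t = 0)"

text \<open>
  \<open>Hom(R\<^sup>n, R\<^sup>n)\<close> is represented by \<open>n \<times> n\<close> matrices with respect to the standard basis, so that the
  adjoint is the transpose.
\<close>

definition hom_inner :: "real^'n^'n \<Rightarrow> real^'n^'n \<Rightarrow> real" where
  "hom_inner f g = trace (transpose f ** g)"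

definition hom_norm :: "real^'n^'n \<Rightarrow> real" where
  "hom_norm f = sqrt (hom_inner f f)"

definition orth_proj :: "(real^'n) set \<Rightarrow> real^'n^'n" where
  "orth_proj S = matrix (\<lambda>x. THE y. y \<in> S \<and> x - y \<in> S\<^sup>\<bottom>)"

definition grassmannian :: "nat \<Rightarrow> (real^'n) set set" where
  "grassmannian m = {S. subspace S \<and> dim S = m}"

text \<open>
  The usual topology of the Grassmannian: a subspace is identified with the orthogonal projection
  onto it.
\<close>

definition grassmann_topology :: "nat \<Rightarrow> (real^'n) set topology" where
  "grassmann_topology m = pullback_topology (grassmannian m) orth_proj euclidean"

definition borel_of :: "'a topology \<Rightarrow> 'a measure" where
  "borel_of X = sigma (topspace X) {G. openin X G}"

text \<open>
  This is used for locally compact, second countable Hausdorff spaces only; there a Borel measure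
  that is finite on compact sets is automatically inner and outer regular.
\<close>

definition radon_measure :: "'a topology \<Rightarrow> 'a measure \<Rightarrow> bool" where
  "radon_measure X \<mu> \<longleftrightarrow>
     sets \<mu> = sets (borel_of X) \<and> (\<forall>K. compactin X K \<longrightarrow> emeasure \<mu> K < \<infinity>)"

text \<open>
  The density is taken of a set function, since it is applied to \<open>\<mu> \<llcorner> (R\<^sup>n \<setminus> S)\<close> for arbitrary,
  possibly non-measurable, \<open>S\<close>.  Here \<^term>\<open>unit_ball_vol (real m)\<close> is \<open>\<alpha>(m)\<close>.
\<close>

definition has_density :: "nat \<Rightarrow> ((real^'n) set \<Rightarrow> ennreal) \<Rightarrow> real^'n \<Rightarrow> ennreal \<Rightarrow> bool" where
  "has_density m \<phi> z d \<longleftrightarrow>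
     ((\<lambda>r. \<phi> (cball z r) / ennreal (unit_ball_vol (real m) * r ^ m)) \<longlongrightarrow> d) (at_right 0)"

text \<open>
  The tangent cone in the sense of Federer, 3.1.21; it contains \<open>0\<close> iff \<open>a\<close> is in the closure of \<open>S\<close>.
\<close>

definition tangent_cone :: "(real^'n) set \<Rightarrow> real^'n \<Rightarrow> (real^'n) set" where
  "tangent_cone S a =
     {v. \<forall>e>0. \<exists>x\<in>S. \<exists>s>0. norm (x - a) < e \<and> norm (s *\<^sub>R (x - a) - v) < e}"

definition approx_tangent_cone :: "nat \<Rightarrow> (real^'n) measure \<Rightarrow> real^'n \<Rightarrow> (real^'n) set" where
  "approx_tangent_cone m \<mu> z =
     \<Inter> {tangent_cone S z | S. has_density m (\<lambda>A. outer_measure_of \<mu> (A \<inter> (UNIV - S))) z 0}"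

text \<open>
  The map \<open>\<tau>\<close> is meaningful on its domain \<open>Z\<close>, namely \<^term>\<open>tangent_domain m \<mu>\<close>, only.
\<close>

definition tangent_domain :: "nat \<Rightarrow> (real^'n) measure \<Rightarrow> (real^'n) set" where
  "tangent_domain m \<mu> = {z. approx_tangent_cone m \<mu> z \<in> grassmannian m}"

definition tangent_map :: "nat \<Rightarrow> (real^'n) measure \<Rightarrow> real^'n \<Rightarrow> real^'n^'n" where
  "tangent_map m \<mu> z = orth_proj (approx_tangent_cone m \<mu> z)"

text \<open>
  The library's \<^const>\<open>diameter\<close> is meaningful for bounded sets only, whence the boundedness
  condition on the covering sets.  The empty set is treated separately for the sake of \<open>m = 0\<close>.
\<close>

definition hausdorff_gauge :: "nat \<Rightarrow> (real^'n) set \<Rightarrow> ennreal" where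
  "hausdorff_gauge m C =
     (if C = {} then 0 else ennreal (unit_ball_vol (real m) * (diameter C / 2) ^ m))"

definition hausdorff_size :: "nat \<Rightarrow> real \<Rightarrow> (real^'n) set \<Rightarrow> ennreal" where
  "hausdorff_size m \<delta> A =
     (INF C\<in>{C :: nat \<Rightarrow> (real^'n) set.
              A \<subseteq> (\<Union>i. C i) \<and> (\<forall>i. bounded (C i) \<and> diameter (C i) \<le> \<delta>)}.
        \<Sum>i. hausdorff_gauge m (C i))"

definition hausdorff_outer_measure :: "nat \<Rightarrow> (real^'n) set \<Rightarrow> ennreal" where
  "hausdorff_outer_measure m A = (SUP \<delta>\<in>{0<..}. hausdorff_size m \<delta> A)"

text \<open>
  The restriction to the Borel sets, on which \<^const>\<open>hausdorff_outer_measure\<close> is countably additive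
  by Caratheodory's criterion for metric outer measures.
\<close>

definition hausdorff_measure :: "nat \<Rightarrow> (real^'n) measure" where
  "hausdorff_measure m = measure_of UNIV (sets borel) (hausdorff_outer_measure m)"

text \<open>
  Countable \<open>m\<close>-rectifiability in the sense of Federer, 3.2.14, with \<open>m\<close> the cardinality of \<open>'m\<close>:
  a countable union of Lipschitz images of bounded subsets of \<open>R\<^sup>m\<close>.
\<close>

definition countably_rectifiable :: "'m::finite itself \<Rightarrow> (real^'n) set \<Rightarrow> bool" where
  "countably_rectifiable T E \<longleftrightarrow>
     (\<exists>(A :: nat \<Rightarrow> (real^'m) set) (f :: nat \<Rightarrow> real^'m \<Rightarrow> real^'n).
        (\<forall>j. bounded (A j) \<and> (\<exists>L. L-lipschitz_on (A j) (f j))) \<and> E = (\<Union>j. f j ` A j))"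

definition varifold :: "nat \<Rightarrow> ((real^'n) \<times> (real^'n) set) measure \<Rightarrow> bool" where
  "varifold m V \<longleftrightarrow> radon_measure (prod_topology euclidean (grassmann_topology m)) V"

definition weight :: "((real^'n) \<times> (real^'n) set) measure \<Rightarrow> (real^'n) measure" where
  "weight V = distr V borel fst"

text \<open>
  The dimension \<open>m\<close> is the cardinality of the index type \<open>'m\<close>.  Requiring \<open>E\<close> and \<open>\<theta>\<close> to be Borel
  rather than \<open>H\<^sup>m\<close> measurable is no restriction, since both may be changed on \<open>H\<^sup>m\<close> null sets.
\<close>

definition integral_varifold ::
    "'m::finite itself \<Rightarrow> ((real^'n) \<times> (real^'n) set) measure \<Rightarrow> bool" where
  "integral_varifold T V \<longleftrightarrow>
     varifold CARD('m) V \<and>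
     (\<exists>E \<in> sets borel. \<exists>\<theta> :: real^'n \<Rightarrow> nat.
        countably_rectifiable T E \<and>
        \<theta> \<in> measurable borel (count_space UNIV) \<and> (\<forall>z\<in>E. 0 < \<theta> z) \<and>
        (\<forall>K. compact K \<longrightarrow> (\<integral>\<^sup>+z\<in>E \<inter> K. of_nat (\<theta> z) \<partial>hausdorff_measure CARD('m)) < \<infinity>) \<and>
        weight V = density (hausdorff_measure CARD('m)) (\<lambda>z. of_nat (\<theta> z) * indicator E z)) \<and>
     (AE p in V. snd p = approx_tangent_cone CARD('m) (weight V) (fst p))"

primrec times_cont_diff :: "nat \<Rightarrow> (real^'n \<Rightarrow> real^'n) \<Rightarrow> bool" where
  "times_cont_diff 0 f \<longleftrightarrow> continuous_on UNIV f"
| "times_cont_diff (Suc k) f \<longleftrightarrow>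
     (\<forall>x. f differentiable at x) \<and>
     (\<forall>v. times_cont_diff k (\<lambda>x. frechet_derivative f (at x) v))"

definition field_support :: "(real^'n \<Rightarrow> real^'n) \<Rightarrow> (real^'n) set" where
  "field_support \<theta> = closure {x. \<theta> x \<noteq> 0}"

definition test_fields :: "(real^'n \<Rightarrow> real^'n) set" where
  "test_fields = {\<theta>. (\<forall>k. times_cont_diff k \<theta>) \<and> compact (field_support \<theta>)}"

definition first_variation ::
    "((real^'n) \<times> (real^'n) set) measure \<Rightarrow> (real^'n \<Rightarrow> real^'n) \<Rightarrow> real" where
  "first_variation V \<theta> =
     (\<integral>p. hom_inner (orth_proj (snd p)) (jacobian \<theta> (at (fst p))) \<partial>V)"

text \<open>
  The value of the total variation measure of the first variation on an open set \<open>G\<close>.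
  A Radon measure is determined by its values on the open sets.
\<close>

definition variation_on_open :: "((real^'n) \<times> (real^'n) set) measure \<Rightarrow> (real^'n) set \<Rightarrow> ennreal" where
  "variation_on_open V G =
     (SUP \<theta>\<in>{\<theta> \<in> test_fields. field_support \<theta> \<subseteq> G \<and> (\<forall>x. norm (\<theta> x) \<le> 1)}.
        ennreal (first_variation V \<theta>))"

definition first_variation_representable ::
    "((real^'n) \<times> (real^'n) set) measure \<Rightarrow> bool" where
  "first_variation_representable V \<longleftrightarrow>
     (\<exists>\<nu>. radon_measure euclidean \<nu> \<and> (\<forall>G. open G \<longrightarrow> emeasure \<nu> G = variation_on_open V G))"

end

theory Submission
  imports Defs "HOL-Computational_Algebra.Polynomial"
begin

text \<open>
  \<open>V\<close> is the unit density varifold of a flat square in which countably many small annuli are replaced by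
  half catenoids. Each chart \<open>\<phi>\<close> of a catenoid or an annulus is conformal and harmonic, so the area
  formula turns \<open>S\<^sub>\<natural> \<bullet> D\<theta>\<close> into an exact derivative on the parameter strip: the first variation consists
  of boundary terms only. Replacing the annulus with radii \<open>\<epsilon>\<close> and \<open>\<epsilon> cosh L\<close> changes it by at most
  \<open>8\<pi>\<epsilon>\<close>, whereas the half catenoid has tilt excess \<open>4\<pi>\<epsilon>\<^sup>2 L\<close> against the horizontal plane.

  Choose scales \<open>r\<^sub>i\<close> tending to \<open>0\<close> so fast that \<open>\<omega>(r\<^sub>i) \<le> s\<^sub>i\<^sup>2\<close> for \<open>s\<^sub>i = (1/2)^(i+4)\<close>, and put
  half catenoids with \<open>\<epsilon>\<^sub>i = s\<^sub>i r\<^sub>i\<^sup>2\<close> and \<open>cosh L\<^sub>i = 1 / r\<^sub>i\<close> at the points of a grid of mesh \<open>r\<^sub>i / 2\<close>. There are about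
  \<open>4 / r\<^sub>i\<^sup>2\<close> of them, so the first variation of all stages is bounded by a multiple of \<open>\<Sum>s\<^sub>i\<close>. Almost every
  flat point \<open>c\<close> outside the doubled disks has a horizontal approximate tangent plane, and for every \<open>i\<close> the ball
  \<open>B(c, r\<^sub>i)\<close> contains a whole half catenoid of stage \<open>i\<close>, with tilt excess
  \<open>4\<pi>s\<^sub>i\<^sup>2 r\<^sub>i\<^sup>4 L\<^sub>i \<ge> 4\<pi>\<omega>(r\<^sub>i) r\<^sub>i\<^sup>4 log(1/r\<^sub>i)\<close>.
\<close>

section \<open>Metric outer measures\<close>

text \<open>The exponents are forced. About \<open>r\<^sub>i\<close>^-2 hats of a stage cost about
  \<open>\<epsilon>\<^sub>i / r\<^sub>i\<^sup>2\<close> in total variation, and this must be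
  summable over the stages; so \<open>\<epsilon>\<^sub>i\<close> is a summable factor times
  \<open>r\<^sub>i\<^sup>2\<close>. A hat has to fit into a cell of size comparable to
  \<open>r\<^sub>i\<close>; this limits \<open>\<epsilon>\<^sub>i cosh L\<^sub>i\<close> and so
  leaves \<open>L\<^sub>i\<close> of order log(1/\<open>r\<^sub>i\<close>), which is the logarithm
  of the theorem. The gain comes from conformality: a catenoid collects tilt excess at a constant
  rate in the logarithm of the radius, while the first variation sees only its two ends, where the
  mismatch is of order \<open>\<epsilon>\<^sub>i\<close>. The obstacle is the approximate tangent
  plane at points of \<open>C\<close>, where hats of all stages accumulate. It is handled by a
  differentiation theorem: a finite measure that vanishes on a set has density zero at Lebesgue
  almost all points of this set. The definition of the cone admits arbitrary sets \<open>S\<close>,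
  so each tangent plane is found by two inclusions: one well chosen \<open>S\<close> bounds the cone
  from above, and mass near every tangent direction bounds it from below.\<close>

definition metric_outer_measure :: "('a::metric_space set \<Rightarrow> ennreal) \<Rightarrow> bool" where
  "metric_outer_measure \<mu> \<longleftrightarrow>
     \<mu> {} = 0 \<and> (\<forall>A B. A \<subseteq> B \<longrightarrow> \<mu> A \<le> \<mu> B) \<and>
     (\<forall>A::nat \<Rightarrow> 'a set. \<mu> (\<Union>i. A i) \<le> (\<Sum>i. \<mu> (A i))) \<and>
     (\<forall>A B d. 0 < d \<and> (\<forall>x\<in>A. \<forall>y\<in>B. d \<le> dist x y) \<longrightarrow> \<mu> A + \<mu> B \<le> \<mu> (A \<union> B))"

lemma ennreal_suminf_tail_small:
  fixes f :: "nat \<Rightarrow> ennreal"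
  assumes "(\<Sum>n. f n) < \<infinity>" "0 < (e::ennreal)"
  shows "\<exists>n. (\<Sum>k. f (k + n)) \<le> e"
proof -
  have fin: "f n < \<infinity>" for n
    using assms(1) ennreal_suminf_lessD by blast
  define g where "g n = enn2real (f n)" for n
  have fg: "f n = ennreal (g n)" and g0: "0 \<le> g n" for n
    using fin[of n] by (auto simp: g_def)
  have s: "summable g"
    using assms(1) g0 by (intro summable_suminf_not_top) (auto simp: fg)
  obtain e' where e': "0 < e'" "ennreal e' \<le> e"
    by (metis assms(2) ennreal_enn2real ennreal_le_1 enn2real_positive_iff ennreal_zero_neq_top
        less_top linorder_not_less nless_le top_greatest zero_less_one)
  obtain n where n: "norm (\<Sum>i. g (i + n)) < e'"
    using suminf_exist_split[OF e'(1) s] by (metis order_refl)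
  have "(\<Sum>k. f (k + n)) = ennreal (\<Sum>i. g (i + n))"
    unfolding fg using s by (intro suminf_ennreal2) (auto simp: g0)
  also have "\<dots> \<le> ennreal e'" using n by (intro ennreal_leI) auto
  finally show ?thesis using e' by (meson order_trans)
qed

lemma outer_Un_le:
  assumes "\<mu> {} = (0::ennreal)" "\<And>A::nat \<Rightarrow> 'a set. \<mu> (\<Union>i. A i) \<le> (\<Sum>i. \<mu> (A i))"
  shows "\<mu> (A \<union> B) \<le> \<mu> A + \<mu> B"
proof -
  have "\<mu> (A \<union> B) = \<mu> (\<Union>i. binaryset A B i)" by (simp add: UN_binaryset_eq)
  also have "\<dots> \<le> (\<Sum>i. \<mu> (binaryset A B i))" by (rule assms)
  also have "\<dots> = \<mu> A + \<mu> B" using assms(1) by (intro suminf_binaryset_eq)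
  finally show ?thesis .
qed

text \<open>Caratheodory's argument. The sets \<open>D n\<close> stay away from \<open>F\<close>, so
  additivity holds for \<open>A \<inter> F\<close> and \<open>D n\<close>. The rings between
  successive \<open>D n\<close> have summable measure: rings of equal parity are positively
  separated, so each parity sums to at most \<open>\<mu> A\<close>. The tail of this series bounds
  what \<open>D n\<close> leaves of \<open>A - F\<close>.\<close>

lemma metric_outer_measure_closed:
  fixes \<mu> :: "'a::metric_space set \<Rightarrow> ennreal"
  assumes \<mu>: "metric_outer_measure \<mu>" and F: "closed F"
  shows "\<mu> (A \<inter> F) + \<mu> (A - F) \<le> \<mu> A"
proof (cases "F = {} \<or> \<mu> A = \<infinity>")
  case True
  then show ?thesis using \<mu> by (auto simp: metric_outer_measure_def)
next
  case False
  have empty: "\<mu> {} = 0" and mono: "\<And>A B. A \<subseteq> B \<Longrightarrow> \<mu> A \<le> \<mu> B"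
    and sub: "\<And>A::nat \<Rightarrow> 'a set. \<mu> (\<Union>i. A i) \<le> (\<Sum>i. \<mu> (A i))"
    and sep: "\<And>A B d. 0 < d \<Longrightarrow> (\<And>x y. x\<in>A \<Longrightarrow> y\<in>B \<Longrightarrow> d \<le> dist x y) \<Longrightarrow> \<mu> A + \<mu> B \<le> \<mu> (A \<union> B)"
    using \<mu> unfolding metric_outer_measure_def by blast+
  define D where "D n = {x \<in> A. 1 / real (Suc n) \<le> infdist x F}" for n
  define R where "R n = D (Suc n) - D n" for n
  have D_mono: "D m \<subseteq> D n" if "m \<le> n" for m n
    using that by (auto simp: D_def field_simps) (smt (verit) divide_right_mono field_simps of_nat_le_iff infdist_nonneg mult_right_mono)
  have gap: "\<mu> X + \<mu> Y \<le> \<mu> (X \<union> Y)"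
    if X: "X \<subseteq> D n" and Y: "Y \<inter> D (Suc n) = {}" "Y \<subseteq> A" for X Y n
  proof (rule sep)
    show "0 < 1 / real (Suc n) - 1 / real (Suc (Suc n))"
      by (simp add: frac_less2)
    fix x y assume "x \<in> X" "y \<in> Y"
    then have "1 / real (Suc n) \<le> infdist x F" "infdist y F < 1 / real (Suc (Suc n))"
      using X Y by (auto simp: D_def)
    moreover have "infdist x F \<le> infdist y F + dist x y" by (rule infdist_triangle)
    ultimately show "1 / real (Suc n) - 1 / real (Suc (Suc n)) \<le> dist x y" by linarith
  qed
  have AF: "\<mu> (A \<inter> F) + \<mu> (D n) \<le> \<mu> A" for n
  proof -
    have "\<mu> (D n) + \<mu> (A \<inter> F) \<le> \<mu> (D n \<union> (A \<inter> F))"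
      by (rule gap[of _ n]) (auto simp: D_def)
    also have "\<dots> \<le> \<mu> A" by (rule mono) (auto simp: D_def)
    finally show ?thesis by (simp add: add.commute)
  qed
  have half: "(\<Sum>k<n. \<mu> (R (2 * k + i))) \<le> \<mu> (\<Union>k<n. R (2 * k + i))" for n i
  proof (induction n)
    case (Suc n)
    \<comment> \<open>A whole ring separates this set from the next ring of the same parity. For
      \<open>n = 0\<close> the subtraction may be truncated; the union is then empty and the case is
      settled separately.\<close>
    have sub': "(\<Union>k<n. R (2 * k + i)) \<subseteq> D (2 * n + i - 1)"
    proof (clarsimp simp: R_def)
      fix x k assume "x \<in> D (Suc (2 * k + i))" "k < n"
      moreover have "Suc (2 * k + i) \<le> 2 * n + i - 1" using \<open>k < n\<close> by arith
      ultimately show "x \<in> D (2 * n + i - Suc 0)" using D_mono by auto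
    qed
    have "(\<Sum>k<Suc n. \<mu> (R (2 * k + i))) \<le> \<mu> (\<Union>k<n. R (2 * k + i)) + \<mu> (R (2 * n + i))"
      using Suc by (simp add: add_right_mono)
    also have "\<dots> \<le> \<mu> ((\<Union>k<n. R (2 * k + i)) \<union> R (2 * n + i))"
    proof (cases "n = 0")
      case False
      then have eq: "Suc (2 * n + i - 1) = 2 * n + i" by simp
      show ?thesis
        by (rule gap[OF sub'], unfold eq) (auto simp: R_def D_def)
    qed (simp add: empty)
    also have "\<dots> = \<mu> (\<Union>k<Suc n. R (2 * k + i))" by (simp add: lessThan_Suc Un_commute)
    finally show ?case .
  qed (simp add: empty)
  have half_le: "(\<Sum>k<n. \<mu> (R (2 * k + i))) \<le> \<mu> A" for n i
    by (intro order_trans[OF half] mono) (auto simp: R_def D_def)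
  have "(\<Sum>k. \<mu> (R k)) < \<infinity>"
  proof -
    have "(\<Sum>k<n. \<mu> (R k)) \<le> \<mu> A + \<mu> A" for n
    proof -
      have "(\<Sum>k<n. \<mu> (R k)) \<le> (\<Sum>k<2 * n. \<mu> (R k))" by (intro sum_mono2) auto
      also have "\<dots> = (\<Sum>k<n. \<mu> (R (2 * k))) + (\<Sum>k<n. \<mu> (R (2 * k + 1)))"
        by (induction n) (auto simp: ac_simps)
      also have "\<dots> \<le> \<mu> A + \<mu> A"
        using half_le[of 0 n] half_le[of 1 n] by (intro add_mono) simp_all
      finally show ?thesis .
    qed
    then have "(\<Sum>k. \<mu> (R k)) \<le> \<mu> A + \<mu> A" by (intro suminf_le_const summableI)
    also have "\<dots> < \<infinity>" using False by (simp add: less_top)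
    finally show ?thesis .
  qed
  note tail = ennreal_suminf_tail_small[OF this]
  show ?thesis
  proof (rule ennreal_le_epsilon)
    fix e :: real assume "0 < e"
    with tail[of "ennreal e"] obtain n where n: "(\<Sum>k. \<mu> (R (k + n))) \<le> ennreal e" by auto
    have "A - F \<subseteq> D n \<union> (\<Union>k. R (k + n))"
    proof
      fix x assume x: "x \<in> A - F"
      then have "infdist x F > 0" using F False by (simp add: infdist_pos_not_in_closed)
      then obtain m where "1 / real (Suc m) < infdist x F" using nat_approx_posE by metis
      then have ex: "x \<in> D m" using x by (auto simp: D_def)
      define m0 where "m0 = (LEAST m. x \<in> D m)"
      have m0: "x \<in> D m0" unfolding m0_def using ex by (rule LeastI)
      have notm: "x \<notin> D k" if "k < m0" for k using that not_less_Least m0_def by blast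
      show "x \<in> D n \<union> (\<Union>k. R (k + n))"
      proof (cases "m0 \<le> n")
        case True
        then show ?thesis using D_mono m0 by blast
      next
        case False
        then obtain k where "m0 = Suc (k + n)" by (metis add.commute less_imp_Suc_add not_le)
        then have "x \<in> R (k + n)" using m0 notm[of "k + n"] by (auto simp: R_def)
        then show ?thesis by blast
      qed
    qed
    then have "\<mu> (A - F) \<le> \<mu> (D n \<union> (\<Union>k. R (k + n)))" by (rule mono)
    also have "\<dots> \<le> \<mu> (D n) + \<mu> (\<Union>k. R (k + n))" by (rule outer_Un_le[where \<mu>=\<mu>, OF empty sub])
    also have "\<mu> (\<Union>k. R (k + n)) \<le> ennreal e" using sub n by (meson order_trans)
    finally have "\<mu> (A \<inter> F) + \<mu> (A - F) \<le> \<mu> (A \<inter> F) + (\<mu> (D n) + ennreal e)"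
      by (simp add: add_left_mono)
    also have "\<dots> \<le> \<mu> A + ennreal e" using AF[of n] by (simp add: add.assoc[symmetric] add_right_mono)
    finally show "\<mu> (A \<inter> F) + \<mu> (A - F) \<le> \<mu> A + ennreal e" .
  qed
qed

theorem metric_outer_measure_borel:
  assumes "metric_outer_measure \<mu>"
  shows "measure_space UNIV (sets borel) \<mu>"
proof -
  interpret sigma_algebra UNIV "UNIV :: 'a set set" by (metis Pow_UNIV sigma_algebra_Pow)
  have empty: "\<mu> {} = 0" and mono: "\<And>A B. A \<subseteq> B \<Longrightarrow> \<mu> A \<le> \<mu> B"
    and sub: "\<And>A::nat \<Rightarrow> 'a set. \<mu> (\<Union>i. A i) \<le> (\<Sum>i. \<mu> (A i))"
    using assms unfolding metric_outer_measure_def by blast+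
  have "outer_measure_space UNIV \<mu>"
    unfolding outer_measure_space_def positive_def increasing_def countably_subadditive_def
    using empty mono sub by auto
  from caratheodory_lemma[OF this]
  have ms: "measure_space UNIV (lambda_system UNIV UNIV \<mu>) \<mu>" .
  have closed: "F \<in> lambda_system UNIV UNIV \<mu>" if "closed F" for F
  proof -
    have "\<mu> (F \<inter> A) + \<mu> ((UNIV - F) \<inter> A) = \<mu> A" for A
    proof (rule antisym)
      show "\<mu> (F \<inter> A) + \<mu> ((UNIV - F) \<inter> A) \<le> \<mu> A"
        using metric_outer_measure_closed[OF assms that, of A]
        by (simp add: Int_commute Diff_eq)
      have "\<mu> A \<le> \<mu> ((F \<inter> A) \<union> ((UNIV - F) \<inter> A))" by (rule mono) auto
      also have "\<dots> \<le> \<mu> (F \<inter> A) + \<mu> ((UNIV - F) \<inter> A)" by (rule outer_Un_le[where \<mu>=\<mu>, OF empty sub])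
      finally show "\<mu> A \<le> \<mu> (F \<inter> A) + \<mu> ((UNIV - F) \<inter> A)" .
    qed
    then show ?thesis by (simp add: lambda_system_def)
  qed
  have "sigma_algebra UNIV (lambda_system UNIV UNIV \<mu>)" using ms by (simp add: measure_space_def)
  then have "sets borel \<subseteq> lambda_system UNIV UNIV \<mu>"
    unfolding borel_eq_closed using closed
    by (simp add: sigma_algebra.sigma_sets_subset subset_iff[of "Collect closed"])
  moreover have "sigma_algebra UNIV (sets (borel :: 'a measure))"
    by (metis sets.sigma_algebra_axioms space_borel)
  ultimately show ?thesis using measure_down[OF ms] by blast
qed

lemma sets_measure_of_borel: "sets (measure_of UNIV (sets borel) \<mu>) = sets borel"
  by (metis sets.sets_measure_of_eq space_borel)

corollary emeasure_metric_outer_measure: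
  assumes "metric_outer_measure \<mu>" "A \<in> sets borel"
  shows "emeasure (measure_of UNIV (sets borel) \<mu>) A = \<mu> A"
proof (rule emeasure_measure_of[OF refl])
  have "measure_space UNIV (sets borel) \<mu>" by (rule metric_outer_measure_borel[OF assms(1)])
  then show "positive (sets (measure_of UNIV (sets borel) \<mu>)) \<mu>"
    "countably_additive (sets (measure_of UNIV (sets borel) \<mu>)) \<mu>"
    by (auto simp: measure_space_def sets_measure_of_borel)
qed (use assms in \<open>auto simp: sets_measure_of_borel\<close>)

section \<open>Hausdorff measure\<close>

lemma hausdorff_gauge_empty [simp]: "hausdorff_gauge m {} = 0"
  by (simp add: hausdorff_gauge_def)

lemma hausdorff_gauge_mono:
  assumes "A \<subseteq> B" "bounded B" shows "hausdorff_gauge m A \<le> hausdorff_gauge m B"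
proof (cases "A = {}")
  case False
  then show ?thesis
    using assms diameter_subset[OF assms] diameter_ge_0[OF bounded_subset[OF assms(2,1)]]
    by (auto simp: hausdorff_gauge_def intro!: ennreal_leI mult_left_mono power_mono)
qed auto

lemma hausdorff_size_le:
  assumes "A \<subseteq> (\<Union>i. C i)" "\<And>i::nat. bounded (C i)" "\<And>i. diameter (C i) \<le> \<delta>"
  shows "hausdorff_size m \<delta> A \<le> (\<Sum>i. hausdorff_gauge m (C i))"
  unfolding hausdorff_size_def using assms by (intro INF_lower) auto

lemma hausdorff_size_cover:
  assumes "hausdorff_size m \<delta> A < c"
  obtains C :: "nat \<Rightarrow> (real^'n) set" where "A \<subseteq> (\<Union>i. C i)" "\<And>i. bounded (C i)"
    "\<And>i. diameter (C i) \<le> \<delta>" "(\<Sum>i. hausdorff_gauge m (C i)) < c"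
  using assms unfolding hausdorff_size_def INF_less_iff by auto

lemma hausdorff_size_mono: "A \<subseteq> B \<Longrightarrow> hausdorff_size m \<delta> A \<le> hausdorff_size m \<delta> B"
  unfolding hausdorff_size_def by (intro INF_superset_mono) auto

lemma hausdorff_size_antimono: "\<delta> \<le> \<epsilon> \<Longrightarrow> hausdorff_size m \<epsilon> A \<le> hausdorff_size m \<delta> A"
  unfolding hausdorff_size_def by (intro INF_superset_mono) (auto intro: order_trans)

lemma hausdorff_size_le_outer: "0 < \<delta> \<Longrightarrow> hausdorff_size m \<delta> A \<le> hausdorff_outer_measure m A"
  unfolding hausdorff_outer_measure_def by (intro SUP_upper) auto

lemma hausdorff_size_UN:
  fixes A :: "nat \<Rightarrow> (real^'n) set"
  shows "hausdorff_size m \<delta> (\<Union>i. A i) \<le> (\<Sum>i. hausdorff_size m \<delta> (A i))"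
proof (rule ennreal_le_epsilon)
  fix e :: real assume "(\<Sum>i. hausdorff_size m \<delta> (A i)) < top" "0 < e"
  define d where "d i = ennreal (e * (1/2) ^ Suc i)" for i
  have fin: "hausdorff_size m \<delta> (A i) < top" for i
    using \<open>(\<Sum>i. hausdorff_size m \<delta> (A i)) < top\<close> ennreal_suminf_lessD by blast
  have "\<exists>C::nat \<Rightarrow> (real^'n) set. A i \<subseteq> (\<Union>j. C j) \<and> (\<forall>j. bounded (C j) \<and> diameter (C j) \<le> \<delta>) \<and>
          (\<Sum>j. hausdorff_gauge m (C j)) \<le> hausdorff_size m \<delta> (A i) + d i" for i
  proof -
    have "hausdorff_size m \<delta> (A i) < hausdorff_size m \<delta> (A i) + d i"
      using fin[of i] \<open>0 < e\<close>
      by (cases "hausdorff_size m \<delta> (A i)")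
         (auto simp: d_def ennreal_plus[symmetric] ennreal_less_iff simp del: ennreal_plus)
    then show ?thesis by (metis hausdorff_size_cover less_imp_le)
  qed
  then obtain C :: "nat \<Rightarrow> nat \<Rightarrow> (real^'n) set" where C: "\<And>i. A i \<subseteq> (\<Union>j. C i j)"
    "\<And>i j. bounded (C i j)" "\<And>i j. diameter (C i j) \<le> \<delta>"
    "\<And>i. (\<Sum>j. hausdorff_gauge m (C i j)) \<le> hausdorff_size m \<delta> (A i) + d i"
    by metis
  define D where "D k = (case prod_decode k of (i, j) \<Rightarrow> C i j)" for k
  have "hausdorff_size m \<delta> (\<Union>i. A i) \<le> (\<Sum>k. hausdorff_gauge m (D k))"
  proof (rule hausdorff_size_le)
    show "(\<Union>i. A i) \<subseteq> (\<Union>k. D k)"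
    proof
      fix x assume "x \<in> (\<Union>i. A i)"
      then obtain i j where "x \<in> C i j" using C(1) by blast
      then have "x \<in> D (prod_encode (i, j))" by (simp add: D_def)
      then show "x \<in> (\<Union>k. D k)" by blast
    qed
  qed (auto simp: D_def C split: prod.split)
  also have "\<dots> = (\<Sum>i. \<Sum>j. hausdorff_gauge m (C i j))"
    using suminf_ennreal_2dimen[of "\<lambda>i. \<Sum>j. hausdorff_gauge m (C i j)" "\<lambda>(i,j). hausdorff_gauge m (C i j)"]
    by (simp add: D_def split_beta)
  also have "\<dots> \<le> (\<Sum>i. hausdorff_size m \<delta> (A i) + d i)" by (intro suminf_le C summableI)
  also have "\<dots> = (\<Sum>i. hausdorff_size m \<delta> (A i)) + (\<Sum>i. d i)" by (intro suminf_add[symmetric] summableI)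
  also have "(\<Sum>i. d i) = ennreal e"
    unfolding d_def using sums_mult[OF power_half_series, of e] \<open>0 < e\<close>
    by (subst suminf_ennreal2) (auto simp: sums_iff)
  finally show "hausdorff_size m \<delta> (\<Union>i. A i) \<le> (\<Sum>i. hausdorff_size m \<delta> (A i)) + ennreal e" .
qed

lemma hausdorff_outer_measure_mono: "A \<subseteq> B \<Longrightarrow> hausdorff_outer_measure m A \<le> hausdorff_outer_measure m B"
  unfolding hausdorff_outer_measure_def by (intro SUP_mono) (auto intro: hausdorff_size_mono)

lemma hausdorff_outer_measure_empty [simp]: "hausdorff_outer_measure m {} = 0"
proof -
  have "hausdorff_size m \<delta> {} = 0" if "0 < \<delta>" for \<delta>
    using hausdorff_size_le[of "{}" "\<lambda>_. {}" \<delta> m] that by simp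
  then have "hausdorff_outer_measure m {} = (SUP \<delta>\<in>{0::real<..}. 0)"
    unfolding hausdorff_outer_measure_def by (intro SUP_cong) auto
  then show ?thesis by simp
qed

text \<open>At scales below the distance \<open>d\<close> no covering set meets both
  \<open>A\<close> and \<open>B\<close>, so a covering of the union splits into coverings of the two
  parts without loss.\<close>

lemma metric_outer_measure_hausdorff: "metric_outer_measure (hausdorff_outer_measure m)"
  unfolding metric_outer_measure_def
proof (intro conjI allI impI; (elim conjE)?)
  fix A :: "nat \<Rightarrow> (real^'n) set"
  show "hausdorff_outer_measure m (\<Union>i. A i) \<le> (\<Sum>i. hausdorff_outer_measure m (A i))"
    unfolding hausdorff_outer_measure_def[of m "\<Union>i. A i"]
  proof (rule SUP_least)
    fix \<delta> :: real assume "\<delta> \<in> {0<..}"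
    then show "hausdorff_size m \<delta> (\<Union>i. A i) \<le> (\<Sum>i. hausdorff_outer_measure m (A i))"
      by (intro order_trans[OF hausdorff_size_UN] suminf_le summableI hausdorff_size_le_outer) auto
  qed
next
  fix A B :: "(real^'n) set" and d :: real
  assume d: "0 < d" "\<forall>x\<in>A. \<forall>y\<in>B. d \<le> dist x y"
  have small: "hausdorff_size m \<delta> A + hausdorff_size m \<delta> B \<le> hausdorff_size m \<delta> (A \<union> B)"
    if "0 < \<delta>" "\<delta> < d" for \<delta>
    unfolding hausdorff_size_def[of m \<delta> "A \<union> B"]
  proof (rule INF_greatest, clarsimp)
    fix C :: "nat \<Rightarrow> (real^'n) set"
    assume C: "A \<subseteq> (\<Union>i. C i)" "B \<subseteq> (\<Union>i. C i)" "\<forall>i. bounded (C i) \<and> diameter (C i) \<le> \<delta>"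
    \<comment> \<open>The sets meeting \<open>A\<close> go to \<open>A\<close>, all others to
      \<open>B\<close>; padding with the empty set is free because its gauge is 0.\<close>
    let ?A = "\<lambda>i. if C i \<inter> A = {} then {} else C i" and ?B = "\<lambda>i. if C i \<inter> A = {} then C i else {}"
    have "hausdorff_size m \<delta> A \<le> (\<Sum>i. hausdorff_gauge m (?A i))"
      using C that by (intro hausdorff_size_le) (auto, blast)
    moreover have "hausdorff_size m \<delta> B \<le> (\<Sum>i. hausdorff_gauge m (?B i))"
    proof (rule hausdorff_size_le)
      show "B \<subseteq> (\<Union>i. ?B i)"
      proof
        fix y assume "y \<in> B"
        then obtain i where i: "y \<in> C i" using C by blast
        have "C i \<inter> A = {}"
        proof (rule ccontr)
          assume "C i \<inter> A \<noteq> {}"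
          then obtain x where "x \<in> C i" "x \<in> A" by blast
          then have "dist x y \<le> \<delta>" using diameter_bounded_bound[of "C i" x y] C(3) i by (meson order_trans)
          then show False using d \<open>x \<in> A\<close> \<open>y \<in> B\<close> that by force
        qed
        then show "y \<in> (\<Union>i. ?B i)" using i by auto
      qed
    qed (use C that in auto)
    ultimately have "hausdorff_size m \<delta> A + hausdorff_size m \<delta> B \<le>
      (\<Sum>i. hausdorff_gauge m (?A i)) + (\<Sum>i. hausdorff_gauge m (?B i))" by (rule add_mono)
    also have "\<dots> = (\<Sum>i. hausdorff_gauge m (?A i) + hausdorff_gauge m (?B i))"
      by (intro suminf_add summableI)
    also have "\<dots> = (\<Sum>i. hausdorff_gauge m (C i))" by (intro suminf_cong) simp
    finally show "hausdorff_size m \<delta> A + hausdorff_size m \<delta> B \<le> (\<Sum>i. hausdorff_gauge m (C i))" .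
  qed
  have "hausdorff_size m \<delta> A + hausdorff_size m \<epsilon> B \<le> hausdorff_outer_measure m (A \<union> B)"
    if "0 < \<delta>" "0 < \<epsilon>" for \<delta> \<epsilon>
  proof -
    \<comment> \<open>The two suprema run over scales of their own; a common finer scale below
      \<open>d\<close> dominates both.\<close>
    define \<eta> where "\<eta> = Min {\<delta>, \<epsilon>, d / 2}"
    have \<eta>: "0 < \<eta>" "\<eta> < d" "\<eta> \<le> \<delta>" "\<eta> \<le> \<epsilon>" using that d by (auto simp: \<eta>_def min_def)
    have "hausdorff_size m \<delta> A + hausdorff_size m \<epsilon> B \<le> hausdorff_size m \<eta> A + hausdorff_size m \<eta> B"
      by (intro add_mono hausdorff_size_antimono \<eta>)
    also have "\<dots> \<le> hausdorff_size m \<eta> (A \<union> B)" by (rule small) fact+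
    also have "\<dots> \<le> hausdorff_outer_measure m (A \<union> B)" by (rule hausdorff_size_le_outer) fact
    finally show ?thesis .
  qed
  then show "hausdorff_outer_measure m A + hausdorff_outer_measure m B \<le> hausdorff_outer_measure m (A \<union> B)"
    unfolding hausdorff_outer_measure_def[of m A] hausdorff_outer_measure_def[of m B]
    by (simp add: ennreal_SUP_add_left[symmetric] ennreal_SUP_add_right del: SUP_le_iff)
       (auto intro!: SUP_least)
qed (auto intro: hausdorff_outer_measure_mono)

lemma sets_hausdorff_measure [simp, measurable_cong]: "sets (hausdorff_measure m) = sets borel"
  by (simp add: hausdorff_measure_def sets_measure_of_borel)

lemma space_hausdorff_measure [simp]: "space (hausdorff_measure m) = UNIV"
  by (simp add: hausdorff_measure_def)

lemma emeasure_hausdorff_measure: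
  "A \<in> sets borel \<Longrightarrow> emeasure (hausdorff_measure m) A = hausdorff_outer_measure m A"
  unfolding hausdorff_measure_def
  by (rule emeasure_metric_outer_measure[OF metric_outer_measure_hausdorff])

lemma hausdorff_gauge_lipschitz_image:
  fixes f :: "real^'n \<Rightarrow> real^'k"
  assumes L: "L-lipschitz_on X f" and X: "bounded X"
  shows "bounded (f ` X)" "diameter (f ` X) \<le> L * diameter X"
    "hausdorff_gauge m (f ` X) \<le> ennreal (L ^ m) * hausdorff_gauge m X"
proof -
  have L0: "0 \<le> L" using L by (rule lipschitz_on_nonneg)
  have d: "dist (f x) (f y) \<le> L * diameter X" if "x \<in> X" "y \<in> X" for x y
    using lipschitz_onD[OF L that] diameter_bounded_bound[OF X that] L0
    by (meson mult_left_mono order_trans)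
  show b: "bounded (f ` X)"
    by (metis L X bounded_uniformly_continuous_image lipschitz_on_uniformly_continuous)
  show di: "diameter (f ` X) \<le> L * diameter X"
    using d L0 diameter_ge_0[OF X] by (intro diameter_le) (auto simp: dist_norm)
  show "hausdorff_gauge m (f ` X) \<le> ennreal (L ^ m) * hausdorff_gauge m X"
  proof -
    have "unit_ball_vol (real m) * (diameter (f ` X) / 2) ^ m \<le> unit_ball_vol (real m) * (L * (diameter X / 2)) ^ m"
      using di diameter_ge_0[OF b] by (intro mult_left_mono power_mono) auto
    also have "\<dots> = L ^ m * (unit_ball_vol (real m) * (diameter X / 2) ^ m)"
      by (simp only: power_mult_distrib) (simp add: ac_simps)
    finally show ?thesis using L0 diameter_ge_0[OF X]
      by (auto simp: hausdorff_gauge_def ennreal_mult[symmetric] intro!: ennreal_leI)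
  qed
qed

lemma hausdorff_outer_measure_lipschitz_image:
  fixes f :: "real^'n \<Rightarrow> real^'k"
  assumes L: "L-lipschitz_on A f" and pos: "0 < L"
  shows "hausdorff_outer_measure m (f ` A) \<le> ennreal (L ^ m) * hausdorff_outer_measure m A"
  unfolding hausdorff_outer_measure_def[of m "f ` A"]
proof (rule SUP_least)
  fix \<delta> :: real assume "\<delta> \<in> {0<..}"
  have L0: "0 \<le> L" using L by (rule lipschitz_on_nonneg)
  define \<epsilon> where "\<epsilon> = \<delta> / (L + 1)"
  have \<epsilon>: "0 < \<epsilon>" "L * \<epsilon> \<le> \<delta>" using L0 \<open>\<delta> \<in> _\<close> by (auto simp: \<epsilon>_def field_simps)
  have "hausdorff_size m \<delta> (f ` A) \<le> ennreal (L ^ m) * hausdorff_size m \<epsilon> A"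
  proof -
    have "hausdorff_size m \<delta> (f ` A) \<le> ennreal (L ^ m) * (\<Sum>i. hausdorff_gauge m (C i))"
      if C: "A \<subseteq> (\<Union>i. C i)" "\<forall>i::nat. bounded (C i) \<and> diameter (C i) \<le> \<epsilon>" for C
    proof -
      have b: "bounded (C i \<inter> A)" for i using C by (meson bounded_Int)
      have d: "diameter (C i \<inter> A) \<le> diameter (C i)" for i using C by (intro diameter_subset) auto
      have l: "L-lipschitz_on (C i \<inter> A) f" for i using lipschitz_on_subset[OF L] by blast
      have "hausdorff_size m \<delta> (f ` A) \<le> (\<Sum>i. hausdorff_gauge m (f ` (C i \<inter> A)))"
      proof (rule hausdorff_size_le)
        show "f ` A \<subseteq> (\<Union>i. f ` (C i \<inter> A))" using C(1) by blast
        show "bounded (f ` (C i \<inter> A))" for i by (rule hausdorff_gauge_lipschitz_image[OF l b])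
        show "diameter (f ` (C i \<inter> A)) \<le> \<delta>" for i
          using hausdorff_gauge_lipschitz_image(2)[OF l[of i] b] d[of i] C(2) L0 \<epsilon>(2)
          by (meson mult_left_mono order_trans)
      qed
      also have "\<dots> \<le> (\<Sum>i. ennreal (L ^ m) * hausdorff_gauge m (C i))"
        using C(2) by (intro suminf_le summableI order_trans[OF hausdorff_gauge_lipschitz_image(3)[OF l b]]
            mult_left_mono hausdorff_gauge_mono) auto
      finally show ?thesis by simp
    qed
    note * = this
    \<comment> \<open>The factor is moved to the left so that the infimum over coverings of
      \<open>A\<close> only has to be bounded from below; the multiplication is undone
      afterwards.\<close>
    have "ennreal (1 / L ^ m) * hausdorff_size m \<delta> (f ` A) \<le> hausdorff_size m \<epsilon> A"
      unfolding hausdorff_size_def[of m \<epsilon>]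
    proof (rule INF_greatest)
      fix C :: "nat \<Rightarrow> (real^'n) set"
      assume "C \<in> {C. A \<subseteq> (\<Union>i. C i) \<and> (\<forall>i. bounded (C i) \<and> diameter (C i) \<le> \<epsilon>)}"
      then have "ennreal (1 / L ^ m) * hausdorff_size m \<delta> (f ` A)
          \<le> ennreal (1 / L ^ m) * (ennreal (L ^ m) * (\<Sum>i. hausdorff_gauge m (C i)))"
        by (intro mult_left_mono *) auto
      also have "\<dots> = (\<Sum>i. hausdorff_gauge m (C i))"
        using pos by (simp add: mult.assoc[symmetric] ennreal_mult[symmetric])
      finally show "ennreal (1 / L ^ m) * hausdorff_size m \<delta> (f ` A) \<le> (\<Sum>i. hausdorff_gauge m (C i))" .
    qed
    then have "ennreal (L ^ m) * (ennreal (1 / L ^ m) * hausdorff_size m \<delta> (f ` A))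
        \<le> ennreal (L ^ m) * hausdorff_size m \<epsilon> A" by (rule mult_left_mono) auto
    then show ?thesis
      using pos by (simp add: mult.assoc[symmetric] ennreal_mult[symmetric])
  qed
  also have "\<dots> \<le> ennreal (L ^ m) * hausdorff_outer_measure m A"
    by (intro mult_left_mono hausdorff_size_le_outer \<epsilon>) auto
  finally show "hausdorff_size m \<delta> (f ` A) \<le> ennreal (L ^ m) * hausdorff_outer_measure m A" .
qed

text \<open>Uniqueness of Haar measure by Fubini. The double integral of
  \<open>indicator A x * indicator B (x + y)\<close> equals
  \<open>emeasure M A * emeasure lborel B\<close> if \<open>y\<close> is integrated first. If
  \<open>x\<close> comes first and is translated by \<open>- y\<close>, the same integral turns into
  \<open>emeasure M B * emeasure lborel A\<close>.\<close>

lemma translation_invariant_eq_lborel: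
  fixes M :: "'a::euclidean_space measure"
  assumes M: "sigma_finite_measure M" "sets M = sets borel" "\<And>c. distr M borel ((+) c) = M"
    and A: "A \<in> sets borel" and B: "B \<in> sets borel" "emeasure lborel B = 1"
  shows "emeasure M A = emeasure M B * emeasure lborel A"
proof -
  interpret M: sigma_finite_measure M by fact
  interpret P: pair_sigma_finite M lborel ..
  note [measurable] = A B(1)
  note [measurable_cong] = M(2)
  have shift: "(\<integral>\<^sup>+x. f (c + x) \<partial>M) = (\<integral>\<^sup>+x. f x \<partial>M)" if [measurable]: "f \<in> borel_measurable borel" for f c
  proof -
    have "(\<integral>\<^sup>+x. f x \<partial>M) = (\<integral>\<^sup>+x. f x \<partial>distr M borel ((+) c))" by (simp add: M(3))
    also have "\<dots> = (\<integral>\<^sup>+x. f (c + x) \<partial>M)" by (intro nn_integral_distr) auto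
    finally show ?thesis by simp
  qed
  have shiftL: "(\<integral>\<^sup>+x. f (c + x) \<partial>lborel) = (\<integral>\<^sup>+x. f x \<partial>lborel)"
    if [measurable]: "f \<in> borel_measurable borel" for f and c :: 'a
  proof -
    have "(\<integral>\<^sup>+x. f x \<partial>lborel) = (\<integral>\<^sup>+x. f x \<partial>distr lborel borel ((+) c))" by (simp add: lborel_distr_plus)
    also have "\<dots> = (\<integral>\<^sup>+x. f (c + x) \<partial>lborel)" by (intro nn_integral_distr) auto
    finally show ?thesis by simp
  qed
  have reflL: "(\<integral>\<^sup>+x. f (- x) \<partial>lborel) = (\<integral>\<^sup>+x. f x \<partial>lborel)"
    if [measurable]: "f \<in> borel_measurable borel" for f :: "'a \<Rightarrow> ennreal"
  proof -
    have "(\<integral>\<^sup>+x. f x \<partial>lborel) = (\<integral>\<^sup>+x. f x \<partial>distr lborel borel uminus)"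
      using lborel_affine[of "-1" "0::'a"] by (simp add: density_1)
    also have "\<dots> = (\<integral>\<^sup>+x. f (- x) \<partial>lborel)" by (intro nn_integral_distr) auto
    finally show ?thesis by simp
  qed
  have "emeasure M A * emeasure lborel B = (\<integral>\<^sup>+x. indicator A x * (\<integral>\<^sup>+y. indicator B (x + y) \<partial>lborel) \<partial>M)"
    by (simp add: shiftL[of "indicator B"] nn_integral_multc B(2))
  also have "\<dots> = (\<integral>\<^sup>+x. (\<integral>\<^sup>+y. indicator A x * indicator B (x + y) \<partial>lborel) \<partial>M)"
    by (intro nn_integral_cong) (simp add: nn_integral_cmult)
  also have "\<dots> = (\<integral>\<^sup>+y. (\<integral>\<^sup>+x. indicator A x * indicator B (x + y) \<partial>M) \<partial>lborel)"
    by (rule P.Fubini'[symmetric]) measurable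
  also have "\<dots> = (\<integral>\<^sup>+y. (\<integral>\<^sup>+x. indicator A (x - y) * indicator B x \<partial>M) \<partial>lborel)"
  proof (rule nn_integral_cong)
    fix y :: 'a
    show "(\<integral>\<^sup>+x. indicator A x * indicator B (x + y) \<partial>M) = (\<integral>\<^sup>+x. indicator A (x - y) * indicator B x \<partial>M)"
      using shift[of "\<lambda>x. indicator A (x - y) * indicator B x" y] by (simp add: add.commute)
  qed
  also have "\<dots> = (\<integral>\<^sup>+x. (\<integral>\<^sup>+y. indicator A (x - y) * indicator B x \<partial>lborel) \<partial>M)"
    by (rule P.Fubini') measurable
  also have "\<dots> = (\<integral>\<^sup>+x. (\<integral>\<^sup>+y. indicator A (x - y) \<partial>lborel) * indicator B x \<partial>M)"
    by (intro nn_integral_cong) (simp add: nn_integral_multc)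
  also have "(\<lambda>x. \<integral>\<^sup>+y. indicator A (x - y) \<partial>lborel) = (\<lambda>x. emeasure lborel A)"
  proof
    fix x :: 'a
    have "(\<integral>\<^sup>+y. indicator A (x - y) \<partial>lborel) = (\<integral>\<^sup>+y. indicator A (x + y) \<partial>lborel)"
      using reflL[of "\<lambda>y. indicator A (x + y)"] by simp
    also have "\<dots> = emeasure lborel A" by (simp add: shiftL[of "indicator A"])
    finally show "(\<integral>\<^sup>+y. indicator A (x - y) \<partial>lborel) = emeasure lborel A" .
  qed
  finally have "emeasure M A * emeasure lborel B = (\<integral>\<^sup>+x. emeasure lborel A * indicator B x \<partial>M)"
    by (simp add: mult.commute)
  then show ?thesis by (simp add: nn_integral_cmult B(2)) (simp add: mult.commute)
qed

section \<open>The horizontal plane in space and its Hausdorff measure\<close>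

definition flat :: "real \<times> real \<Rightarrow> real^3" where
  "flat p = vector [fst p, snd p, 0]"

definition shadow :: "real^3 \<Rightarrow> real \<times> real" where
  "shadow z = (z $ 1, z $ 2)"

lemma flat_nth [simp]: "flat p $ 1 = fst p" "flat p $ 2 = snd p" "flat p $ 3 = 0"
  by (simp_all add: flat_def)

lemma shadow_flat [simp]: "shadow (flat p) = p"
  by (simp add: shadow_def)

lemma flat_arith: "flat p + flat q = flat (p + q)" "flat p - flat q = flat (p - q)"
  "c *\<^sub>R flat p = flat (c *\<^sub>R p)"
  by (simp_all add: vec_eq_iff forall_3)

lemma norm_vec3: "norm (z :: real^3) = sqrt ((z $ 1)\<^sup>2 + (z $ 2)\<^sup>2 + (z $ 3)\<^sup>2)"
  by (simp add: norm_vec_def L2_set_def sum_3)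

lemma norm_flat [simp]: "norm (flat p) = norm p"
  by (simp add: norm_vec3 norm_prod_def)

lemma dist_flat [simp]: "dist (flat p) (flat q) = dist p q"
  by (simp add: dist_norm flat_arith)

lemma norm_shadow_le: "norm (shadow z) \<le> norm z"
  by (simp add: norm_vec3 shadow_def norm_prod_def)

lemma shadow_diff: "shadow (y - z) = shadow y - shadow z"
  by (simp add: shadow_def)

lemma dist_shadow_le: "dist (shadow y) (shadow z) \<le> dist y z"
  using norm_shadow_le[of "y - z"] by (simp add: dist_norm shadow_diff)

lemma continuous_on_flat: "continuous_on A flat"
  by (intro Lipschitz.lipschitz_on_continuous_on[of 1] lipschitz_onI) auto

lemma continuous_on_shadow: "continuous_on A shadow"
  by (intro Lipschitz.lipschitz_on_continuous_on[of 1] lipschitz_onI) (auto simp: dist_shadow_le)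

lemma measurable_flat [measurable]: "flat \<in> borel_measurable borel"
  by (intro borel_measurable_continuous_onI continuous_on_flat)

lemma measurable_shadow [measurable]: "shadow \<in> borel_measurable borel"
  by (intro borel_measurable_continuous_onI continuous_on_shadow)

lemma flat_image_eq: "flat ` A = shadow -` A \<inter> {z. z $ 3 = 0}"
proof -
  have "z = flat (shadow z)" if "z $ 3 = 0" for z
    using that by (simp add: vec_eq_iff forall_3 shadow_def)
  then show ?thesis by force
qed

lemma sets_flat_image [measurable]:
  assumes [measurable]: "A \<in> sets borel" shows "flat ` A \<in> sets borel"
proof -
  have "{z :: real^3. z $ 3 = 0} \<in> sets borel" by (intro borel_closed closed_Collect_eq continuous_intros)
  then show ?thesis unfolding flat_image_eq using measurable_sets[OF measurable_shadow assms] by auto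
qed

text \<open>Since \<open>shadow\<close> inverts \<open>flat\<close> on the plane, this pushforward
  gives a planar set the \<open>H\<^sup>2\<close> measure of its flat copy, and it is a measure by
  construction.\<close>

definition plane_measure :: "(real \<times> real) measure" where
  "plane_measure = distr (density (hausdorff_measure 2) (indicator (range flat))) borel shadow"

lemma sets_plane_measure [simp, measurable_cong]: "sets plane_measure = sets borel"
  by (simp add: plane_measure_def)

lemma space_plane_measure [simp]: "space plane_measure = UNIV"
  by (simp add: plane_measure_def)

lemma emeasure_plane_measure:
  assumes [measurable]: "A \<in> sets borel"
  shows "emeasure plane_measure A = hausdorff_outer_measure 2 (flat ` A)"
proof -
  have [measurable]: "range flat \<in> sets borel" using sets_flat_image[of UNIV] by simp
  have "emeasure plane_measure A =
      (\<integral>\<^sup>+z. indicator (range flat) z * indicator (shadow -` A) z \<partial>hausdorff_measure 2)"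
    unfolding plane_measure_def using measurable_sets[OF measurable_shadow assms]
    by (simp add: emeasure_distr emeasure_density)
  also have "\<dots> = (\<integral>\<^sup>+z. indicator (flat ` A) z \<partial>hausdorff_measure 2)"
    by (intro nn_integral_cong) (auto simp: indicator_def)
  also have "\<dots> = hausdorff_outer_measure 2 (flat ` A)"
    by (simp add: emeasure_hausdorff_measure)
  finally show ?thesis .
qed

text \<open>A horizontal translation and its inverse are both 1-Lipschitz, and 1-Lipschitz maps do
  not increase Hausdorff measure.\<close>

lemma plane_measure_translate: "distr plane_measure borel ((+) c) = plane_measure"
proof (rule measure_eqI)
  fix A assume "A \<in> sets (distr plane_measure borel ((+) c))"
  then have [measurable]: "A \<in> sets borel" by simp
  have pre: "(+) c -` A = (\<lambda>x. x - c) ` A"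
  proof (intro set_eqI iffI)
    show "x \<in> (\<lambda>x. x - c) ` A" if "x \<in> (+) c -` A" for x
      by (rule image_eqI[of _ _ "c + x"]) (use that in auto)
  qed auto
  have le: "hausdorff_outer_measure 2 (flat ` (\<lambda>x. x + d) ` A) \<le> hausdorff_outer_measure 2 (flat ` A)" for A d
  proof -
    have "1-lipschitz_on (flat ` A) (\<lambda>z. z + flat d)" by (intro lipschitz_onI) auto
    moreover have "(\<lambda>z. z + flat d) ` (flat ` A) = flat ` (\<lambda>x. x + d) ` A"
      by (simp add: image_image flat_arith)
    ultimately show ?thesis using hausdorff_outer_measure_lipschitz_image[of 1 "flat ` A" "\<lambda>z. z + flat d" 2] by simp
  qed
  have "hausdorff_outer_measure 2 (flat ` ((+) c -` A)) = hausdorff_outer_measure 2 (flat ` A)"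
  proof (rule antisym)
    show "hausdorff_outer_measure 2 (flat ` ((+) c -` A)) \<le> hausdorff_outer_measure 2 (flat ` A)"
      using le[of "- c" A] by (simp add: pre)
    have "(\<lambda>x. x + c) ` (\<lambda>x. x - c) ` A = A" by (simp add: image_image)
    then show "hausdorff_outer_measure 2 (flat ` A) \<le> hausdorff_outer_measure 2 (flat ` ((+) c -` A))"
      using le[of c "(\<lambda>x. x - c) ` A"] by (simp add: pre)
  qed
  moreover have "(+) c -` A \<in> sets borel"
    using measurable_sets[of "(+) c" borel borel A] by auto
  ultimately show "emeasure (distr plane_measure borel ((+) c)) A = emeasure plane_measure A"
    by (simp add: emeasure_distr emeasure_plane_measure)
qed simp

definition unit_square :: "(real \<times> real) set" where "unit_square = {0..<1} \<times> {0..<1}"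

lemma sets_unit_square [measurable]: "unit_square \<in> sets borel"
  unfolding unit_square_def by (simp add: borel_prod[symmetric])

lemma emeasure_unit_square: "emeasure lborel unit_square = 1"
  unfolding unit_square_def lborel_prod[symmetric]
  by (subst lborel.emeasure_pair_measure_Times) auto

lemma dist_prod_le: "dist p q \<le> \<bar>fst p - fst q\<bar> + \<bar>snd p - snd q\<bar>" for p q :: "real \<times> real"
  using sqrt_sum_squares_le_sum_abs[of "fst p - fst q" "snd p - snd q"]
  by (simp add: dist_prod_def dist_real_def)

text \<open>\<open>N * N\<close> cells of side \<open>1 / N\<close> have diameter at most
  \<open>2 / N\<close>, and then their gauges add up to at most \<open>unit_ball_vol 2\<close> for
  every \<open>N\<close>. The crude diameter bound suffices, as only finiteness is at stake.\<close>

lemma hausdorff_size_unit_square: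
  assumes "0 < \<delta>"
  shows "hausdorff_size 2 \<delta> (flat ` unit_square) \<le> ennreal (unit_ball_vol 2)"
proof -
  obtain N :: nat where N: "2 / \<delta> < real N" using reals_Archimedean2 by blast
  moreover have "0 < 2 / \<delta>" using assms by simp
  ultimately have "0 < real N" by linarith
  then have N0: "0 < N" "2 / real N < \<delta>"
    using assms N by (simp, simp add: pos_divide_less_eq mult.commute)
  \<comment> \<open>The number \<open>i\<close> encodes a cell by its quotient and remainder modulo
    \<open>N\<close>.\<close>
  define S where "S i = {real (i div N) / N..<(real (i div N) + 1) / N} \<times>
    {real (i mod N) / N..<(real (i mod N) + 1) / N}" for i
  have dS: "dist p q \<le> 2 / N" if "p \<in> S i" "q \<in> S i" for p q i
  proof -
    have "\<bar>fst p - fst q\<bar> \<le> 1 / N" "\<bar>snd p - snd q\<bar> \<le> 1 / N"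
      using that N0 by (auto simp: S_def add_divide_distrib)
    then show ?thesis using dist_prod_le[of p q] by simp
  qed
  define C where "C i = (if i < N * N then flat ` S i else {})" for i
  have dC: "dist x y \<le> 2 / N" if "x \<in> C i" "y \<in> C i" for x y i
    using that dS by (auto simp: C_def split: if_splits)
  have bC: "bounded (C i)" for i unfolding bounded_def using dC by blast
  have diC: "diameter (C i) \<le> 2 / N" for i using dC by (intro diameter_le) (auto simp: dist_norm)
  have g: "hausdorff_gauge 2 (C i) \<le> ennreal (unit_ball_vol 2 / N\<^sup>2)" for i
  proof -
    have "unit_ball_vol 2 * (diameter (C i) / 2)\<^sup>2 \<le> unit_ball_vol 2 * (1 / N)\<^sup>2"
      using diC[of i] diameter_ge_0[OF bC] by (intro mult_left_mono power_mono) auto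
    then show ?thesis by (auto simp: hausdorff_gauge_def power_divide intro!: ennreal_leI)
  qed
  have "hausdorff_size 2 \<delta> (flat ` unit_square) \<le> (\<Sum>i. hausdorff_gauge 2 (C i))"
  proof (rule hausdorff_size_le)
    show "flat ` unit_square \<subseteq> (\<Union>i. C i)"
    proof (rule image_subsetI)
      fix p assume p: "p \<in> unit_square"
      define a b where "a = nat \<lfloor>fst p * N\<rfloor>" and "b = nat \<lfloor>snd p * N\<rfloor>"
      have ab: "real a \<le> fst p * N" "fst p * N < real a + 1" "real b \<le> snd p * N" "snd p * N < real b + 1"
        using p by (auto simp: a_def b_def unit_square_def)
      have "fst p * N < N" "snd p * N < N" using p N0 by (auto simp: unit_square_def)
      then have "real a < real N" "real b < real N" using ab by linarith+
      then have lt: "a < N" "b < N" by simp_all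
      define i where "i = a * N + b"
      have i: "i div N = a" "i mod N = b" using lt by (auto simp: i_def)
      have "p \<in> S i" using ab N0 by (cases p) (auto simp: S_def i field_simps)
      moreover have "i < N * N"
      proof -
        have "i < (a + 1) * N" using lt by (simp add: i_def)
        also have "\<dots> \<le> N * N" using lt by (intro mult_right_mono) auto
        finally show ?thesis .
      qed
      ultimately show "flat p \<in> (\<Union>i. C i)" by (auto simp: C_def)
    qed
  qed (fact bC, rule order_trans[OF diC less_imp_le[OF N0(2)]])
  also have "\<dots> = (\<Sum>i<N * N. hausdorff_gauge 2 (C i))"
    by (intro suminf_finite) (auto simp: C_def)
  also have "\<dots> \<le> (\<Sum>i<N * N. ennreal (unit_ball_vol 2 / N\<^sup>2))" by (intro sum_mono g)
  also have "\<dots> = ennreal (unit_ball_vol 2)" using N0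
    by (simp add: ennreal_of_nat_eq_real_of_nat ennreal_mult[symmetric] power2_eq_square)
  finally show ?thesis .
qed

text \<open>A covering set that meets the plane has its flat part in the disk about one of its
  points with its diameter as radius. The area of this disk is four times the gauge of the set, and
  these disks cover a square of area 1.\<close>

lemma hausdorff_size_unit_square_ge:
  "1 / 4 \<le> hausdorff_size 2 \<delta> (flat ` unit_square)"
  unfolding hausdorff_size_def
proof (rule INF_greatest, clarify)
  fix C :: "nat \<Rightarrow> (real^3) set"
  assume C: "flat ` unit_square \<subseteq> (\<Union>i. C i)" "\<forall>i. bounded (C i) \<and> diameter (C i) \<le> \<delta>"
  \<comment> \<open>If a covering set misses the plane, this point is arbitrary and its disk only
    enlarges the covering.\<close>
  define x where "x i = (SOME x. flat x \<in> C i)" for i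
  have "unit_square \<subseteq> (\<Union>i. if C i = {} then {} else cball (x i) (diameter (C i)))"
  proof
    fix p assume "p \<in> unit_square"
    then obtain i where i: "flat p \<in> C i" using C(1) by blast
    then have "flat (x i) \<in> C i" unfolding x_def by (rule someI)
    then have "dist (x i) p \<le> diameter (C i)"
      using diameter_bounded_bound[of "C i" "flat (x i)" "flat p"] C(2) i by auto
    then show "p \<in> (\<Union>i. if C i = {} then {} else cball (x i) (diameter (C i)))" using i by auto
  qed
  then have "emeasure lborel unit_square \<le> emeasure lborel (\<Union>i. if C i = {} then {} else cball (x i) (diameter (C i)))"
    by (intro emeasure_mono) auto
  also have "\<dots> \<le> (\<Sum>i. emeasure lborel (if C i = {} then {} else cball (x i) (diameter (C i))))"
    by (intro emeasure_subadditive_countably) auto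
  also have "\<dots> = (\<Sum>i. 4 * hausdorff_gauge 2 (C i))"
  proof (intro suminf_cong)
    fix i
    have "0 \<le> diameter (C i)" using C(2) diameter_ge_0 by blast
    then have "emeasure lborel (cball (x i) (diameter (C i))) = ennreal (4 * (unit_ball_vol 2 * (diameter (C i) / 2)\<^sup>2))"
      by (simp add: emeasure_cball power_divide) (simp add: power2_eq_square)
    also have "\<dots> = 4 * ennreal (unit_ball_vol 2 * (diameter (C i) / 2)\<^sup>2)"
      by (subst ennreal_mult) auto
    finally show "emeasure lborel (if C i = {} then {} else cball (x i) (diameter (C i))) = 4 * hausdorff_gauge 2 (C i)"
      by (simp add: hausdorff_gauge_def)
  qed
  finally have "1 \<le> 4 * (\<Sum>i. hausdorff_gauge 2 (C i))" by (simp add: emeasure_unit_square)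
  then have "ennreal (1/4) * 1 \<le> ennreal (1/4) * (4 * (\<Sum>i. hausdorff_gauge 2 (C i)))"
    by (rule mult_left_mono) auto
  moreover have "ennreal (1/4) * 4 = 1"
  proof -
    have "ennreal (1/4) * ennreal 4 = 1" by (subst ennreal_mult[symmetric]) auto
    then show ?thesis by simp
  qed
  moreover have "ennreal (1/4) = 1 / 4" using divide_ennreal[of 1 4] by simp
  ultimately show "1 / 4 \<le> (\<Sum>i. hausdorff_gauge 2 (C i))"
    by (simp add: mult.assoc[symmetric] del: ennreal_divide_numeral)
qed

text \<open>
  By translation invariance, \<open>H\<^sup>2\<close> on a plane is a multiple of the Lebesgue measure. The value \<open>1\<close> of the
  constant would need the isodiametric inequality; here it suffices that it is positive and finite.
\<close>

definition area_const :: real where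
  "area_const = enn2real (hausdorff_outer_measure 2 (flat ` unit_square))"

lemma area_const: "0 < area_const"
  "hausdorff_outer_measure 2 (flat ` unit_square) = ennreal area_const"
proof -
  have le: "hausdorff_outer_measure 2 (flat ` unit_square) \<le> ennreal (unit_ball_vol 2)"
    unfolding hausdorff_outer_measure_def by (intro SUP_least hausdorff_size_unit_square) auto
  then show eq: "hausdorff_outer_measure 2 (flat ` unit_square) = ennreal area_const"
    unfolding area_const_def by (metis ennreal_enn2real ennreal_less_top order_le_less_trans)
  have "1 / 4 \<le> hausdorff_outer_measure 2 (flat ` unit_square)"
    using order_trans[OF hausdorff_size_unit_square_ge hausdorff_size_le_outer[of 1]] by simp
  moreover have "(0 :: ennreal) < 1 / 4" by (simp add: ennreal_zero_less_divide)
  ultimately have "0 < ennreal area_const" unfolding eq by (rule order_less_le_trans[rotated])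
  then show "0 < area_const" by simp
qed

lemma hausdorff_flat:
  assumes [measurable]: "A \<in> sets borel"
  shows "hausdorff_outer_measure 2 (flat ` A) = ennreal area_const * emeasure lborel A"
proof -
  have sf: "sigma_finite_measure plane_measure"
  proof
    \<comment> \<open>The integer translates of the unit square witness sigma-finiteness; by
      translation invariance each has measure \<open>area_const\<close>.\<close>
    let ?S = "\<lambda>(i, j). (\<lambda>p. p + (real_of_int i, real_of_int j)) ` unit_square"
    have S: "?S ij = (+) (- (real_of_int (fst ij), real_of_int (snd ij))) -` unit_square" for ij
      by (force simp: split_beta image_iff)
    have meas: "?S ij \<in> sets borel" for ij unfolding S
      using measurable_sets[of "(+) (- (real_of_int (fst ij), real_of_int (snd ij)))" borel borel unit_square] by auto
    show "\<exists>A. countable A \<and> A \<subseteq> sets plane_measure \<and> \<Union> A = space plane_measure \<and> (\<forall>a\<in>A. emeasure plane_measure a \<noteq> \<infinity>)"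
    proof (intro exI[of _ "range ?S"] conjI ballI)
      show "range ?S \<subseteq> sets plane_measure" using meas by auto
      have "p \<in> ?S (\<lfloor>fst p\<rfloor>, \<lfloor>snd p\<rfloor>)" for p
      proof -
        have "(frac (fst p), frac (snd p)) \<in> unit_square" by (simp add: unit_square_def frac_lt_1)
        moreover have "p = (frac (fst p), frac (snd p)) + (real_of_int \<lfloor>fst p\<rfloor>, real_of_int \<lfloor>snd p\<rfloor>)"
          unfolding frac_def by (rule prod_eqI) simp_all
        ultimately show ?thesis unfolding prod.case by (rule rev_image_eqI)
      qed
      then have "p \<in> \<Union> (range ?S)" for p by (rule UN_I[OF UNIV_I])
      then show "\<Union> (range ?S) = space plane_measure" by (simp add: set_eq_iff)
      fix a assume "a \<in> range ?S"
      then obtain ij where "a = ?S ij" by blast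
      then have "emeasure plane_measure a =
          emeasure (distr plane_measure borel ((+) (- (real_of_int (fst ij), real_of_int (snd ij))))) unit_square"
        using S[of ij] by (simp add: emeasure_distr)
      also have "\<dots> = ennreal area_const"
        by (simp add: plane_measure_translate emeasure_plane_measure area_const)
      finally show "emeasure plane_measure a \<noteq> \<infinity>" by simp
    qed simp
  qed
  have "emeasure plane_measure A = emeasure plane_measure unit_square * emeasure lborel A"
    by (rule translation_invariant_eq_lborel[OF sf _ plane_measure_translate assms _ emeasure_unit_square]) auto
  then show ?thesis by (simp add: emeasure_plane_measure area_const)
qed

section \<open>The area formula for conformal parametrisations\<close>

text \<open>An open set is a countable union of compact sets, so the image is sigma-compact. A
  continuous image of a general Borel set is only analytic, whence the special form of the
  set.\<close>

lemma borel_continuous_image_diff: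
  fixes f :: "'a::euclidean_space \<Rightarrow> 'b::euclidean_space"
  assumes f: "continuous_on UNIV f" and S: "open S" "closed F"
  shows "f ` (S \<inter> F) \<in> sets borel"
proof -
  obtain C :: "nat \<Rightarrow> 'a set" where C: "\<And>n. compact (C n)" "\<And>n. C n \<subseteq> S" "\<Union>(range C) = S"
  proof (rule open_Union_compact_subsets[OF S(1)], goal_cases)
    case (1 C)
    then show thesis by (intro that[of C])
  qed
  have "f ` (S \<inter> F) = (\<Union>n. f ` (C n \<inter> F))" using C(3) by blast
  moreover have "f ` (C n \<inter> F) \<in> sets borel" for n
    using C(1) S(2) f by (intro borel_compact compact_continuous_image compact_Int_closed)
      (auto intro: continuous_on_subset)
  ultimately show ?thesis by auto
qed

text \<open>\<open>\<phi>s\<close> and \<open>\<phi>t\<close> are the partial derivatives and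
  \<open>\<sigma>\<close> is the conformal factor, so \<open>(\<sigma> p)\<^sup>2\<close> is the
  area element. Injectivity is confined to \<open>U\<close>, everything else holds on the whole
  parameter plane; thus the charts and their derivatives have values on the boundary of
  \<open>U\<close>.\<close>

locale conformal_chart =
  fixes U :: "(real \<times> real) set" and \<phi> \<phi>s \<phi>t :: "real \<times> real \<Rightarrow> real^3" and \<sigma> :: "real \<times> real \<Rightarrow> real"
  assumes open_U: "open U" and inj: "inj_on \<phi> U"
    and deriv: "(\<phi> has_derivative (\<lambda>v. fst v *\<^sub>R \<phi>s p + snd v *\<^sub>R \<phi>t p)) (at p)"
    and cont: "continuous_on UNIV \<phi>s" "continuous_on UNIV \<phi>t"
    and orth: "\<phi>s p \<bullet> \<phi>t p = 0" and norm_s: "norm (\<phi>s p) = \<sigma> p" and norm_t: "norm (\<phi>t p) = \<sigma> p"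
    and pos: "0 < \<sigma> p"
begin

abbreviation D :: "real \<times> real \<Rightarrow> real \<times> real \<Rightarrow> real^3" where
  "D p v \<equiv> fst v *\<^sub>R \<phi>s p + snd v *\<^sub>R \<phi>t p"

lemma norm_D: "norm (D p v) = \<sigma> p * norm v"
proof -
  have "\<phi>s p \<bullet> \<phi>s p = (\<sigma> p)\<^sup>2" "\<phi>t p \<bullet> \<phi>t p = (\<sigma> p)\<^sup>2"
    by (simp_all add: power2_norm_eq_inner[symmetric] norm_s norm_t)
  then have "D p v \<bullet> D p v = (\<sigma> p)\<^sup>2 * ((fst v)\<^sup>2 + (snd v)\<^sup>2)"
    using orth[of p] inner_commute[of "\<phi>t p" "\<phi>s p"]
    by (simp add: inner_add_left inner_add_right)
       (simp add: power2_eq_square algebra_simps)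
  then have "(norm (D p v))\<^sup>2 = (\<sigma> p)\<^sup>2 * ((fst v)\<^sup>2 + (snd v)\<^sup>2)"
    by (simp add: power2_norm_eq_inner)
  also have "\<dots> = (\<sigma> p * norm v)\<^sup>2"
    by (simp add: norm_prod_def power_mult_distrib)
  finally show ?thesis using pos[of p] by (simp add: power2_eq_iff_nonneg)
qed

lemma cont_\<phi>: "continuous_on UNIV \<phi>"
  using deriv has_derivative_continuous by (fastforce simp: continuous_on_eq_continuous_within)

lemma cont_\<sigma>: "continuous_on UNIV \<sigma>"
proof -
  have "\<sigma> = (\<lambda>p. norm (\<phi>s p))" by (simp add: norm_s)
  then show ?thesis using cont by (auto intro: continuous_intros)
qed

lemma measurable_\<phi> [measurable]: "\<phi> \<in> borel_measurable borel" "\<phi>s \<in> borel_measurable borel"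
  "\<phi>t \<in> borel_measurable borel" "\<sigma> \<in> borel_measurable borel"
  using cont cont_\<phi> cont_\<sigma> by (auto intro: borel_measurable_continuous_onI)

lemma sets_U [measurable]: "U \<in> sets borel"
  using open_U by auto

text \<open>By conformality the derivative at \<open>p0\<close> is a similarity of ratio
  \<open>\<sigma> p0\<close>. By continuity of the partial derivatives, \<open>\<phi>\<close>
  differs from it near \<open>p0\<close> by a map with Lipschitz constant at most
  \<open>\<eta> * \<sigma> p0\<close>.\<close>

lemma local_bilipschitz:
  assumes p0: "p0 \<in> U" and \<eta>: "0 < \<eta>" "\<eta> < 1"
  obtains \<delta> where "0 < \<delta>" "ball p0 \<delta> \<subseteq> U"
    "\<And>p q. p \<in> ball p0 \<delta> \<Longrightarrow> q \<in> ball p0 \<delta> \<Longrightarrow> (1 - \<eta>) * \<sigma> p0 * dist p q \<le> dist (\<phi> p) (\<phi> q)"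
    "\<And>p q. p \<in> ball p0 \<delta> \<Longrightarrow> q \<in> ball p0 \<delta> \<Longrightarrow> dist (\<phi> p) (\<phi> q) \<le> (1 + \<eta>) * \<sigma> p0 * dist p q"
    "\<And>p. p \<in> ball p0 \<delta> \<Longrightarrow> (1 - \<eta>) * \<sigma> p0 \<le> \<sigma> p \<and> \<sigma> p \<le> (1 + \<eta>) * \<sigma> p0"
proof -
  \<comment> \<open>Half of the tolerance for each of the two partial derivatives.\<close>
  let ?e = "\<eta> * \<sigma> p0 / 2"
  have e: "0 < ?e" using \<eta> pos by simp
  obtain d1 where d1: "0 < d1" "\<And>p. dist p p0 < d1 \<Longrightarrow> dist (\<phi>s p) (\<phi>s p0) < ?e"
    using cont(1) e unfolding continuous_on_iff by (metis UNIV_I)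
  obtain d2 where d2: "0 < d2" "\<And>p. dist p p0 < d2 \<Longrightarrow> dist (\<phi>t p) (\<phi>t p0) < ?e"
    using cont(2) e unfolding continuous_on_iff by (metis UNIV_I)
  obtain d3 where d3: "0 < d3" "ball p0 d3 \<subseteq> U" using open_U p0 by (meson openE)
  define \<delta> where "\<delta> = min d1 (min d2 d3)"
  have \<delta>: "0 < \<delta>" "\<delta> \<le> d1" "\<delta> \<le> d2" "\<delta> \<le> d3" using d1 d2 d3 by (auto simp: \<delta>_def)
  have on: "onorm (D p - D p0) \<le> \<eta> * \<sigma> p0" if "p \<in> ball p0 \<delta>" for p
  proof (rule onorm_bound)
    fix v :: "real \<times> real"
    have "norm ((D p - D p0) v) = norm (fst v *\<^sub>R (\<phi>s p - \<phi>s p0) + snd v *\<^sub>R (\<phi>t p - \<phi>t p0))"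
      by (simp add: algebra_simps)
    also have "\<dots> \<le> \<bar>fst v\<bar> * norm (\<phi>s p - \<phi>s p0) + \<bar>snd v\<bar> * norm (\<phi>t p - \<phi>t p0)"
      by (metis norm_scaleR norm_triangle_ineq)
    also have "\<dots> \<le> norm v * ?e + norm v * ?e"
    proof (intro add_mono mult_mono)
      show "norm (\<phi>s p - \<phi>s p0) \<le> ?e" "norm (\<phi>t p - \<phi>t p0) \<le> ?e"
        using d1(2)[of p] d2(2)[of p] that \<delta> by (auto simp: dist_norm norm_minus_commute)
      show "\<bar>fst v\<bar> \<le> norm v" "\<bar>snd v\<bar> \<le> norm v"
        using norm_fst_le[of "fst v" "snd v"] norm_snd_le[of "snd v" "fst v"] by simp_all
    qed auto
    finally show "norm ((D p - D p0) v) \<le> \<eta> * \<sigma> p0 * norm v" by (simp add: algebra_simps)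
  qed (use \<eta> pos[of p0] in auto)
  have lin: "norm (\<phi> q - \<phi> p - D p0 (q - p)) \<le> norm (q - p) * (\<eta> * \<sigma> p0)"
    if "p \<in> ball p0 \<delta>" "q \<in> ball p0 \<delta>" for p q
  proof (rule differentiable_bound_linearization[where S="ball p0 \<delta>"])
    show "p + t *\<^sub>R (q - p) \<in> ball p0 \<delta>" if "t \<in> {0..1}" for t
    proof -
      have "(1 - t) *\<^sub>R p + t *\<^sub>R q \<in> ball p0 \<delta>"
        using \<open>p \<in> _\<close> \<open>q \<in> _\<close> that by (intro convexD[OF convex_ball]) auto
      then show ?thesis by (simp add: algebra_simps)
    qed
  qed (use on \<delta> in \<open>auto intro: has_derivative_at_withinI deriv\<close>)
  show thesis
  proof
    fix p q assume pq: "p \<in> ball p0 \<delta>" "q \<in> ball p0 \<delta>"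
    have "norm (D p0 (q - p)) = \<sigma> p0 * dist p q" by (simp add: norm_D dist_norm norm_minus_commute del: fst_diff snd_diff)
    moreover have "dist (\<phi> p) (\<phi> q) \<le> norm (\<phi> q - \<phi> p - D p0 (q - p)) + norm (D p0 (q - p))"
      using norm_triangle_sub[of "\<phi> q - \<phi> p" "D p0 (q - p)"] by (simp add: dist_norm norm_minus_commute)
    moreover have "norm (D p0 (q - p)) \<le> dist (\<phi> p) (\<phi> q) + norm (\<phi> q - \<phi> p - D p0 (q - p))"
      using norm_triangle_sub[of "D p0 (q - p)" "\<phi> q - \<phi> p"] by (simp add: dist_norm norm_minus_commute)
    moreover note lin[OF pq]
    ultimately show "(1 - \<eta>) * \<sigma> p0 * dist p q \<le> dist (\<phi> p) (\<phi> q)"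
      "dist (\<phi> p) (\<phi> q) \<le> (1 + \<eta>) * \<sigma> p0 * dist p q"
      by (simp_all add: dist_norm norm_minus_commute algebra_simps)
  next
    fix p assume "p \<in> ball p0 \<delta>"
    then have "norm (\<phi>s p - \<phi>s p0) \<le> ?e" using d1(2)[of p] \<delta> by (auto simp: dist_norm norm_minus_commute)
    then have "\<bar>\<sigma> p - \<sigma> p0\<bar> \<le> ?e"
      using norm_triangle_ineq3[of "\<phi>s p" "\<phi>s p0"] norm_s by simp
    then have "\<sigma> p \<le> \<sigma> p0 + \<eta> * \<sigma> p0" "\<sigma> p0 - \<eta> * \<sigma> p0 \<le> \<sigma> p"
      using e by linarith+
    then show "(1 - \<eta>) * \<sigma> p0 \<le> \<sigma> p \<and> \<sigma> p \<le> (1 + \<eta>) * \<sigma> p0"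
      by (simp add: left_diff_distrib distrib_right)
  qed (use \<delta> d3 in auto)
qed

definition param_measure :: "(real \<times> real) measure" where
  "param_measure = density lborel (\<lambda>p. ennreal (area_const * (\<sigma> p)\<^sup>2))"

lemma sets_param_measure [simp, measurable_cong]: "sets param_measure = sets borel"
  by (simp add: param_measure_def)

lemma space_param_measure [simp]: "space param_measure = UNIV"
  by (simp add: param_measure_def)

text \<open>Near \<open>p0\<close>, both the Hausdorff measure of the image and
  \<open>param_measure\<close> lie between the squares of the lower and of the upper Lipschitz
  constant, times \<open>area_const\<close> and Lebesgue measure. \<open>K\<close> is the quotient
  of these squares.\<close>

lemma local_area:
  assumes p0: "p0 \<in> U" and \<eta>: "0 < \<eta>" "\<eta> < 1"
  defines "K \<equiv> ((1 + \<eta>) / (1 - \<eta>))\<^sup>2"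
  obtains \<delta> where "0 < \<delta>" "ball p0 \<delta> \<subseteq> U"
    "\<And>A. A \<in> sets borel \<Longrightarrow> A \<subseteq> ball p0 \<delta> \<Longrightarrow>
      hausdorff_outer_measure 2 (\<phi> ` A) \<le> ennreal K * emeasure param_measure A"
    "\<And>A. A \<in> sets borel \<Longrightarrow> A \<subseteq> ball p0 \<delta> \<Longrightarrow>
      emeasure param_measure A \<le> ennreal K * hausdorff_outer_measure 2 (\<phi> ` A)"
proof -
  obtain \<delta> where \<delta>: "0 < \<delta>" "ball p0 \<delta> \<subseteq> U"
    "\<And>p q. p \<in> ball p0 \<delta> \<Longrightarrow> q \<in> ball p0 \<delta> \<Longrightarrow> (1 - \<eta>) * \<sigma> p0 * dist p q \<le> dist (\<phi> p) (\<phi> q)"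
    "\<And>p q. p \<in> ball p0 \<delta> \<Longrightarrow> q \<in> ball p0 \<delta> \<Longrightarrow> dist (\<phi> p) (\<phi> q) \<le> (1 + \<eta>) * \<sigma> p0 * dist p q"
    "\<And>p. p \<in> ball p0 \<delta> \<Longrightarrow> (1 - \<eta>) * \<sigma> p0 \<le> \<sigma> p \<and> \<sigma> p \<le> (1 + \<eta>) * \<sigma> p0"
    using local_bilipschitz[OF p0 \<eta>] by blast
  let ?a = "(1 - \<eta>) * \<sigma> p0" and ?b = "(1 + \<eta>) * \<sigma> p0"
  have ab: "0 < ?a" "0 < ?b" using \<eta> pos by auto
  have K: "?b\<^sup>2 = K * ?a\<^sup>2" "0 < K" using \<eta> pos[of p0] by (auto simp: K_def power_divide power_mult_distrib)
  show thesis
  proof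
    fix A assume A[measurable]: "A \<in> sets borel" and sub: "A \<subseteq> ball p0 \<delta>"
    have fs: "inj_on \<phi> A" using inj sub \<delta>(2) by (meson inj_on_subset order_trans)
    have "?b-lipschitz_on (flat ` A) (\<phi> \<circ> shadow)"
    proof (intro lipschitz_onI)
      fix x y assume "x \<in> flat ` A" "y \<in> flat ` A"
      then obtain p q where pq: "x = flat p" "y = flat q" "p \<in> A" "q \<in> A" by (elim imageE)
      show "dist ((\<phi> \<circ> shadow) x) ((\<phi> \<circ> shadow) y) \<le> ?b * dist x y"
        using \<delta>(4)[OF subsetD[OF sub pq(3)] subsetD[OF sub pq(4)]] pq by simp
    qed (use ab in simp)
    from hausdorff_outer_measure_lipschitz_image[OF this ab(2), of 2]
    have H1: "hausdorff_outer_measure 2 (\<phi> ` A) \<le> ennreal (?b\<^sup>2) * (ennreal area_const * emeasure lborel A)"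
      by (simp add: image_image hausdorff_flat)
    have "(1 / ?a)-lipschitz_on (\<phi> ` A) (flat \<circ> inv_into A \<phi>)"
    proof (intro lipschitz_onI)
      fix x y assume "x \<in> \<phi> ` A" "y \<in> \<phi> ` A"
      then obtain p q where pq: "x = \<phi> p" "y = \<phi> q" "p \<in> A" "q \<in> A" by (elim imageE)
      then have "?a * dist p q \<le> dist x y" using \<delta>(3)[OF subsetD[OF sub pq(3)] subsetD[OF sub pq(4)]] pq by simp
      then show "dist ((flat \<circ> inv_into A \<phi>) x) ((flat \<circ> inv_into A \<phi>) y) \<le> 1 / ?a * dist x y"
        using pq fs ab by (simp add: field_simps)
    qed (use ab in auto)
    from hausdorff_outer_measure_lipschitz_image[OF this, of 2]
    have "ennreal area_const * emeasure lborel A \<le> ennreal ((1 / ?a)\<^sup>2) * hausdorff_outer_measure 2 (\<phi> ` A)"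
      unfolding image_comp[symmetric] inv_into_image_cancel[OF fs subset_refl] hausdorff_flat[OF A]
      using ab by simp
    then have "ennreal (?a\<^sup>2) * (ennreal area_const * emeasure lborel A)
      \<le> ennreal (?a\<^sup>2) * (ennreal ((1 / ?a)\<^sup>2) * hausdorff_outer_measure 2 (\<phi> ` A))"
      by (rule mult_left_mono) auto
    also have "\<dots> = hausdorff_outer_measure 2 (\<phi> ` A)"
    proof -
      have "a\<^sup>2 * (1 / a)\<^sup>2 = 1" if "0 < a" for a :: real using that by (simp add: power_divide)
      from this[OF ab(1)] have "ennreal (?a\<^sup>2) * ennreal ((1 / ?a)\<^sup>2) = 1" by (subst ennreal_mult[symmetric]) auto
      then show ?thesis by (simp add: mult.assoc[symmetric])
    qed
    finally have H2: "ennreal (?a\<^sup>2) * (ennreal area_const * emeasure lborel A) \<le> hausdorff_outer_measure 2 (\<phi> ` A)" .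
    have n: "emeasure param_measure A = (\<integral>\<^sup>+p. ennreal (area_const * (\<sigma> p)\<^sup>2) * indicator A p \<partial>lborel)"
      unfolding param_measure_def by (subst emeasure_density) auto
    have c0: "0 < area_const" by (rule area_const)
    have n1: "emeasure param_measure A \<le> ennreal (?b\<^sup>2) * (ennreal area_const * emeasure lborel A)"
    proof -
      have "emeasure param_measure A \<le> (\<integral>\<^sup>+p. ennreal (area_const * ?b\<^sup>2) * indicator A p \<partial>lborel)"
        unfolding n
      proof (intro nn_integral_mono)
        fix p
        show "ennreal (area_const * (\<sigma> p)\<^sup>2) * indicator A p \<le> ennreal (area_const * ?b\<^sup>2) * indicator A p"
        proof (cases "p \<in> A")
          case True
          then have "(\<sigma> p)\<^sup>2 \<le> ?b\<^sup>2" using \<delta>(5)[of p] sub pos[of p] by (intro power_mono) auto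
          then show ?thesis using True c0 by (auto intro!: ennreal_leI)
        qed auto
      qed
      also have "\<dots> = ennreal (?b\<^sup>2) * (ennreal area_const * emeasure lborel A)"
        using c0 by (subst nn_integral_cmult_indicator) (simp_all add: ennreal_mult ac_simps)
      finally show ?thesis .
    qed
    have n2: "ennreal (?a\<^sup>2) * (ennreal area_const * emeasure lborel A) \<le> emeasure param_measure A"
    proof -
      have "(\<integral>\<^sup>+p. ennreal (area_const * ?a\<^sup>2) * indicator A p \<partial>lborel) \<le> emeasure param_measure A"
        unfolding n
      proof (intro nn_integral_mono)
        fix p
        show "ennreal (area_const * ?a\<^sup>2) * indicator A p \<le> ennreal (area_const * (\<sigma> p)\<^sup>2) * indicator A p"
        proof (cases "p \<in> A")
          case True
          then have "?a\<^sup>2 \<le> (\<sigma> p)\<^sup>2" using \<delta>(5)[of p] sub ab by (intro power_mono) auto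
          then show ?thesis using True c0 by (auto intro!: ennreal_leI)
        qed auto
      qed
      also have "(\<integral>\<^sup>+p. ennreal (area_const * ?a\<^sup>2) * indicator A p \<partial>lborel) = ennreal (?a\<^sup>2) * (ennreal area_const * emeasure lborel A)"
        using c0 by (subst nn_integral_cmult_indicator) (simp_all add: ennreal_mult ac_simps)
      finally show ?thesis .
    qed
    have Kb: "ennreal (?b\<^sup>2) * X = ennreal K * (ennreal (?a\<^sup>2) * X)" for X
      unfolding K(1) using K(2) by (subst ennreal_mult) (auto simp: mult.assoc)
    show "hausdorff_outer_measure 2 (\<phi> ` A) \<le> ennreal K * emeasure param_measure A"
      using order_trans[OF H1[unfolded Kb] mult_left_mono[OF n2]] by simp
    show "emeasure param_measure A \<le> ennreal K * hausdorff_outer_measure 2 (\<phi> ` A)"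
      using order_trans[OF n1[unfolded Kb] mult_left_mono[OF H2]] by simp
  qed fact+
qed

lemma borel_image: "closed F \<Longrightarrow> \<phi> ` (U \<inter> F) \<in> sets borel" "\<phi> ` U \<in> sets borel"
  using borel_continuous_image_diff[OF cont_\<phi> open_U, of F] borel_continuous_image_diff[OF cont_\<phi> open_U, of UNIV]
  by auto

text \<open>By Lindelof's theorem countably many balls from \<open>local_area\<close> cover
  \<open>U\<close>. Made disjoint, they have disjoint images by injectivity, and the local estimates
  add up with the same \<open>K\<close>.\<close>

lemma area_approx:
  assumes \<eta>: "0 < \<eta>" "\<eta> < 1" and B[measurable]: "B \<in> sets borel"
  defines "K \<equiv> ((1 + \<eta>) / (1 - \<eta>))\<^sup>2"
  shows "emeasure (hausdorff_measure 2) (B \<inter> \<phi> ` U) \<le> ennreal K * emeasure param_measure (U \<inter> \<phi> -` B)"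
    "emeasure param_measure (U \<inter> \<phi> -` B) \<le> ennreal K * emeasure (hausdorff_measure 2) (B \<inter> \<phi> ` U)"
proof -
  let ?H = "hausdorff_measure 2" and ?n = "emeasure param_measure"
  have "\<exists>\<delta>>0. ball p \<delta> \<subseteq> U \<and> (\<forall>A\<in>sets borel. A \<subseteq> ball p \<delta> \<longrightarrow>
      hausdorff_outer_measure 2 (\<phi> ` A) \<le> ennreal K * ?n A \<and>
      ?n A \<le> ennreal K * hausdorff_outer_measure 2 (\<phi> ` A))" if "p \<in> U" for p
  proof (rule local_area[OF that \<eta>], fold K_def, goal_cases)
    case (1 \<delta>)
    then show ?case by blast
  qed
  then have "\<forall>p\<in>U. \<exists>\<delta>>0. ball p \<delta> \<subseteq> U \<and> (\<forall>A\<in>sets borel. A \<subseteq> ball p \<delta> \<longrightarrow>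
      hausdorff_outer_measure 2 (\<phi> ` A) \<le> ennreal K * ?n A \<and>
      ?n A \<le> ennreal K * hausdorff_outer_measure 2 (\<phi> ` A))" by blast
  from bchoice[OF this] obtain \<delta> where \<delta>: "\<And>p. p \<in> U \<Longrightarrow> 0 < \<delta> p" "\<And>p. p \<in> U \<Longrightarrow> ball p (\<delta> p) \<subseteq> U"
    "\<And>p A. p \<in> U \<Longrightarrow> A \<in> sets borel \<Longrightarrow> A \<subseteq> ball p (\<delta> p) \<Longrightarrow>
      hausdorff_outer_measure 2 (\<phi> ` A) \<le> ennreal K * ?n A"
    "\<And>p A. p \<in> U \<Longrightarrow> A \<in> sets borel \<Longrightarrow> A \<subseteq> ball p (\<delta> p) \<Longrightarrow>
      ?n A \<le> ennreal K * hausdorff_outer_measure 2 (\<phi> ` A)"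
    by blast
  obtain P where P: "P \<subseteq> U" "countable P" "U = (\<Union>p\<in>P. ball p (\<delta> p))"
  proof -
    obtain F' where F': "F' \<subseteq> (\<lambda>p. ball p (\<delta> p)) ` U" "countable F'" "\<Union>F' = \<Union>((\<lambda>p. ball p (\<delta> p)) ` U)"
      by (rule Lindelof[of "(\<lambda>p. ball p (\<delta> p)) ` U"]) auto
    obtain P where P: "P \<subseteq> U" "countable P" "F' = (\<lambda>p. ball p (\<delta> p)) ` P"
      using F'(1,2) countable_subset_image[of F'] by metis
    have "(\<Union>p\<in>U. ball p (\<delta> p)) = U"
      using \<delta>(1,2) centre_in_ball by (intro equalityI UN_least subsetI UN_I) blast+
    then have "U = (\<Union>p\<in>P. ball p (\<delta> p))" using F'(3) P(3) by simp
    then show thesis using that P by blast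
  qed
  define b where "b i = (if P = {} then {} else ball (from_nat_into P i) (\<delta> (from_nat_into P i)))" for i :: nat
  have Ub: "U = (\<Union>i. b i)"
  proof (cases "P = {}")
    case False
    then have "range (from_nat_into P) = P" using P(2) by (simp add: range_from_nat_into)
    then have "(\<Union>p\<in>P. ball p (\<delta> p)) = (\<Union>p\<in>range (from_nat_into P). ball p (\<delta> p))" by simp
    also have "\<dots> = (\<Union>i. b i)" using False unfolding b_def by simp
    finally have "(\<Union>i. b i) = (\<Union>p\<in>P. ball p (\<delta> p))" by simp
    then show ?thesis using P(3) by simp
  qed (use P(3) in \<open>auto simp: b_def\<close>)
  have ob: "open (b i)" for i by (auto simp: b_def)
  define S where "S = disjointed b"
  \<comment> \<open>An open set intersected with a closed one: the form for which the image is known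
    to be Borel.\<close>
  have S_eq: "S i = b i \<inter> - (\<Union>k<i. b k)" for i by (auto simp: S_def disjointed_def)
  have SU: "(\<Union>i. S i) = U" unfolding S_def UN_disjointed_eq Ub ..
  have disjS: "disjoint_family S" unfolding S_def by (rule disjoint_family_disjointed)
  have Sm[measurable]: "S i \<in> sets borel" for i unfolding S_eq using ob by (intro sets.Int borel_open borel_closed) auto
  have imS[measurable]: "\<phi> ` S i \<in> sets borel" for i unfolding S_eq
    using ob by (intro borel_continuous_image_diff[OF cont_\<phi>]) auto
  have pre[measurable]: "\<phi> -` B \<in> sets borel" using measurable_sets[OF measurable_\<phi>(1) B] by simp
  define A where "A i = S i \<inter> \<phi> -` B" for i
  have Am: "A i \<in> sets borel" for i unfolding A_def by auto
  have imA: "\<phi> ` A i = B \<inter> \<phi> ` S i" for i by (auto simp: A_def)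
  have disjA: "disjoint_family A" using disjS by (auto simp: A_def disjoint_family_on_def)
  have disjI: "disjoint_family (\<lambda>i. \<phi> ` A i)"
    unfolding disjoint_family_on_def
  proof (intro ballI impI)
    fix i j :: nat assume "i \<noteq> j"
    then have "A i \<inter> A j = {}" using disjA by (auto simp: disjoint_family_on_def)
    moreover have "A i \<subseteq> U" "A j \<subseteq> U" using SU by (auto simp: A_def)
    ultimately show "\<phi> ` A i \<inter> \<phi> ` A j = {}" using inj_on_image_Int[OF inj] by (metis image_empty)
  qed
  have loc: "\<exists>p\<in>U. A i \<subseteq> ball p (\<delta> p)" if "A i \<noteq> {}" for i
  proof -
    have "P \<noteq> {}" using that by (auto simp: A_def S_eq b_def)
    then show ?thesis using P(1) from_nat_into[of P i] by (intro bexI[of _ "from_nat_into P i"]) (auto simp: A_def S_eq b_def)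
  qed
  have e1: "hausdorff_outer_measure 2 (\<phi> ` A i) \<le> ennreal K * ?n (A i)"
    and e2: "?n (A i) \<le> ennreal K * hausdorff_outer_measure 2 (\<phi> ` A i)" for i
    using loc[of i] \<delta>(3)[OF _ Am] \<delta>(4)[OF _ Am] by (cases "A i = {}"; auto)+
  have HU: "emeasure ?H (B \<inter> \<phi> ` U) = (\<Sum>i. hausdorff_outer_measure 2 (\<phi> ` A i))"
  proof -
    have "B \<inter> \<phi> ` U = (\<Union>i. \<phi> ` A i)" unfolding imA SU[symmetric] by auto
    then have "emeasure ?H (B \<inter> \<phi> ` U) = (\<Sum>i. emeasure ?H (\<phi> ` A i))"
      using disjI imS B by (simp add: suminf_emeasure imA image_subset_iff)
    then show ?thesis using B by (simp add: emeasure_hausdorff_measure imA)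
  qed
  have nU: "?n (U \<inter> \<phi> -` B) = (\<Sum>i. ?n (A i))"
  proof -
    have "U \<inter> \<phi> -` B = (\<Union>i. A i)" unfolding A_def SU[symmetric] by auto
    then show ?thesis using disjA Am by (simp add: suminf_emeasure image_subset_iff)
  qed
  show "emeasure ?H (B \<inter> \<phi> ` U) \<le> ennreal K * ?n (U \<inter> \<phi> -` B)"
    unfolding HU nU ennreal_suminf_cmult[symmetric] by (intro suminf_le e1 summableI)
  show "?n (U \<inter> \<phi> -` B) \<le> ennreal K * emeasure ?H (B \<inter> \<phi> ` U)"
    unfolding HU nU ennreal_suminf_cmult[symmetric] by (intro suminf_le e2 summableI)
qed

theorem emeasure_image:
  assumes B[measurable]: "B \<in> sets borel"
  shows "emeasure (hausdorff_measure 2) (B \<inter> \<phi> ` U) = emeasure param_measure (U \<inter> \<phi> -` B)"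
proof -
  \<comment> \<open>The tolerance \<open>1 / (n + 2)\<close> lies strictly between 0 and 1 for every
    \<open>n\<close> and tends to 0, so \<open>K n\<close> tends to 1.\<close>
  define K where "K n = ((1 + 1 / real (n + 2)) / (1 - 1 / real (n + 2)))\<^sup>2" for n
  have \<eta>: "0 < 1 / real (n + 2)" "1 / real (n + 2) < 1" for n by auto
  have "(\<lambda>n. 1 / real (n + 2)) \<longlonglongrightarrow> 0"
    using LIMSEQ_ignore_initial_segment[OF lim_1_over_n, of 2] by simp
  then have "K \<longlonglongrightarrow> ((1 + 0) / (1 - 0))\<^sup>2" unfolding K_def by (intro tendsto_intros) auto
  then have K: "(\<lambda>n. ennreal (K n)) \<longlonglongrightarrow> 1" using tendsto_ennrealI by fastforce
  have le: "X \<le> Y" if "\<And>n. X \<le> ennreal (K n) * Y" for X Y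
  proof (cases "Y = \<infinity>")
    case False
    have "(\<lambda>n. ennreal (K n) * Y) \<longlonglongrightarrow> 1 * Y"
      using K by (intro tendsto_mult_ennreal) (use False in auto)
    then show ?thesis using that by (auto intro: LIMSEQ_le_const)
  qed simp
  show ?thesis
    by (rule antisym; rule le; unfold K_def)
       (rule area_approx(1)[OF \<eta>(1) \<eta>(2) B], rule area_approx(2)[OF \<eta>(1) \<eta>(2) B])
qed

lemma hausdorff_restrict_image:
  "density (hausdorff_measure 2) (indicator (\<phi> ` U)) = distr (density param_measure (indicator U)) borel \<phi>"
proof (rule measure_eqI)
  fix B assume "B \<in> sets (density (hausdorff_measure 2) (indicator (\<phi> ` U)))"
  then have B[measurable]: "B \<in> sets borel" by simp
  have pre[measurable]: "\<phi> -` B \<in> sets borel" using measurable_sets[OF measurable_\<phi>(1) B] by simp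
  have [measurable]: "\<phi> ` U \<in> sets borel" by (rule borel_image)
  have "emeasure (density (hausdorff_measure 2) (indicator (\<phi> ` U))) B = emeasure (hausdorff_measure 2) (B \<inter> \<phi> ` U)"
    by (subst emeasure_density) (auto simp: nn_integral_indicator[symmetric] indicator_inter_arith ac_simps simp del: nn_integral_indicator)
  also have "\<dots> = emeasure param_measure (U \<inter> \<phi> -` B)" by (rule emeasure_image[OF B])
  also have "\<dots> = emeasure (distr (density param_measure (indicator U)) borel \<phi>) B"
    by (subst emeasure_distr, simp, simp, subst emeasure_density)
      (auto simp: nn_integral_indicator[symmetric] indicator_inter_arith simp del: nn_integral_indicator)
  finally show "emeasure (density (hausdorff_measure 2) (indicator (\<phi> ` U))) B = emeasure (distr (density param_measure (indicator U)) borel \<phi>) B" .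
qed simp

lemma nn_integral_image:
  assumes [measurable]: "f \<in> borel_measurable borel"
  shows "(\<integral>\<^sup>+z\<in>\<phi> ` U. f z \<partial>hausdorff_measure 2) = (\<integral>\<^sup>+p\<in>U. ennreal (area_const * (\<sigma> p)\<^sup>2) * f (\<phi> p) \<partial>lborel)"
proof -
  have [measurable]: "\<phi> ` U \<in> sets borel" by (rule borel_image)
  have "(\<integral>\<^sup>+z\<in>\<phi> ` U. f z \<partial>hausdorff_measure 2) = (\<integral>\<^sup>+z. f z \<partial>density (hausdorff_measure 2) (indicator (\<phi> ` U)))"
    by (subst nn_integral_density) (auto simp: mult.commute)
  also have "\<dots> = (\<integral>\<^sup>+p. f (\<phi> p) \<partial>density param_measure (indicator U))"
    unfolding hausdorff_restrict_image by (subst nn_integral_distr) auto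
  also have "\<dots> = (\<integral>\<^sup>+p. indicator U p * f (\<phi> p) \<partial>param_measure)"
    by (subst nn_integral_density) auto
  also have "\<dots> = (\<integral>\<^sup>+p\<in>U. ennreal (area_const * (\<sigma> p)\<^sup>2) * f (\<phi> p) \<partial>lborel)"
    unfolding param_measure_def by (subst nn_integral_density) (auto simp: ac_simps)
  finally show ?thesis .
qed

lemma integral_image:
  fixes f :: "real^3 \<Rightarrow> real"
  assumes [measurable]: "f \<in> borel_measurable borel"
  shows "(LINT z:\<phi> ` U|hausdorff_measure 2. f z) = area_const * (LINT p:U|lborel. (\<sigma> p)\<^sup>2 * f (\<phi> p))"
proof -
  have c0: "0 < area_const" by (rule area_const)
  have [measurable]: "\<phi> ` U \<in> sets borel" by (rule borel_image)
  have ind: "indicator A x = ennreal (indicat_real A x)" for A and x :: 'x by (simp add: indicator_def)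
  have "(LINT z:\<phi> ` U|hausdorff_measure 2. f z) = (\<integral>z. f z \<partial>density (hausdorff_measure 2) (indicator (\<phi> ` U)))"
    unfolding set_lebesgue_integral_def ind by (subst integral_density) auto
  also have "\<dots> = (\<integral>p. f (\<phi> p) \<partial>density param_measure (indicator U))"
    unfolding hausdorff_restrict_image by (subst integral_distr) auto
  also have "\<dots> = (\<integral>p. indicator U p *\<^sub>R f (\<phi> p) \<partial>param_measure)"
    unfolding ind by (subst integral_density) auto
  also have "\<dots> = (\<integral>p. (area_const * (\<sigma> p)\<^sup>2) *\<^sub>R (indicator U p *\<^sub>R f (\<phi> p)) \<partial>lborel)"
    unfolding param_measure_def using c0 by (subst integral_density) auto
  also have "\<dots> = area_const * (LINT p:U|lborel. (\<sigma> p)\<^sup>2 * f (\<phi> p))"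
    unfolding set_lebesgue_integral_def by (simp add: ac_simps flip: integral_mult_right_zero)
  finally show ?thesis .
qed

end

interpretation flat: conformal_chart UNIV flat "\<lambda>_. axis 1 1" "\<lambda>_. axis 2 1" "\<lambda>_. 1"
proof
  have eq: "flat = (\<lambda>v. fst v *\<^sub>R axis 1 1 + snd v *\<^sub>R axis 2 1)"
    by (auto simp: fun_eq_iff vec_eq_iff forall_3 axis_def)
  show "(flat has_derivative (\<lambda>v. fst v *\<^sub>R axis 1 1 + snd v *\<^sub>R axis 2 1)) (at p)" for p
    unfolding eq by (auto intro!: derivative_eq_intros)
  show "inj_on flat UNIV" by (rule inj_on_inverseI[of _ shadow]) simp
qed (auto simp: inner_axis_axis norm_axis_1)

section \<open>Smooth functions\<close>

text \<open>\<open>times_cont_diff\<close> for arbitrary domains and codomains: the cut-off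
  functions that multiply test fields are real-valued.\<close>

primrec Ck :: "nat \<Rightarrow> ('a::real_normed_vector \<Rightarrow> 'b::real_normed_vector) \<Rightarrow> bool" where
  "Ck 0 f \<longleftrightarrow> continuous_on UNIV f"
| "Ck (Suc k) f \<longleftrightarrow> (\<forall>x. f differentiable at x) \<and> (\<forall>v. Ck k (\<lambda>x. frechet_derivative f (at x) v))"

lemma times_cont_diff_iff_Ck: "times_cont_diff k f \<longleftrightarrow> Ck k f"
  by (induction k arbitrary: f) auto

lemma Ck_SucI:
  assumes "\<And>x. (f has_derivative f' x) (at x)" "\<And>v. Ck k (\<lambda>x. f' x v)"
  shows "Ck (Suc k) f"
proof -
  have "frechet_derivative f (at x) = f' x" for x
    using assms(1) by (metis frechet_derivative_at)
  then show ?thesis using assms by (auto simp: differentiable_def)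
qed

lemma Ck_SucD:
  assumes "Ck (Suc k) f"
  shows "\<exists>f'. (\<forall>x. (f has_derivative f' x) (at x)) \<and> (\<forall>v. Ck k (\<lambda>x. f' x v))"
  using assms by (intro exI[of _ "\<lambda>x. frechet_derivative f (at x)"]) (auto simp: frechet_derivative_works)

lemma Ck_Suc_imp: "Ck (Suc k) f \<Longrightarrow> Ck k f"
proof (induction k arbitrary: f)
  case 0
  then show ?case
    by (auto simp: continuous_on_eq_continuous_within intro!: differentiable_imp_continuous_within)
next
  case (Suc k)
  then show ?case by (auto simp del: Ck.simps(1))
qed

lemma Ck_const: "Ck k (\<lambda>x. c)"
proof (induction k arbitrary: c)
  case (Suc k)
  then show ?case by (intro Ck_SucI[where f'="\<lambda>x v. 0"]) auto
qed simp

lemma Ck_bounded_linear: "bounded_linear f \<Longrightarrow> Ck k f"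
proof (cases k)
  case (Suc m)
  assume "bounded_linear f"
  then show ?thesis unfolding Suc
    by (intro Ck_SucI[where f'="\<lambda>x. f"] Ck_const) (rule bounded_linear_imp_has_derivative)
qed (simp add: linear_continuous_on)

lemma Ck_add: "Ck k f \<Longrightarrow> Ck k g \<Longrightarrow> Ck k (\<lambda>x. f x + g x)"
proof (induction k arbitrary: f g)
  case (Suc k)
  obtain f' where f': "\<And>x. (f has_derivative f' x) (at x)" "\<And>v. Ck k (\<lambda>x. f' x v)"
    using Ck_SucD[OF Suc.prems(1)] by blast
  obtain g' where g': "\<And>x. (g has_derivative g' x) (at x)" "\<And>v. Ck k (\<lambda>x. g' x v)"
    using Ck_SucD[OF Suc.prems(2)] by blast
  show ?case
    by (rule Ck_SucI[where f'="\<lambda>x v. f' x v + g' x v"])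
       (auto intro!: Suc.IH f' g' has_derivative_add)
qed (auto intro: continuous_on_add)

lemma Ck_scaleR: "Ck k (g :: 'a::real_normed_vector \<Rightarrow> real) \<Longrightarrow> Ck k f \<Longrightarrow> Ck k (\<lambda>x. g x *\<^sub>R f x)"
proof (induction k arbitrary: f g)
  case (Suc k)
  obtain f' where f': "\<And>x. (f has_derivative f' x) (at x)" "\<And>v. Ck k (\<lambda>x. f' x v)"
    using Ck_SucD[OF Suc.prems(2)] by blast
  obtain g' where g': "\<And>x. (g has_derivative g' x) (at x)" "\<And>v. Ck k (\<lambda>x. g' x v)"
    using Ck_SucD[OF Suc.prems(1)] by blast
  show ?case
    by (rule Ck_SucI[where f'="\<lambda>x v. g x *\<^sub>R f' x v + g' x v *\<^sub>R f x"])
       (auto intro!: Suc.IH Ck_add f' g' has_derivative_scaleR Ck_Suc_imp[OF Suc.prems(1)] Ck_Suc_imp[OF Suc.prems(2)])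
qed (auto intro: continuous_on_scaleR)

lemma Ck_mult:
  fixes f g :: "'a::real_normed_vector \<Rightarrow> real"
  shows "Ck k f \<Longrightarrow> Ck k g \<Longrightarrow> Ck k (\<lambda>x. f x * g x)"
  using Ck_scaleR[of k f g] by simp

lemma Ck_diff: "Ck k f \<Longrightarrow> Ck k g \<Longrightarrow> Ck k (\<lambda>x. f x - g x)"
  using Ck_add[of k f "\<lambda>x. (- 1) *\<^sub>R g x"] Ck_scaleR[OF Ck_const, of k g "-1"] by simp

lemma Ck_prod:
  fixes f :: "'i \<Rightarrow> 'a::real_normed_vector \<Rightarrow> real"
  shows "(\<And>i. i \<in> I \<Longrightarrow> Ck k (f i)) \<Longrightarrow> Ck k (\<lambda>x. \<Prod>i\<in>I. f i x)"
proof (induction I rule: infinite_finite_induct)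
  case (insert i I)
  then show ?case by (simp add: Ck_mult)
qed (simp_all add: Ck_const)

text \<open>\<open>H\<close> lists an outer function together with all its derivatives. The chain
  rule leads from \<open>H n\<close> to \<open>H (Suc n)\<close>, so \<open>n\<close> has to stay
  free in the induction on \<open>k\<close>.\<close>

lemma Ck_compose_real:
  fixes H :: "nat \<Rightarrow> real \<Rightarrow> real"
  assumes H: "\<And>n x. (H n has_real_derivative H (Suc n) x) (at x)"
  shows "Ck k q \<Longrightarrow> Ck k (\<lambda>x. H n (q x))"
proof (induction k arbitrary: n)
  case 0
  have "continuous_on UNIV (H n)" using H by (meson DERIV_continuous_on has_field_derivative_at_within)
  then show ?case using 0 by (auto intro: continuous_on_compose2)
next
  case (Suc k)
  obtain q' where q': "\<And>x. (q has_derivative q' x) (at x)" "\<And>v. Ck k (\<lambda>x. q' x v)"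
    using Ck_SucD[OF Suc.prems] by blast
  have "((\<lambda>x. H n (q x)) has_derivative (\<lambda>v. H (Suc n) (q x) * q' x v)) (at x)" for x
    using has_derivative_compose[OF q'(1), of "H n" "(*) (H (Suc n) (q x))" x] H
    by (simp add: has_field_derivative_def)
  then show ?case
    by (rule Ck_SucI) (intro Ck_mult Suc.IH Ck_Suc_imp[OF Suc.prems] q')
qed

text \<open>The functions \<open>p(1/x) exp(-1/x)\<close>, extended by zero, form a class closed
  under differentiation: the polynomial \<open>p\<close> becomes \<open>(p - p') X^2\<close>.
  Iterating from \<open>p = 1\<close>, as in \<open>flat_poly\<close>, gives all derivatives of the
  classical function \<open>exp(-1/x)\<close>.\<close>

definition flat_exp :: "real poly \<Rightarrow> real \<Rightarrow> real" where
  "flat_exp p x = (if 0 < x then poly p (inverse x) * exp (- inverse x) else 0)"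

lemma tendsto_poly_exp: "((\<lambda>t. t ^ k * poly p t * exp (- t)) \<longlongrightarrow> 0) (at_top :: real filter)"
proof (induction p arbitrary: k)
  case (pCons a p)
  have "((\<lambda>t. a * (t ^ k / exp t) + t ^ Suc k * poly p t * exp (- t)) \<longlongrightarrow> a * 0 + 0) (at_top :: real filter)"
    by (intro tendsto_intros tendsto_power_div_exp_0 pCons.IH)
  then show ?case by (simp add: algebra_simps exp_minus divide_inverse)
qed simp

lemma flat_exp_deriv:
  "(flat_exp p has_real_derivative flat_exp ((p - pderiv p) * [:0, 0, 1:]) x) (at x)"
proof (cases x "0 :: real" rule: linorder_cases)
  case less
  have "(flat_exp p has_real_derivative 0) (at x)"
    by (rule has_field_derivative_transform_within_open[where f="\<lambda>_. 0" and S="{..<0}"])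
       (use less in \<open>auto simp: flat_exp_def\<close>)
  then show ?thesis using less by (simp add: flat_exp_def)
next
  case greater
  have "((\<lambda>x. poly p (inverse x) * exp (- inverse x)) has_real_derivative
      flat_exp ((p - pderiv p) * [:0, 0, 1:]) x) (at x)"
    using greater
    by (auto intro!: derivative_eq_intros simp: flat_exp_def power2_eq_square algebra_simps)
  then show ?thesis
    by (rule has_field_derivative_transform_within_open[where S="{0<..}"])
       (use greater in \<open>auto simp: flat_exp_def\<close>)
next
  case equal
  have "((\<lambda>h. flat_exp p h / h) \<longlongrightarrow> 0) (at_left 0)"
    by (rule tendsto_eventually) (auto simp: flat_exp_def eventually_at_left_field intro!: exI[of _ "-1"])
  moreover have "((\<lambda>h. flat_exp p h / h) \<longlongrightarrow> 0) (at_right 0)"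
  proof -
    have "((\<lambda>h. inverse h ^ 1 * poly p (inverse h) * exp (- inverse h)) \<longlongrightarrow> 0) (at_right 0)"
      by (rule filterlim_compose[OF tendsto_poly_exp filterlim_inverse_at_top_right])
    then show ?thesis
      by (rule Lim_transform_eventually)
         (auto simp: flat_exp_def eventually_at_right_field divide_inverse intro!: exI[of _ 1])
  qed
  ultimately have "((\<lambda>h. flat_exp p h / h) \<longlongrightarrow> 0) (at 0)" by (simp add: filterlim_split_at)
  then show ?thesis using equal by (simp add: has_field_derivative_iff flat_exp_def)
qed

primrec flat_poly :: "nat \<Rightarrow> real poly" where
  "flat_poly 0 = 1"
| "flat_poly (Suc n) = (flat_poly n - pderiv (flat_poly n)) * [:0, 0, 1:]"

text \<open>The inner quotient is 0 up to 0 and at least 1 from 1 on, so the argument of the outer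
  \<open>flat_exp 1\<close> is 1 on the left and at most 0 on the right. Composing twice replaces
  the usual integration of a bump function.\<close>

definition smooth_step :: "real \<Rightarrow> real" where
  "smooth_step x = flat_exp 1 (1 - flat_exp 1 x / exp (-1)) / exp (-1)"

lemma smooth_step: "0 \<le> smooth_step x" "smooth_step x \<le> 1"
  "x \<le> 0 \<Longrightarrow> smooth_step x = 1" "1 \<le> x \<Longrightarrow> smooth_step x = 0"
proof -
  have nn: "0 \<le> flat_exp 1 y" for y by (simp add: flat_exp_def)
  have le: "flat_exp 1 y \<le> exp (-1)" if "y \<le> 1" for y
    using that by (auto simp: flat_exp_def field_simps)
  have ge: "exp (-1) \<le> flat_exp 1 y" if "1 \<le> y" for y
    using that by (auto simp: flat_exp_def field_simps)
  show "0 \<le> smooth_step x" using nn by (simp add: smooth_step_def)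
  show "smooth_step x \<le> 1"
    using le[of "1 - flat_exp 1 x / exp (-1)"] nn[of x] by (simp add: smooth_step_def)
  show "x \<le> 0 \<Longrightarrow> smooth_step x = 1" by (simp add: smooth_step_def flat_exp_def)
  show "1 \<le> x \<Longrightarrow> smooth_step x = 0"
    using ge[of x] by (simp add: smooth_step_def flat_exp_def[of _ "1 - _"])
qed

lemma Ck_smooth_step:
  assumes "Ck k q" shows "Ck k (\<lambda>x. smooth_step (q x))"
proof -
  have *: "Ck k (\<lambda>x. flat_exp 1 (q x))" if "Ck k q" for q :: "'a \<Rightarrow> real"
    using Ck_compose_real[of "\<lambda>n. flat_exp (flat_poly n)" k q 0] flat_exp_deriv that by simp
  have "Ck k (\<lambda>x. inverse (exp (-1)) * flat_exp 1 (1 - inverse (exp (-1)) * flat_exp 1 (q x)))"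
    by (intro Ck_mult Ck_const * Ck_diff assms)
  then show ?thesis by (simp add: smooth_step_def field_simps)
qed

text \<open>A finite covering of \<open>K\<close> by balls yields \<open>\<kappa>\<close> as one
  minus a product of factors \<open>1 - \<psi> x\<close>. The open set \<open>N\<close> is there
  because supports are closures: \<open>\<theta>\<close> times \<open>1 - \<kappa>\<close> must have
  its support away from \<open>K\<close>.\<close>

lemma smooth_urysohn:
  fixes K G :: "'a::euclidean_space set"
  assumes K: "compact K" and G: "open G" "K \<subseteq> G"
  shows "\<exists>(\<kappa> :: 'a \<Rightarrow> real) N. (\<forall>k. Ck k \<kappa>) \<and> (\<forall>x. 0 \<le> \<kappa> x \<and> \<kappa> x \<le> 1) \<and>
    open N \<and> K \<subseteq> N \<and> (\<forall>x\<in>N. \<kappa> x = 1) \<and> closure {x. \<kappa> x \<noteq> 0} \<subseteq> G"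
proof -
  have "\<forall>x\<in>K. \<exists>r. 0 < r \<and> cball x (2 * r) \<subseteq> G"
  proof
    fix x assume "x \<in> K"
    then obtain e where "e > 0" "cball x e \<subseteq> G" using G by (meson open_contains_cball subsetD)
    then show "\<exists>r. 0 < r \<and> cball x (2 * r) \<subseteq> G" by (intro exI[of _ "e / 2"]) auto
  qed
  from bchoice[OF this] obtain r where r: "\<And>x. x \<in> K \<Longrightarrow> 0 < r x" "\<And>x. x \<in> K \<Longrightarrow> cball x (2 * r x) \<subseteq> G" by blast
  obtain X where X: "X \<subseteq> K" "finite X" "K \<subseteq> (\<Union>x\<in>X. ball x (r x))"
  proof (rule compactE_image[OF K, of K "\<lambda>x. ball x (r x)"])
    show "K \<subseteq> (\<Union>x\<in>K. ball x (r x))" using r by auto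
  qed auto
  \<comment> \<open>The argument of \<open>smooth_step\<close> is 0 at distance \<open>r x\<close>
    and 1 at distance \<open>2 * r x\<close>, because 4 - 1 = 3.\<close>
  define \<psi> where "\<psi> x y = smooth_step (((y - x) \<bullet> (y - x) - (r x)\<^sup>2) * inverse (3 * (r x)\<^sup>2))" for x y
  define \<kappa> where "\<kappa> y = 1 - (\<Prod>x\<in>X. 1 - \<psi> x y)" for y
  have \<psi>01: "0 \<le> \<psi> x y" "\<psi> x y \<le> 1" for x y by (auto simp: \<psi>_def smooth_step)
  have \<psi>1: "\<psi> x y = 1" if "x \<in> X" "y \<in> ball x (r x)" for x y
  proof -
    have "norm (y - x) \<le> r x" using that by (simp add: dist_norm norm_minus_commute)
    then have "(y - x) \<bullet> (y - x) \<le> (r x)\<^sup>2" by (simp add: dot_square_norm power_mono)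
    then show ?thesis unfolding \<psi>_def by (intro smooth_step) (simp add: mult_nonpos_nonneg)
  qed
  have \<psi>0: "\<psi> x y = 0" if "x \<in> X" "y \<notin> cball x (2 * r x)" for x y
  proof -
    have rx: "0 < r x" using r X that by auto
    have "2 * r x \<le> norm (y - x)" using that by (simp add: dist_norm norm_minus_commute)
    then have "(2 * r x)\<^sup>2 \<le> (norm (y - x))\<^sup>2" using rx by (intro power_mono) auto
    then have "3 * (r x)\<^sup>2 \<le> (y - x) \<bullet> (y - x) - (r x)\<^sup>2"
      by (simp add: power_mult_distrib dot_square_norm)
    then show ?thesis unfolding \<psi>_def using rx by (intro smooth_step) (simp add: field_simps)
  qed
  have "Ck k (\<lambda>y. (y - x) \<bullet> (y - x))" for k and x :: 'a
  proof (cases k)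
    case (Suc m)
    have "Ck m (\<lambda>y. 2 * (v \<bullet> y - v \<bullet> x))" for v
      by (intro Ck_mult Ck_const Ck_diff Ck_bounded_linear bounded_linear_inner_right)
    then show ?thesis unfolding Suc
      by (intro Ck_SucI[where f'="\<lambda>y v. 2 * (v \<bullet> y - v \<bullet> x)"])
         (auto intro!: derivative_eq_intros simp: inner_diff_left inner_diff_right inner_commute algebra_simps)
  qed (auto intro!: continuous_intros)
  then have "Ck k (\<psi> x)" for k x unfolding \<psi>_def
    by (intro Ck_smooth_step Ck_mult Ck_diff Ck_const)
  then have C: "Ck k \<kappa>" for k unfolding \<kappa>_def by (intro Ck_diff Ck_const Ck_prod)
  have P: "0 \<le> (\<Prod>x\<in>X. 1 - \<psi> x y)" "(\<Prod>x\<in>X. 1 - \<psi> x y) \<le> 1" for y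
    using \<psi>01 by (auto intro!: prod_nonneg prod_le_1)
  have "{y. \<kappa> y \<noteq> 0} \<subseteq> (\<Union>x\<in>X. cball x (2 * r x))"
  proof (rule subsetI, rule ccontr)
    fix y assume y: "y \<in> {y. \<kappa> y \<noteq> 0}" "y \<notin> (\<Union>x\<in>X. cball x (2 * r x))"
    then have "(\<Prod>x\<in>X. 1 - \<psi> x y) = 1" by (intro prod.neutral) (use \<psi>0 in auto)
    then show False using y by (simp add: \<kappa>_def)
  qed
  moreover have "closed (\<Union>x\<in>X. cball x (2 * r x))" using X by auto
  ultimately have "closure {y. \<kappa> y \<noteq> 0} \<subseteq> (\<Union>x\<in>X. cball x (2 * r x))" by (rule closure_minimal)
  then have cl: "closure {y. \<kappa> y \<noteq> 0} \<subseteq> G" using r(2) X(1) by blast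
  have "\<kappa> y = 1" if y: "y \<in> (\<Union>x\<in>X. ball x (r x))" for y
  proof -
    from y obtain x where "x \<in> X" "y \<in> ball x (r x)" by blast
    then show "\<kappa> y = 1" using \<psi>1 X by (auto simp: \<kappa>_def prod_zero_iff)
  qed
  moreover have "0 \<le> \<kappa> y \<and> \<kappa> y \<le> 1" for y using P[of y] by (auto simp: \<kappa>_def)
  ultimately show ?thesis using C cl X(3)
    by (intro exI[of _ \<kappa>] exI[of _ "\<Union>x\<in>X. ball x (r x)"]) blast
qed

section \<open>Representability of the first variation\<close>

lemma field_support_subset: "{x. \<theta> x \<noteq> 0} \<subseteq> F \<Longrightarrow> closed F \<Longrightarrow> field_support \<theta> \<subseteq> F"
  unfolding field_support_def by (rule closure_minimal)

lemma zero_test_field: "(\<lambda>x. 0) \<in> test_fields" "field_support (\<lambda>x. 0) = {}"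
  by (auto simp: test_fields_def field_support_def times_cont_diff_iff_Ck Ck_const)

lemma closed_field_support: "closed (field_support \<theta>)"
  by (simp add: field_support_def)

lemma in_field_support: "\<theta> x \<noteq> 0 \<Longrightarrow> x \<in> field_support \<theta>"
  unfolding field_support_def using closure_subset by fastforce

lemma test_fields_add:
  assumes "\<theta> \<in> test_fields" "\<eta> \<in> test_fields"
  shows "(\<lambda>x. \<theta> x + \<eta> x) \<in> test_fields" "field_support (\<lambda>x. \<theta> x + \<eta> x) \<subseteq> field_support \<theta> \<union> field_support \<eta>"
proof -
  show s: "field_support (\<lambda>x. \<theta> x + \<eta> x) \<subseteq> field_support \<theta> \<union> field_support \<eta>"
  proof (intro field_support_subset closed_Un closed_field_support subsetI)
    fix x assume "x \<in> {x. \<theta> x + \<eta> x \<noteq> 0}"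
    then show "x \<in> field_support \<theta> \<union> field_support \<eta>"
      using in_field_support[of \<theta> x] in_field_support[of \<eta> x] by (cases "\<theta> x = 0") auto
  qed
  have "compact (field_support \<theta> \<union> field_support \<eta>)" using assms by (auto simp: test_fields_def)
  then have "compact (field_support (\<lambda>x. \<theta> x + \<eta> x))"
    using s closed_field_support by (metis compact_Int_closed inf.absorb2 inf_commute)
  then show "(\<lambda>x. \<theta> x + \<eta> x) \<in> test_fields"
    using assms by (auto simp: test_fields_def times_cont_diff_iff_Ck Ck_add)
qed

lemma test_fields_scale:
  assumes "\<theta> \<in> test_fields" "\<And>k. Ck k \<kappa>"
  shows "(\<lambda>x. \<kappa> x *\<^sub>R \<theta> x) \<in> test_fields" "field_support (\<lambda>x. \<kappa> x *\<^sub>R \<theta> x) \<subseteq> field_support \<theta>"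
proof -
  show s: "field_support (\<lambda>x. \<kappa> x *\<^sub>R \<theta> x) \<subseteq> field_support \<theta>"
    by (intro field_support_subset closed_field_support) (auto intro: in_field_support)
  then have "compact (field_support (\<lambda>x. \<kappa> x *\<^sub>R \<theta> x))"
    using assms(1) closed_field_support by (metis (mono_tags, lifting) compact_Int_closed inf.absorb2 inf_commute mem_Collect_eq test_fields_def)
  then show "(\<lambda>x. \<kappa> x *\<^sub>R \<theta> x) \<in> test_fields"
    using assms by (auto simp: test_fields_def times_cont_diff_iff_Ck Ck_scaleR)
qed

lemma ennreal_SUP_add_le:
  fixes f :: "'i \<Rightarrow> ennreal" and g :: "'j \<Rightarrow> ennreal"
  assumes "I \<noteq> {}" "J \<noteq> {}" "\<And>i j. i \<in> I \<Longrightarrow> j \<in> J \<Longrightarrow> f i + g j \<le> c"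
  shows "(SUP i\<in>I. f i) + (SUP j\<in>J. g j) \<le> c"
proof -
  have "f i + (SUP j\<in>J. g j) \<le> c" if "i \<in> I" for i
    unfolding ennreal_SUP_add_right[OF assms(2)] using assms(3)[OF that] by (rule SUP_least)
  then show ?thesis unfolding ennreal_SUP_add_left[OF assms(1), symmetric] by (rule SUP_least)
qed

lemma ennreal_add_le: "ennreal (a + b) \<le> ennreal a + ennreal b"
  by (cases "0 \<le> a"; cases "0 \<le> b") (auto simp: ennreal_neg ennreal_plus[symmetric] simp del: ennreal_plus intro!: ennreal_leI)

context
  fixes V :: "((real^'n) \<times> (real^'n) set) measure" and M :: real
  assumes additive: "\<And>\<theta> \<eta>. \<theta> \<in> test_fields \<Longrightarrow> \<eta> \<in> test_fields \<Longrightarrow>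
      first_variation V (\<lambda>x. \<theta> x + \<eta> x) = first_variation V \<theta> + first_variation V \<eta>"
    and bound: "\<And>\<theta>. \<theta> \<in> test_fields \<Longrightarrow> (\<And>x. norm (\<theta> x) \<le> 1) \<Longrightarrow> first_variation V \<theta> \<le> M"
begin

lemma first_variation_zero: "first_variation V (\<lambda>x. 0) = 0"
  using additive[OF zero_test_field(1) zero_test_field(1)] by simp

lemma variation_ge:
  "\<theta> \<in> test_fields \<Longrightarrow> field_support \<theta> \<subseteq> G \<Longrightarrow> (\<And>x. norm (\<theta> x) \<le> 1) \<Longrightarrow>
    ennreal (first_variation V \<theta>) \<le> variation_on_open V G"
  unfolding variation_on_open_def by (intro SUP_upper) auto

lemma variation_le:
  "(\<And>\<theta>. \<theta> \<in> test_fields \<Longrightarrow> field_support \<theta> \<subseteq> G \<Longrightarrow> (\<And>x. norm (\<theta> x) \<le> 1) \<Longrightarrow>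
    ennreal (first_variation V \<theta>) \<le> c) \<Longrightarrow> variation_on_open V G \<le> c"
  unfolding variation_on_open_def by (intro SUP_least) auto

lemma variation_mono: "G \<subseteq> G' \<Longrightarrow> variation_on_open V G \<le> variation_on_open V G'"
  by (intro variation_le variation_ge) auto

lemma variation_bound: "variation_on_open V G \<le> ennreal M"
  by (intro variation_le ennreal_leI bound) auto

lemma variation_finite: "variation_on_open V G < top"
  by (rule order_le_less_trans[OF variation_bound ennreal_less_top])

lemma variation_empty: "variation_on_open V {} = 0"
proof -
  have "\<theta> = (\<lambda>x. 0)" if "field_support \<theta> \<subseteq> {}" for \<theta> :: "real^'n \<Rightarrow> real^'n"
    using that in_field_support[of \<theta>] by auto
  then have "variation_on_open V {} \<le> 0"
    by (intro variation_le) (metis first_variation_zero ennreal_0 order_refl)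
  then show ?thesis by simp
qed

text \<open>\<open>\<theta>\<close> is split by a cut-off function that is 1 near the part of its
  support outside \<open>G'\<close>. Both summands are multiples of \<open>\<theta>\<close> by
  factors between 0 and 1, hence again admissible.\<close>

lemma variation_Un:
  assumes "open G" "open G'"
  shows "variation_on_open V (G \<union> G') \<le> variation_on_open V G + variation_on_open V G'"
proof (rule variation_le)
  fix \<theta> :: "real^'n \<Rightarrow> real^'n"
  assume \<theta>: "\<theta> \<in> test_fields" "field_support \<theta> \<subseteq> G \<union> G'" "\<And>x. norm (\<theta> x) \<le> 1"
  have "compact (field_support \<theta> - G')" using \<theta>(1) assms(2) by (auto simp: test_fields_def intro: compact_diff)
  moreover have "field_support \<theta> - G' \<subseteq> G" using \<theta>(2) by blast
  ultimately have "\<exists>(\<kappa> :: real^'n \<Rightarrow> real) N. (\<forall>k. Ck k \<kappa>) \<and> (\<forall>x. 0 \<le> \<kappa> x \<and> \<kappa> x \<le> 1) \<and>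
      open N \<and> field_support \<theta> - G' \<subseteq> N \<and> (\<forall>x\<in>N. \<kappa> x = 1) \<and> closure {x. \<kappa> x \<noteq> 0} \<subseteq> G"
    by (rule smooth_urysohn[OF _ assms(1)])
  then obtain \<kappa> :: "real^'n \<Rightarrow> real" and N where k: "\<forall>k. Ck k \<kappa>" "\<forall>x. 0 \<le> \<kappa> x \<and> \<kappa> x \<le> 1"
    "open N" "field_support \<theta> - G' \<subseteq> N" "\<forall>x\<in>N. \<kappa> x = 1" "closure {x. \<kappa> x \<noteq> 0} \<subseteq> G"
    by (elim exE conjE) (rule that)
  have \<kappa>: "\<And>k. Ck k \<kappa>" "\<And>x. 0 \<le> \<kappa> x" "\<And>x. \<kappa> x \<le> 1"
    "open N" "field_support \<theta> - G' \<subseteq> N" "\<And>x. x \<in> N \<Longrightarrow> \<kappa> x = 1" "closure {x. \<kappa> x \<noteq> 0} \<subseteq> G"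
    using k by simp_all
  let ?f = "\<lambda>x. \<kappa> x *\<^sub>R \<theta> x" and ?g = "\<lambda>x. (1 - \<kappa> x) *\<^sub>R \<theta> x"
  have f: "?f \<in> test_fields" and g: "?g \<in> test_fields"
    by (intro test_fields_scale \<theta> Ck_diff Ck_const \<kappa>)+
  have n: "norm (c *\<^sub>R \<theta> x) \<le> 1" if "0 \<le> c" "c \<le> 1" for c x
    using mult_mono[of c 1 "norm (\<theta> x)" 1] that \<theta>(3) by simp
  have "field_support ?f \<subseteq> closure {x. \<kappa> x \<noteq> 0}"
    by (intro field_support_subset) (use closure_subset in fastforce)+
  then have sf: "field_support ?f \<subseteq> G" using \<kappa>(7) by blast
  have "field_support ?g \<subseteq> field_support \<theta> - N"
    by (intro field_support_subset closed_Diff closed_field_support \<kappa>)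
       (use in_field_support[of \<theta>] \<kappa>(6) in fastforce)
  then have sg: "field_support ?g \<subseteq> G'" using \<kappa>(5) by blast
  have "first_variation V \<theta> = first_variation V (\<lambda>x. ?f x + ?g x)"
    by (simp add: scaleR_left_diff_distrib)
  also have "\<dots> = first_variation V ?f + first_variation V ?g" by (rule additive[OF f g])
  finally have "ennreal (first_variation V \<theta>) \<le> ennreal (first_variation V ?f) + ennreal (first_variation V ?g)"
    by (simp add: ennreal_add_le)
  also have "\<dots> \<le> variation_on_open V G + variation_on_open V G'"
    by (intro add_mono variation_ge f g sf sg n) (use \<kappa> in auto)
  finally show "ennreal (first_variation V \<theta>) \<le> variation_on_open V G + variation_on_open V G'" .
qed

text \<open>The compact support of a test field meets the union in finitely many \<open>G i\<close>,
  which reduces the claim to finite subadditivity.\<close>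

lemma variation_UN:
  fixes G :: "nat \<Rightarrow> (real^'n) set"
  assumes "\<And>i. open (G i)"
  shows "variation_on_open V (\<Union>i. G i) \<le> (\<Sum>i. variation_on_open V (G i))"
proof (rule variation_le)
  fix \<theta> :: "real^'n \<Rightarrow> real^'n"
  assume \<theta>: "\<theta> \<in> test_fields" "field_support \<theta> \<subseteq> (\<Union>i. G i)" "\<And>x. norm (\<theta> x) \<le> 1"
  have fin: "variation_on_open V (\<Union>i<n. G i) \<le> (\<Sum>i<n. variation_on_open V (G i))" for n
  proof (induction n)
    case (Suc n)
    have "variation_on_open V (\<Union>i<Suc n. G i) \<le> variation_on_open V (\<Union>i<n. G i) + variation_on_open V (G n)"
      using variation_Un[OF open_UN[of "{..<n}" G] assms[of n]] assms by (simp add: lessThan_Suc Un_commute)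
    also have "\<dots> \<le> (\<Sum>i<Suc n. variation_on_open V (G i))" using Suc by (simp add: add_right_mono)
    finally show ?case .
  qed (simp add: variation_empty)
  obtain I where I: "finite I" "field_support \<theta> \<subseteq> (\<Union>i\<in>I. G i)"
    using \<theta>(1,2) assms compactE_image[of "field_support \<theta>" UNIV G] by (auto simp: test_fields_def)
  obtain n where n: "I \<subseteq> {..<n}" using I(1) finite_nat_iff_bounded by blast
  have "ennreal (first_variation V \<theta>) \<le> variation_on_open V (\<Union>i<n. G i)"
    using I(2) n by (intro variation_ge \<theta>) blast
  also have "\<dots> \<le> (\<Sum>i<n. variation_on_open V (G i))" by (rule fin)
  also have "\<dots> \<le> (\<Sum>i. variation_on_open V (G i))" by (intro sum_le_suminf summableI) auto
  finally show "ennreal (first_variation V \<theta>) \<le> (\<Sum>i. variation_on_open V (G i))" .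
qed

text \<open>At every point at most one of two fields with disjoint supports is nonzero, so their sum
  is still bounded by 1.\<close>

lemma variation_disjoint:
  assumes "G \<inter> G' = {}"
  shows "variation_on_open V G + variation_on_open V G' \<le> variation_on_open V (G \<union> G')"
proof -
  let ?T = "\<lambda>G. {\<theta> \<in> test_fields. field_support \<theta> \<subseteq> G \<and> (\<forall>x. norm (\<theta> x) \<le> 1)}"
  have ne: "?T G \<noteq> {}" for G using zero_test_field by force
  have *: "ennreal (first_variation V \<theta>) + ennreal (first_variation V \<eta>) \<le> variation_on_open V (G \<union> G')"
    if \<theta>: "\<theta> \<in> ?T G" and \<eta>: "\<eta> \<in> ?T G'" for \<theta> \<eta>
  proof (cases "0 \<le> first_variation V \<theta> \<and> 0 \<le> first_variation V \<eta>")
    case True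
    have t: "\<theta> \<in> test_fields" "\<eta> \<in> test_fields" using \<theta> \<eta> by auto
    have "norm (\<theta> x + \<eta> x) \<le> 1" for x
    proof -
      have "\<theta> x = 0 \<or> \<eta> x = 0" using in_field_support[of \<theta> x] in_field_support[of \<eta> x] \<theta> \<eta> assms by blast
      then show ?thesis using \<theta> \<eta> by auto
    qed
    then have "ennreal (first_variation V (\<lambda>x. \<theta> x + \<eta> x)) \<le> variation_on_open V (G \<union> G')"
      using test_fields_add[OF t] \<theta> \<eta> by (intro variation_ge) auto
    then show ?thesis using True by (simp add: additive[OF t])
  next
    case False
    have "ennreal (first_variation V \<theta>) \<le> variation_on_open V (G \<union> G')"
      "ennreal (first_variation V \<eta>) \<le> variation_on_open V (G \<union> G')"
      using \<theta> \<eta> by (auto intro!: variation_ge)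
    \<comment> \<open>\<open>ennreal\<close> sends a negative number to 0, so one of the two
      summands disappears.\<close>
    then show ?thesis using False by (auto simp: ennreal_neg)
  qed
  show ?thesis unfolding variation_on_open_def[of V G] variation_on_open_def[of V G']
    by (rule ennreal_SUP_add_le[OF ne ne *])
qed

text \<open>The passage of De Giorgi and Letta from a set function on open sets to a Borel measure:
  extend from outside, then apply Caratheodory's criterion.\<close>

definition variation_outer :: "(real^'n) set \<Rightarrow> ennreal" where
  "variation_outer A = (INF G\<in>{G. open G \<and> A \<subseteq> G}. variation_on_open V G)"

lemma variation_outer_open: "open G \<Longrightarrow> variation_outer G = variation_on_open V G"
  unfolding variation_outer_def
  by (intro antisym INF_lower INF_greatest) (auto intro: variation_mono)

lemma metric_outer_measure_variation: "metric_outer_measure variation_outer"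
  unfolding metric_outer_measure_def
proof (intro conjI allI impI; (elim conjE)?)
  show "variation_outer {} = 0" by (simp add: variation_outer_open variation_empty)
  show "variation_outer A \<le> variation_outer B" if "A \<subseteq> B" for A B
    unfolding variation_outer_def using that by (intro INF_superset_mono) auto
next
  fix A :: "nat \<Rightarrow> (real^'n) set"
  show "variation_outer (\<Union>i. A i) \<le> (\<Sum>i. variation_outer (A i))"
  proof (rule ennreal_le_epsilon)
    fix e :: real assume "0 < e"
    define d where "d i = ennreal (e * (1/2) ^ Suc i)" for i
    have "\<exists>G. open G \<and> A i \<subseteq> G \<and> variation_on_open V G \<le> variation_outer (A i) + d i" for i
    proof -
      have "variation_outer (A i) \<le> variation_on_open V UNIV"
        unfolding variation_outer_def by (intro INF_lower) auto
      also note variation_finite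
      finally have "variation_outer (A i) < variation_outer (A i) + d i"
        using \<open>0 < e\<close> by (cases "variation_outer (A i)")
         (auto simp: d_def ennreal_plus[symmetric] ennreal_less_iff simp del: ennreal_plus)
      then show ?thesis unfolding variation_outer_def[of "A i"] INF_less_iff by (auto intro: less_imp_le)
    qed
    then obtain G where G: "\<And>i. open (G i)" "\<And>i. A i \<subseteq> G i"
      "\<And>i. variation_on_open V (G i) \<le> variation_outer (A i) + d i" by metis
    have "variation_outer (\<Union>i. A i) \<le> variation_on_open V (\<Union>i. G i)"
      unfolding variation_outer_def using G by (intro INF_lower) auto
    also have "\<dots> \<le> (\<Sum>i. variation_on_open V (G i))" by (rule variation_UN[OF G(1)])
    also have "\<dots> \<le> (\<Sum>i. variation_outer (A i) + d i)" by (intro suminf_le G summableI)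
    also have "\<dots> = (\<Sum>i. variation_outer (A i)) + (\<Sum>i. d i)" by (intro suminf_add[symmetric] summableI)
    also have "(\<Sum>i. d i) = ennreal e"
      unfolding d_def using sums_mult[OF power_half_series, of e] \<open>0 < e\<close>
      by (subst suminf_ennreal2) (auto simp: sums_iff)
    finally show "variation_outer (\<Union>i. A i) \<le> (\<Sum>i. variation_outer (A i)) + ennreal e" .
  qed
next
  fix A B :: "(real^'n) set" and d :: real
  assume d: "0 < d" "\<forall>x\<in>A. \<forall>y\<in>B. d \<le> dist x y"
  \<comment> \<open>Neighbourhoods of half the distance are disjoint, so
    \<open>variation_disjoint\<close> applies to their intersections with \<open>G\<close>.\<close>
  let ?N = "\<lambda>A. \<Union>x\<in>A. ball x (d / 2)"
  have disj: "?N A \<inter> ?N B = {}"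
  proof (rule ccontr)
    assume "?N A \<inter> ?N B \<noteq> {}"
    then obtain x y z where "x \<in> A" "y \<in> B" "dist x z < d / 2" "dist y z < d / 2" by auto
    then show False using d(2) dist_triangle2[of x y z] by force
  qed
  show "variation_outer A + variation_outer B \<le> variation_outer (A \<union> B)"
    unfolding variation_outer_def[of "A \<union> B"]
  proof (rule INF_greatest, clarify)
    fix G assume G: "open G" "A \<union> B \<subseteq> G"
    have "variation_outer A + variation_outer B
        \<le> variation_on_open V (G \<inter> ?N A) + variation_on_open V (G \<inter> ?N B)"
      unfolding variation_outer_def using G d(1) by (intro add_mono INF_lower) auto
    also have "\<dots> \<le> variation_on_open V (G \<inter> ?N A \<union> G \<inter> ?N B)"
      by (intro variation_disjoint) (use disj in blast)
    also have "\<dots> \<le> variation_on_open V G" by (intro variation_mono) auto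
    finally show "variation_outer A + variation_outer B \<le> variation_on_open V G" .
  qed
qed

lemma first_variation_representableI: "first_variation_representable V"
  unfolding first_variation_representable_def
proof (intro exI conjI allI impI)
  let ?\<nu> = "measure_of UNIV (sets borel) variation_outer"
  have b: "sets (borel_of (euclidean :: (real^'n) topology)) = sets borel"
    unfolding borel_of_def borel_def by simp
  have "emeasure ?\<nu> K < \<infinity>" if "compact K" for K
  proof -
    have "emeasure ?\<nu> K = variation_outer K" using that
      by (intro emeasure_metric_outer_measure metric_outer_measure_variation) (simp add: borel_compact)
    also have "\<dots> \<le> variation_on_open V UNIV" unfolding variation_outer_def by (intro INF_lower) auto
    also note variation_finite
    finally show ?thesis by simp
  qed
  then show "radon_measure euclidean ?\<nu>"
    by (simp add: radon_measure_def b sets_measure_of_borel)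
  show "emeasure ?\<nu> G = variation_on_open V G" if "open G" for G
    using that emeasure_metric_outer_measure[OF metric_outer_measure_variation, of G]
    by (simp add: variation_outer_open)
qed

end

section \<open>Densities and approximate tangent cones\<close>

text \<open>Let \<open>N k\<close> consist of the points of \<open>B\<close> at which arbitrarily
  small balls are bad at level \<open>k\<close>. Such a ball has Lebesgue measure at most a constant
  times its \<open>\<kappa>\<close> measure. Vitali's theorem covers almost all of
  \<open>N k\<close> by disjoint bad balls inside an open set of tiny \<open>\<kappa>\<close>
  measure around \<open>B\<close>; hence \<open>N k\<close> is negligible.\<close>

lemma null_set_density:
  fixes \<kappa> :: "'a::euclidean_space measure"
  assumes \<kappa>: "sets \<kappa> = sets borel" "finite_measure \<kappa>" and B: "B \<in> sets borel" "emeasure \<kappa> B = 0"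
  shows "AE x in lborel. x \<in> B \<longrightarrow> ((\<lambda>r. measure \<kappa> (cball x r) / r ^ DIM('a)) \<longlongrightarrow> 0) (at_right 0)"
proof -
  interpret finite_measure \<kappa> by fact
  note [measurable_cong] = \<kappa>(1)
  define bad where "bad k x r \<longleftrightarrow> r ^ DIM('a) / real (Suc k) < measure \<kappa> (cball x r)" for k x r
  define N where "N k = {x \<in> B. \<forall>\<delta>>0. \<exists>r>0. r < \<delta> \<and> bad k x r}" for k
  have negN: "negligible (N k)" for k
  proof (rule negligible_outer_le[THEN iffD2], intro allI impI)
    fix e :: real assume e: "0 < e"
    define v where "v = unit_ball_vol (DIM('a))"
    have v: "0 < v" by (simp add: v_def)
    \<comment> \<open>For a bad ball the ratio of Lebesgue measure to \<open>\<kappa>\<close>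
      measure is at most \<open>v * real (Suc k)\<close>; a total \<open>\<kappa>\<close> measure
      below \<open>\<epsilon>\<close> thus gives Lebesgue measure at most \<open>e\<close>.\<close>
    define \<epsilon> where "\<epsilon> = e / (v * real (Suc k))"
    have \<epsilon>: "0 < \<epsilon>" using e v by (simp add: \<epsilon>_def)
    have "(INF U\<in>{U. B \<subseteq> U \<and> open U}. emeasure \<kappa> U) = 0"
      using outer_regular[OF \<kappa>(1) _ B(1)] B(2) by simp
    then have "(INF U\<in>{U. B \<subseteq> U \<and> open U}. emeasure \<kappa> U) < ennreal \<epsilon>" using \<epsilon> by simp
    then obtain U where U: "B \<subseteq> U" "open U" "emeasure \<kappa> U < ennreal \<epsilon>"
      unfolding INF_less_iff by blast
    define K where "K = {(x, r). x \<in> N k \<and> 0 < r \<and> cball x r \<subseteq> U \<and> bad k x r}"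
    have cov: "\<exists>i. i \<in> K \<and> x \<in> cball (fst i) (snd i) \<and> snd i < d" if x: "x \<in> N k" "0 < d" for x d
    proof -
      have "x \<in> U" using x U by (auto simp: N_def)
      then obtain d' where d': "0 < d'" "cball x d' \<subseteq> U" using U(2) open_contains_cball by blast
      obtain r where "0 < r" "r < min d d'" "bad k x r" using x d' unfolding N_def by (auto dest!: spec[of _ "min d d'"])
      moreover have "cball x r \<subseteq> cball x d'" using \<open>r < min d d'\<close> by (intro subset_cball) simp
      ultimately show ?thesis using d' x by (intro exI[of _ "(x, r)"]) (auto simp: K_def)
    qed
    have pos: "0 < snd i" if "i \<in> K" for i using that by (auto simp: K_def)
    obtain C where C: "countable C" "C \<subseteq> K"
      "pairwise (\<lambda>i j. disjnt (cball (fst i) (snd i)) (cball (fst j) (snd j))) C"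
      "negligible (N k - (\<Union>i\<in>C. cball (fst i) (snd i)))"
    proof (rule Vitali_covering_theorem_cballs[of K snd "N k" fst], goal_cases)
      case (1 i)
      show ?case by (rule pos[OF 1(2)])
    next
      case (2 x d)
      show ?case by (rule cov[OF 2(2,3)])
    next
      case (3 C)
      show thesis by (rule that[OF 3(2-5)])
    qed
    let ?X = "\<lambda>i. cball (fst i) (snd i)"
    let ?T = "\<Union>i\<in>C. ?X i"
    have dX: "disjoint_family_on ?X C" using C(3) by (auto simp: disjoint_family_on_def pairwise_def disjnt_def)
    have mT: "?T \<in> sets borel" using C(1) by (intro sets.countable_UN') auto
    have "emeasure lborel ?T = (\<integral>\<^sup>+i. emeasure lborel (?X i) \<partial>count_space C)"
      by (rule emeasure_UN_countable[OF _ C(1) dX]) simp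
    also have "\<dots> \<le> (\<integral>\<^sup>+i. ennreal (v * real (Suc k)) * emeasure \<kappa> (?X i) \<partial>count_space C)"
    proof (intro nn_integral_mono)
      fix i assume "i \<in> space (count_space C)"
      then have i: "0 < snd i" "bad k (fst i) (snd i)" using C(2) by (auto simp: K_def)
      have "emeasure lborel (?X i) = ennreal (v * snd i ^ DIM('a))"
        using i by (simp add: emeasure_cball v_def)
      also have "\<dots> \<le> ennreal (v * (real (Suc k) * measure \<kappa> (?X i)))"
        using i v by (intro ennreal_leI mult_left_mono) (auto simp: bad_def field_simps)
      also have "\<dots> = ennreal (v * real (Suc k)) * emeasure \<kappa> (?X i)"
        using v by (simp add: emeasure_eq_measure ennreal_mult[symmetric] mult.assoc)
      finally show "emeasure lborel (?X i) \<le> ennreal (v * real (Suc k)) * emeasure \<kappa> (?X i)" .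
    qed
    also have "\<dots> = ennreal (v * real (Suc k)) * (\<integral>\<^sup>+i. emeasure \<kappa> (?X i) \<partial>count_space C)"
      by (rule nn_integral_cmult) simp
    also have "(\<integral>\<^sup>+i. emeasure \<kappa> (?X i) \<partial>count_space C) = emeasure \<kappa> ?T"
      by (rule emeasure_UN_countable[OF _ C(1) dX, symmetric]) simp
    also have "emeasure \<kappa> ?T \<le> emeasure \<kappa> U"
    proof (intro emeasure_mono UN_least)
      show "?X i \<subseteq> U" if "i \<in> C" for i using subsetD[OF C(2) that] by (simp add: K_def split_beta)
    qed (use U(2) \<kappa>(1) in auto)
    also have "\<dots> \<le> ennreal \<epsilon>" using U(3) by simp
    also have "ennreal (v * real (Suc k)) * ennreal \<epsilon> = ennreal e"
      using v \<epsilon> by (simp add: ennreal_mult[symmetric] \<epsilon>_def del: of_nat_Suc)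
    finally have T: "emeasure lborel ?T \<le> ennreal e" by (simp add: mult_left_mono)
    have T': "?T \<in> lmeasurable"
      using mT T by (intro fmeasurableI) (auto simp: le_less_trans)
    show "\<exists>T. N k \<subseteq> T \<and> T \<in> lmeasurable \<and> measure lebesgue T \<le> e"
    proof (intro exI conjI)
      show "N k \<subseteq> ?T \<union> (N k - ?T)" by blast
      show "?T \<union> (N k - ?T) \<in> lmeasurable"
        using T' C(4) by (meson fmeasurable.Un negligible_iff_measure)
      have "measure lebesgue (?T \<union> (N k - ?T)) \<le> measure lebesgue ?T + measure lebesgue (N k - ?T)"
        using T' C(4) by (intro measure_Un_le) (auto simp: fmeasurableD negligible_iff_null_sets)
      also have "measure lebesgue (N k - ?T) = 0" using C(4) by (simp add: negligible_iff_measure)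
      also have "measure lebesgue ?T = measure lborel ?T" using mT by simp
      also have "\<dots> \<le> e" using T e by (simp add: measure_def enn2real_leI)
      finally show "measure lebesgue (?T \<union> (N k - ?T)) \<le> e" by simp
    qed
  qed
  then have "negligible (\<Union>k. N k)" by (intro negligible_countable_Union) auto
  then have "AE x in lebesgue. x \<notin> (\<Union>k. N k)"
    by (intro AE_not_in) (simp add: negligible_iff_null_sets)
  then have "AE x in lborel. x \<notin> (\<Union>k. N k)" by (simp add: AE_completion_iff)
  then show ?thesis
  proof (eventually_elim, intro impI tendstoI)
    fix x and e :: real assume x: "x \<notin> (\<Union>k. N k)" "x \<in> B" and e: "0 < e"
    obtain k where k: "1 / real (Suc k) < e" using e nat_approx_posE by blast
    have "x \<notin> N k" using x by blast
    then obtain \<delta> where \<delta>: "\<delta> > 0" "\<And>r. 0 < r \<Longrightarrow> r < \<delta> \<Longrightarrow> \<not> bad k x r" using x(2) by (auto simp: N_def)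
    have "dist (measure \<kappa> (cball x r) / r ^ DIM('a)) 0 < e" if "0 < r" "r < \<delta>" for r
    proof -
      have "measure \<kappa> (cball x r) / r ^ DIM('a) \<le> (r ^ DIM('a) / real (Suc k)) / r ^ DIM('a)"
        using \<delta>(2)[OF that] that by (intro divide_right_mono) (auto simp: bad_def)
      also have "\<dots> = 1 / real (Suc k)" using that by simp
      also note k
      finally show ?thesis using that by simp
    qed
    then show "\<forall>\<^sub>F r in at_right 0. dist (measure \<kappa> (cball x r) / r ^ DIM('a)) 0 < e"
      unfolding eventually_at_right_field using \<delta>(1) by blast
  qed
qed

section \<open>Orthogonal projections, hyperplanes and tangent cones\<close>

lemma orth_proj_unique:
  fixes S :: "(real^'n) set"
  assumes S: "subspace S" and y: "y \<in> S" "x - y \<in> S\<^sup>\<bottom>"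
  shows "(THE y. y \<in> S \<and> x - y \<in> S\<^sup>\<bottom>) = y"
proof (rule the_equality)
  fix w assume w: "w \<in> S \<and> x - w \<in> S\<^sup>\<bottom>"
  have d: "w - y \<in> S" using S w y by (simp add: subspace_diff)
  have "(x - y) - (x - w) \<in> S\<^sup>\<bottom>" 
    by (rule subspace_diff[OF subspace_orthogonal_comp y(2) conjunct2[OF w]])
  then have "w - y \<in> S\<^sup>\<bottom>" by simp
  then have "orthogonal (w - y) (w - y)" using d by (auto simp: orthogonal_comp_def)
  then show "w = y" by (simp add: orthogonal_def)
qed (use y in auto)

lemma orth_proj_mult:
  fixes S :: "(real^'n) set"
  assumes S: "subspace S"
  shows "orth_proj S *v x \<in> S" "x - orth_proj S *v x \<in> S\<^sup>\<bottom>"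
proof -
  define f where "f x = (THE y. y \<in> S \<and> x - y \<in> S\<^sup>\<bottom>)" for x :: "real^'n"
  have f: "f x \<in> S" "x - f x \<in> S\<^sup>\<bottom>" for x
  proof -
    obtain y z where yz: "y \<in> span S" "\<And>w. w \<in> span S \<Longrightarrow> orthogonal z w" "x = y + z"
      using orthogonal_subspace_decomp_exists[of S x] by blast
    then have "y \<in> S" "x - y \<in> S\<^sup>\<bottom>"
      using S by (auto simp: span_eq_iff[THEN iffD2] orthogonal_comp_def orthogonal_commute)
    then show "f x \<in> S" "x - f x \<in> S\<^sup>\<bottom>" using orth_proj_unique[OF S, of y x] by (simp_all add: f_def)
  qed
  have "linear f"
  proof (rule linearI)
    fix b1 b2 :: "real^'n"
    have "f b1 + f b2 \<in> S" using f S by (simp add: subspace_add)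
    moreover have "(b1 - f b1) + (b2 - f b2) \<in> S\<^sup>\<bottom>" using f by (intro subspace_add subspace_orthogonal_comp)
    ultimately show "f (b1 + b2) = f b1 + f b2"
      unfolding f_def[of "b1 + b2"] by (intro orth_proj_unique[OF S]) (auto simp: algebra_simps)
  next
    fix r and b :: "real^'n"
    have "r *\<^sub>R f b \<in> S" using f S by (simp add: subspace_scale)
    moreover have "r *\<^sub>R (b - f b) \<in> S\<^sup>\<bottom>" using f by (intro subspace_scale subspace_orthogonal_comp)
    ultimately show "f (r *\<^sub>R b) = r *\<^sub>R f b"
      unfolding f_def[of "r *\<^sub>R b"] by (intro orth_proj_unique[OF S]) (auto simp: algebra_simps)
  qed
  then have "orth_proj S *v x = f x" unfolding orth_proj_def f_def[symmetric] by (simp add: matrix_works)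
  then show "orth_proj S *v x \<in> S" "x - orth_proj S *v x \<in> S\<^sup>\<bottom>" using f by simp_all
qed

text \<open>A subspace is the fixed point set of its projection.\<close>

lemma orth_proj_inj:
  assumes "subspace S" "subspace T" "orth_proj S = orth_proj T"
  shows "S = T"
proof -
  have "S = {x. orth_proj S *v x = x}" if S: "subspace S" for S :: "(real^'n) set"
  proof (intro set_eqI iffI)
    fix x assume "x \<in> S"
    then have d: "x - orth_proj S *v x \<in> S" using orth_proj_mult[OF S] S by (simp add: subspace_diff)
    then have "orthogonal (x - orth_proj S *v x) (x - orth_proj S *v x)"
      using orth_proj_mult(2)[OF S, of x] by (auto simp: orthogonal_comp_def)
    then show "x \<in> {x. orth_proj S *v x = x}" by (simp add: orthogonal_def)
  qed (use orth_proj_mult(1)[OF S] in auto, metis)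
  then show ?thesis using assms by metis
qed

definition hyperplane :: "real^'n \<Rightarrow> (real^'n) set" where
  "hyperplane n = {v. n \<bullet> v = 0}"

text \<open>The identity minus the projection onto the line spanned by \<open>n\<close>, which may
  have any length. At \<open>n = 0\<close> division by zero makes it the identity matrix, so that
  the formula is a Borel function on the whole space.\<close>

definition hyper_proj :: "real^'n \<Rightarrow> real^'n^'n" where
  "hyper_proj n = (\<chi> i j. (if i = j then 1 else 0) - n $ i * n $ j / (n \<bullet> n))"

lemma subspace_hyperplane: "subspace (hyperplane n)"
  by (simp add: hyperplane_def subspace_hyperplane)

lemma hyperplane_grassmannian: "n \<noteq> 0 \<Longrightarrow> hyperplane n \<in> grassmannian (CARD('n) - 1)" for n :: "real^'n"
  unfolding grassmannian_def using subspace_hyperplane[of n] dim_hyperplane[of n] by (simp add: hyperplane_def)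

lemma orth_proj_hyperplane:
  assumes "n \<noteq> 0" shows "orth_proj (hyperplane n) = hyper_proj n"
proof -
  have "(THE y. y \<in> hyperplane n \<and> x - y \<in> (hyperplane n)\<^sup>\<bottom>) = x - (n \<bullet> x / (n \<bullet> n)) *\<^sub>R n" for x
    using assms by (intro orth_proj_unique subspace_hyperplane)
      (auto simp: hyperplane_def orthogonal_comp_def orthogonal_def inner_diff_right inner_commute)
  then have "orth_proj (hyperplane n) = matrix (\<lambda>x. x - (n \<bullet> x / (n \<bullet> n)) *\<^sub>R n)"
    by (simp add: orth_proj_def)
  also have "\<dots> = hyper_proj n"
    by (simp add: matrix_def hyper_proj_def vec_eq_iff inner_axis) (simp add: axis_def)
  finally show ?thesis .
qed

lemma borel_measurable_vecI:
  fixes f :: "'x \<Rightarrow> 'a::euclidean_space^'n"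
  assumes "\<And>i. (\<lambda>x. f x $ i) \<in> borel_measurable M" shows "f \<in> borel_measurable M"
  using assms
  by (subst borel_measurable_euclidean_space) (auto simp: Basis_vec_def inner_axis intro: borel_measurable_inner)

lemma measurable_hyper_proj [measurable]: "hyper_proj \<in> borel_measurable borel"
  by (intro borel_measurable_vecI) (simp add: hyper_proj_def)

text \<open>\<open>F\<close> vanishes at \<open>z\<close> and on \<open>S\<close>, so its linear
  part is small, relative to the length, on differences \<open>x - z\<close> with \<open>x\<close>
  in \<open>S\<close>. Rescaling carries this over to limit directions. It serves as the upper bound
  for approximate tangent cones.\<close>

lemma tangent_cone_level_set:
  assumes F: "(F has_derivative (\<lambda>h. n \<bullet> h)) (at z)" and z: "F z = 0" and S: "\<And>x. x \<in> S \<Longrightarrow> F x = (0::real)"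
  shows "tangent_cone S z \<subseteq> hyperplane n"
proof
  fix v assume v: "v \<in> tangent_cone S z"
  have le: "\<bar>n \<bullet> v\<bar> \<le> e * (norm v + 1 + norm n)" if e: "0 < e" "e < 1" for e
  proof -
    obtain d where d: "d > 0" "\<And>x. norm (x - z) < d \<Longrightarrow> norm (F x - F z - n \<bullet> (x - z)) \<le> e * norm (x - z)"
      using F e(1) unfolding has_derivative_at_alt by blast
    obtain x s where x: "x \<in> S" "s > 0" "norm (x - z) < min d e" "norm (s *\<^sub>R (x - z) - v) < min d e"
      using v d e unfolding tangent_cone_def by (auto dest!: spec[of _ "min d e"])
    have "\<bar>n \<bullet> (x - z)\<bar> \<le> e * norm (x - z)" using d(2)[of x] x S[of x] z by simp
    then have "s * \<bar>n \<bullet> (x - z)\<bar> \<le> s * (e * norm (x - z))" using x by (intro mult_left_mono) auto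
    then have 1: "\<bar>n \<bullet> (s *\<^sub>R (x - z))\<bar> \<le> e * norm (s *\<^sub>R (x - z))" using x by (simp add: abs_mult ac_simps)
    have "norm (s *\<^sub>R (x - z)) \<le> norm v + 1"
      using norm_triangle_ineq2[of "s *\<^sub>R (x - z)" v] x e by linarith
    then have 2: "e * norm (s *\<^sub>R (x - z)) \<le> e * (norm v + 1)" using e by (intro mult_left_mono) auto
    have "\<bar>n \<bullet> (s *\<^sub>R (x - z) - v)\<bar> \<le> norm n * norm (s *\<^sub>R (x - z) - v)" by (rule Cauchy_Schwarz_ineq2)
    also have "\<dots> \<le> norm n * e" using x by (intro mult_left_mono) auto
    finally have 3: "\<bar>n \<bullet> (s *\<^sub>R (x - z)) - n \<bullet> v\<bar> \<le> norm n * e" by (simp add: inner_diff_right)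
    show ?thesis using 1 2 3 by (simp add: algebra_simps)
  qed
  have "\<bar>n \<bullet> v\<bar> \<le> 0"
  proof (rule field_le_epsilon)
    fix \<epsilon> :: real assume \<epsilon>: "0 < \<epsilon>"
    define c where "c = norm v + 1 + norm n"
    have c: "1 \<le> c" by (simp add: c_def)
    have "\<bar>n \<bullet> v\<bar> \<le> min (1/2) (\<epsilon> / c) * c"
      unfolding c_def by (rule le) (use \<epsilon> c in \<open>auto simp: c_def[symmetric]\<close>)
    also have "\<dots> \<le> \<epsilon> / c * c" using c by (intro mult_right_mono) auto
    also have "\<dots> = \<epsilon>" using c by simp
    finally show "\<bar>n \<bullet> v\<bar> \<le> 0 + \<epsilon>" by simp
  qed
  then show "v \<in> hyperplane n" by (simp add: hyperplane_def)
qed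

text \<open>The lower bound. If \<open>v\<close> is no tangent vector of \<open>S\<close> at
  \<open>z\<close>, then the sets \<open>Y\<close> near \<open>z + r *\<^sub>R v\<close> lie outside
  \<open>S\<close> for small \<open>r\<close>, and their mass keeps the complement of
  \<open>S\<close> from having density zero.\<close>

lemma approx_tangent_coneI:
  fixes \<mu> :: "(real^'n) measure"
  assumes \<mu>: "sets \<mu> = sets borel"
    and Y: "\<And>e. 0 < e \<Longrightarrow> \<exists>c>0. \<exists>R>0. \<forall>r. 0 < r \<and> r < R \<longrightarrow>
      (\<exists>Y\<in>sets borel. (\<forall>y\<in>Y. norm (y - z - r *\<^sub>R v) < e * r) \<and> ennreal (c * r ^ m) \<le> emeasure \<mu> Y)"
  shows "v \<in> approx_tangent_cone m \<mu> z"
  unfolding approx_tangent_cone_def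
proof (rule InterI, clarify, rule ccontr)
  fix S assume dens: "has_density m (\<lambda>A. outer_measure_of \<mu> (A \<inter> (UNIV - S))) z 0" and v: "v \<notin> tangent_cone S z"
  obtain e where e: "0 < e" "\<And>x s. x \<in> S \<Longrightarrow> 0 < s \<Longrightarrow> norm (x - z) < e \<Longrightarrow> \<not> norm (s *\<^sub>R (x - z) - v) < e"
    using v unfolding tangent_cone_def by blast
  obtain c R where cR: "0 < c" "0 < R" "\<And>r. 0 < r \<Longrightarrow> r < R \<Longrightarrow>
      \<exists>Y\<in>sets borel. (\<forall>y\<in>Y. norm (y - z - r *\<^sub>R v) < e * r) \<and> ennreal (c * r ^ m) \<le> emeasure \<mu> Y"
    using Y[OF e(1)] by blast
  \<comment> \<open>The ball of radius \<open>a * r\<close> about \<open>z\<close> contains every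
    point within \<open>e * r\<close> of \<open>z + r *\<^sub>R v\<close>.\<close>
  define a where "a = norm v + e"
  have a: "0 < a" using e by (simp add: a_def add_nonneg_pos)
  define \<alpha> where "\<alpha> = unit_ball_vol (real m)"
  have \<alpha>: "0 < \<alpha>" by (simp add: \<alpha>_def)
  let ?\<phi> = "\<lambda>\<rho>. outer_measure_of \<mu> (cball z \<rho> \<inter> (UNIV - S)) / ennreal (\<alpha> * \<rho> ^ m)"
  have ge: "ennreal (c / (\<alpha> * a ^ m)) \<le> ?\<phi> \<rho>" if \<rho>: "0 < \<rho>" "\<rho> < min e (a * R)" for \<rho>
  proof -
    define r where "r = \<rho> / a"
    have r: "0 < r" "r < R" "a * r = \<rho>" using \<rho> a by (auto simp: r_def field_simps)
    obtain Y where Y: "Y \<in> sets borel" "\<And>y. y \<in> Y \<Longrightarrow> norm (y - z - r *\<^sub>R v) < e * r"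
      "ennreal (c * r ^ m) \<le> emeasure \<mu> Y" using cR(3)[OF r(1,2)] by blast
    have "y \<in> cball z \<rho> \<inter> (UNIV - S)" if "y \<in> Y" for y
    proof -
      have n: "norm (y - z) \<le> norm (y - z - r *\<^sub>R v) + norm (r *\<^sub>R v)" using norm_triangle_sub by (metis add.commute)
      also have "\<dots> < e * r + norm v * r" using Y(2)[OF that] r by simp
      also have "\<dots> = \<rho>" using r(3) by (simp add: a_def algebra_simps)
      finally have yz: "norm (y - z) < \<rho>" .
      have "(1 / r) *\<^sub>R (y - z) - v = (1 / r) *\<^sub>R (y - z - r *\<^sub>R v)" using r by (simp add: scaleR_diff_right)
      then have "norm ((1 / r) *\<^sub>R (y - z) - v) = norm (y - z - r *\<^sub>R v) / r" using r by simp
      also have "\<dots> < e" using Y(2)[OF that] r by (simp add: pos_divide_less_eq)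
      finally have "y \<notin> S" using e(2)[of y "1 / r"] r yz \<rho> by auto
      then show ?thesis using yz by (auto simp: dist_norm norm_minus_commute)
    qed
    then have "outer_measure_of \<mu> Y \<le> outer_measure_of \<mu> (cball z \<rho> \<inter> (UNIV - S))"
      by (intro outer_measure_of_mono) auto
    then have "ennreal (c * r ^ m) \<le> outer_measure_of \<mu> (cball z \<rho> \<inter> (UNIV - S))"
      using Y(1,3) \<mu> by simp
    then have "ennreal (c * r ^ m) / ennreal (\<alpha> * \<rho> ^ m) \<le> ?\<phi> \<rho>" by (rule divide_right_mono_ennreal)
    also have "ennreal (c * r ^ m) / ennreal (\<alpha> * \<rho> ^ m) = ennreal (c * r ^ m / (\<alpha> * \<rho> ^ m))"
      using cR r \<alpha> \<rho> by (intro divide_ennreal) auto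
    also have "c * r ^ m / (\<alpha> * \<rho> ^ m) = c / (\<alpha> * a ^ m)"
      using r a by (simp add: r(3)[symmetric] power_mult_distrib)
    finally show ?thesis .
  qed
  have "(?\<phi> \<longlongrightarrow> 0) (at_right 0)" using dens by (simp add: has_density_def \<alpha>_def)
  then have "\<forall>\<^sub>F \<rho> in at_right 0. ?\<phi> \<rho> < ennreal (c / (\<alpha> * a ^ m))"
    using cR a \<alpha> by (intro order_tendstoD) auto
  moreover have "\<forall>\<^sub>F \<rho> in at_right 0. 0 < \<rho> \<and> \<rho> < min e (a * R)"
    unfolding eventually_at_right_field using e a cR by (intro exI[of _ "min e (a * R)"]) auto
  ultimately have "\<forall>\<^sub>F \<rho> :: real in at_right 0. False"
    by eventually_elim (use ge in \<open>auto simp: leD\<close>)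
  then show False by simp
qed

section \<open>Varifolds given by a unit density and a normal field\<close>

lemma hom_inner_sum: "hom_inner f g = (\<Sum>i\<in>UNIV. \<Sum>j\<in>UNIV. f $ i $ j * g $ i $ j)"
  unfolding hom_inner_def trace_def matrix_matrix_mult_def transpose_def
  by (simp, rule sum.swap)

lemma hom_norm_square: "(hom_norm f)\<^sup>2 = (\<Sum>i\<in>UNIV. \<Sum>j\<in>UNIV. (f $ i $ j)\<^sup>2)"
proof -
  have "0 \<le> hom_inner f f" unfolding hom_inner_sum by (intro sum_nonneg) simp
  then show ?thesis by (simp add: hom_norm_def hom_inner_sum power2_eq_square)
qed

text \<open>For a conformal chart, with \<open>s\<close> the square of the conformal factor and
  \<open>a\<close>, \<open>b\<close> the partial derivatives, this turns the integrand of the first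
  variation into derivatives along the two coordinates.\<close>

lemma hom_inner_hyper_proj:
  assumes "\<And>i j. s * hyper_proj n $ i $ j = a $ i * a $ j + b $ i * b $ j"
  shows "s * hom_inner (hyper_proj n) J = a \<bullet> (J *v a) + b \<bullet> (J *v b)"
proof -
  have "s * hom_inner (hyper_proj n) J = (\<Sum>i\<in>UNIV. \<Sum>j\<in>UNIV. (s * hyper_proj n $ i $ j) * J $ i $ j)"
    by (simp add: hom_inner_sum sum_distrib_left mult.assoc)
  also have "\<dots> = (\<Sum>i\<in>UNIV. \<Sum>j\<in>UNIV. a $ i * (J $ i $ j * a $ j) + b $ i * (J $ i $ j * b $ j))"
    unfolding assms by (simp add: algebra_simps)
  also have "\<dots> = a \<bullet> (J *v a) + b \<bullet> (J *v b)"
    by (simp add: inner_vec_def matrix_vector_mult_def sum_distrib_left sum.distrib)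
  finally show ?thesis .
qed

lemma abs_hyper_proj_le: "\<bar>hyper_proj n $ i $ j\<bar> \<le> 2"
proof -
  have "\<bar>n $ i * n $ j\<bar> \<le> norm n * norm n"
    unfolding abs_mult using component_le_norm_cart[of n] by (intro mult_mono) auto
  then have "\<bar>n $ i * n $ j / (n \<bullet> n)\<bar> \<le> 1"
    by (auto simp: divide_le_eq_1 power2_eq_square[symmetric] power2_norm_eq_inner)
  moreover have "hyper_proj n $ i $ j = (if i = j then 1 else 0) - n $ i * n $ j / (n \<bullet> n)"
    by (simp add: hyper_proj_def)
  ultimately obtain x where "\<bar>x\<bar> \<le> 1" "hyper_proj n $ i $ j = (if i = j then 1 else 0) - x" by blast
  then show ?thesis by (cases "i = j") auto
qed

lemma measurable_matrix_nth [measurable (raw)]: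
  fixes f :: "'x \<Rightarrow> real^'m^'k"
  assumes "f \<in> borel_measurable M" shows "(\<lambda>x. f x $ i $ j) \<in> borel_measurable M"
  by (rule measurable_compose[OF assms])
     (intro borel_measurable_continuous_onI continuous_on_component continuous_on_id)

lemma borel_measurable_fst_snd:
  "(fst :: 'a::euclidean_space \<times> 'b::euclidean_space \<Rightarrow> 'a) \<in> borel_measurable borel"
  "(snd :: 'a::euclidean_space \<times> 'b::euclidean_space \<Rightarrow> 'b) \<in> borel_measurable borel"
  by (intro borel_measurable_continuous_onI continuous_intros)+

lemma jacobian_nth: "jacobian \<theta> (at z) $ i $ j = frechet_derivative \<theta> (at z) (axis j 1) $ i"
  by (simp add: jacobian_def matrix_def)

lemma test_field_deriv:
  assumes "\<theta> \<in> test_fields"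
  shows "(\<theta> has_derivative (\<lambda>h. jacobian \<theta> (at z) *v h)) (at z)"
    "continuous_on UNIV (\<lambda>z. jacobian \<theta> (at z))"
proof -
  have "times_cont_diff 1 \<theta>" using assms by (simp add: test_fields_def)
  then have d: "\<theta> differentiable (at z)" and c: "continuous_on UNIV (\<lambda>x. frechet_derivative \<theta> (at x) v)" for z v
    by simp_all
  show "(\<theta> has_derivative (\<lambda>h. jacobian \<theta> (at z) *v h)) (at z)" using d by (simp add: jacobian_works)
  show "continuous_on UNIV (\<lambda>z. jacobian \<theta> (at z))"
    unfolding jacobian_def matrix_def by (intro continuous_on_vec_lambda continuous_on_component c)
qed

lemma test_field_jacobian_bounded:
  assumes "\<theta> \<in> test_fields"
  shows "\<exists>B. \<forall>z i j. \<bar>jacobian \<theta> (at z) $ i $ j\<bar> \<le> B"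
proof -
  have K: "compact (field_support \<theta>)" using assms by (simp add: test_fields_def)
  then have "compact ((\<lambda>z. jacobian \<theta> (at z)) ` field_support \<theta>)"
    by (intro compact_continuous_image continuous_on_subset[OF test_field_deriv(2)[OF assms]]) auto
  then obtain B where B: "\<And>z. z \<in> field_support \<theta> \<Longrightarrow> norm (jacobian \<theta> (at z)) \<le> B"
    by (meson bounded_iff compact_imp_bounded imageI)
  have "\<bar>jacobian \<theta> (at z) $ i $ j\<bar> \<le> max B 0" for z i j
  proof (cases "z \<in> field_support \<theta>")
    case True
    have "\<bar>jacobian \<theta> (at z) $ i $ j\<bar> \<le> norm (jacobian \<theta> (at z) $ i)" by (rule component_le_norm_cart)
    also have "\<dots> \<le> norm (jacobian \<theta> (at z))" by (rule Finite_Cartesian_Product.norm_nth_le)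
    finally show ?thesis using B[OF True] by linarith
  next
    case False
    have "(\<theta> has_derivative (\<lambda>h. 0)) (at z)"
      by (rule has_derivative_transform_within_open[where f="\<lambda>_. 0" and s="- field_support \<theta>"])
         (use False closed_field_support[of \<theta>] in_field_support[of \<theta>] in \<open>auto simp: open_Compl\<close>)
    then have "frechet_derivative \<theta> (at z) = (\<lambda>h. 0)" by (rule frechet_derivative_at[symmetric])
    then show ?thesis by (simp add: jacobian_nth)
  qed
  then show ?thesis by blast
qed

lemma jacobian_add:
  assumes "\<theta> \<in> test_fields" "\<eta> \<in> test_fields"
  shows "jacobian (\<lambda>x. \<theta> x + \<eta> x) (at z) = jacobian \<theta> (at z) + jacobian \<eta> (at z)"
proof -
  have "((\<lambda>x. \<theta> x + \<eta> x) has_derivative (\<lambda>h. jacobian \<theta> (at z) *v h + jacobian \<eta> (at z) *v h)) (at z)"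
    by (intro has_derivative_add test_field_deriv assms)
  then have "frechet_derivative (\<lambda>x. \<theta> x + \<eta> x) (at z) = (\<lambda>h. jacobian \<theta> (at z) *v h + jacobian \<eta> (at z) *v h)"
    by (rule frechet_derivative_at[symmetric])
  then show ?thesis
    by (simp add: vec_eq_iff jacobian_nth[of "\<lambda>x. \<theta> x + \<eta> x"] matrix_vector_mult_basis column_def)
qed

abbreviation position_plane_topology :: "((real^3) \<times> (real^3) set) topology" where
  "position_plane_topology \<equiv> prod_topology euclidean (grassmann_topology 2)"

lemma topspace_position_plane: "topspace position_plane_topology = UNIV \<times> grassmannian 2"
  by (auto simp: grassmann_topology_def topspace_pullback_topology)

lemma sets_borel_of: "sets (borel_of X) = sigma_sets (topspace X) {G. openin X G}"
  and space_borel_of: "space (borel_of X) = topspace X"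
  unfolding borel_of_def by (rule sets_measure_of space_measure_of; use openin_subset in auto)+

text \<open>The topology on pairs of a point and a plane is pulled back from a Euclidean space by
  replacing the plane with its projection; measurability of maps into it can therefore be checked on
  matrices.\<close>

lemma openin_position_plane:
  assumes "openin position_plane_topology G"
  shows "\<exists>W. open W \<and> G = {p. snd p \<in> grassmannian 2 \<and> (fst p, orth_proj (snd p)) \<in> W}"
proof -
  define W where "W = \<Union>{A \<times> B | A B. open A \<and> open B \<and> A \<times> (orth_proj -` B \<inter> grassmannian 2) \<subseteq> G}"
  have "open W" unfolding W_def by (intro open_Union) (auto intro: open_Times)
  moreover have "G = {p. snd p \<in> grassmannian 2 \<and> (fst p, orth_proj (snd p)) \<in> W}"
  proof (intro set_eqI iffI)
    fix p assume p: "p \<in> G"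
    obtain A B' where AB: "open A" "openin (grassmann_topology 2) B'" "fst p \<in> A" "snd p \<in> B'" "A \<times> B' \<subseteq> G"
      using assms p unfolding openin_prod_topology_alt by (metis open_openin prod.collapse)
    obtain B where B: "open B" "B' = orth_proj -` B \<inter> grassmannian 2"
      using AB(2) unfolding grassmann_topology_def openin_pullback_topology by auto
    have "A \<times> B \<subseteq> W" unfolding W_def using AB B by (intro Union_upper) blast
    then show "p \<in> {p. snd p \<in> grassmannian 2 \<and> (fst p, orth_proj (snd p)) \<in> W}"
      using AB(3,4) B(2) by auto
  next
    fix p assume "p \<in> {p. snd p \<in> grassmannian 2 \<and> (fst p, orth_proj (snd p)) \<in> W}"
    then show "p \<in> G" unfolding W_def by (cases p) auto
  qed
  ultimately show ?thesis by blast
qed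

lemma measurable_position_proj:
  "(\<lambda>p. (fst p, orth_proj (snd p))) \<in> borel_measurable (borel_of position_plane_topology)"
proof (rule borel_measurableI)
  fix W :: "((real^3) \<times> (real^3^3)) set" assume W: "open W"
  let ?P = "(\<lambda>p. (fst p, orth_proj (snd p))) -` W \<inter> (UNIV \<times> grassmannian 2)"
  have "openin position_plane_topology ?P"
    unfolding openin_prod_topology_alt
  proof (intro allI impI)
    fix x S assume xS: "(x, S) \<in> ?P"
    then obtain A B where AB: "open A" "open B" "x \<in> A" "orth_proj S \<in> B" "A \<times> B \<subseteq> W"
      using W unfolding open_prod_def by fastforce
    have "openin (grassmann_topology 2) (orth_proj -` B \<inter> grassmannian 2)"
      unfolding grassmann_topology_def openin_pullback_topology using AB(2) by auto
    then show "\<exists>U V. openin euclidean U \<and> openin (grassmann_topology 2) V \<and> x \<in> U \<and> S \<in> V \<and> U \<times> V \<subseteq> ?P"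
      using AB xS by (intro exI[of _ A] exI[of _ "orth_proj -` B \<inter> grassmannian 2"]) auto
  qed
  then show "(\<lambda>p. (fst p, orth_proj (snd p))) -` W \<inter> space (borel_of position_plane_topology)
      \<in> sets (borel_of position_plane_topology)"
    unfolding space_borel_of topspace_position_plane sets_borel_of by (intro sigma_sets.Basic) simp
qed

text \<open>Planes are given by a nowhere vanishing normal field of arbitrary length, which reduces
  questions on the Grassmannian to the measurability of a vector field on space.\<close>

locale normal_field =
  fixes \<mu> :: "(real^3) measure" and n :: "real^3 \<Rightarrow> real^3"
  assumes sets_\<mu>: "sets \<mu> = sets borel" and finite_\<mu>: "finite_measure \<mu>"
    and n_meas [measurable]: "n \<in> borel_measurable borel" and n_nz: "\<And>z. n z \<noteq> 0"
begin

sublocale finite_measure \<mu> by (rule finite_\<mu>)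

declare sets_\<mu> [measurable_cong]

lemma space_\<mu> [simp]: "space \<mu> = UNIV"
  using sets_eq_imp_space_eq[OF sets_\<mu>] by simp

definition lift :: "real^3 \<Rightarrow> (real^3) \<times> (real^3) set" where "lift z = (z, hyperplane (n z))"

definition V :: "((real^3) \<times> (real^3) set) measure" where
  "V = distr \<mu> (borel_of position_plane_topology) lift"

lemma hyperplane_in: "hyperplane (n z) \<in> grassmannian 2"
  using hyperplane_grassmannian[OF n_nz[of z]] by simp

lemma lift_meas [measurable]: "lift \<in> measurable \<mu> (borel_of position_plane_topology)"
  unfolding borel_of_def
proof (rule measurable_measure_of)
  show "lift \<in> space \<mu> \<rightarrow> topspace position_plane_topology"
    unfolding topspace_position_plane by (auto simp: lift_def hyperplane_in)
  fix G assume "G \<in> {G. openin position_plane_topology G}"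
  then obtain W where W: "open W" "G = {p. snd p \<in> grassmannian 2 \<and> (fst p, orth_proj (snd p)) \<in> W}"
    using openin_position_plane by blast
  have "lift -` G \<inter> space \<mu> = (\<lambda>z. (z, hyper_proj (n z))) -` W \<inter> space \<mu>"
    by (auto simp: W(2) lift_def hyperplane_in orth_proj_hyperplane[OF n_nz])
  also have "\<dots> \<in> sets \<mu>"
  proof (rule measurable_sets[of _ _ borel])
    show "(\<lambda>z. (z, hyper_proj (n z))) \<in> borel_measurable \<mu>" by (intro borel_measurable_Pair) measurable
  qed (use W(1) in auto)
  finally show "lift -` G \<inter> space \<mu> \<in> sets \<mu>" .
qed (use openin_subset in blast)

lemma weight_V: "weight V = \<mu>"
proof -
  have f: "fst \<in> measurable (borel_of position_plane_topology) borel"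
    using measurable_compose[OF measurable_position_proj, of fst borel] by (simp add: borel_prod[symmetric])
  have "weight V = distr \<mu> borel (\<lambda>z. z)"
    unfolding weight_def V_def by (subst distr_distr[OF f lift_meas]) (simp add: comp_def lift_def)
  also have "\<dots> = \<mu>" by (rule distr_id2) (simp add: sets_\<mu>)
  finally show ?thesis .
qed

lemma varifold_V: "varifold 2 V"
proof -
  have "emeasure V K \<le> emeasure \<mu> UNIV" for K
  proof (cases "K \<in> sets V")
    case True
    then show ?thesis unfolding V_def by (subst emeasure_distr[OF lift_meas]) (auto intro!: emeasure_mono simp: V_def sets_\<mu>)
  qed (simp add: emeasure_notin_sets)
  then have "emeasure V K < \<infinity>" for K
    by (rule le_less_trans) (use emeasure_finite[of UNIV] in \<open>unfold infinity_ennreal_def less_top\<close>)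
  then show ?thesis by (simp add: varifold_def radon_measure_def V_def)
qed

text \<open>The set of exceptional pairs is not known to be measurable. It is enclosed in the
  preimage of a Borel set \<open>W\<close> of points and matrices: the point lies in a null set
  \<open>N\<close>, or the matrix is not the projection prescribed by \<open>n\<close>. The
  enclosure rests on the injectivity of \<open>orth_proj\<close>.\<close>

lemma AE_tangent:
  assumes "AE z in \<mu>. approx_tangent_cone 2 \<mu> z = hyperplane (n z)"
  shows "AE p in V. snd p = approx_tangent_cone 2 (weight V) (fst p)"
proof -
  obtain N where N: "N \<in> null_sets \<mu>" "{z \<in> space \<mu>. approx_tangent_cone 2 \<mu> z \<noteq> hyperplane (n z)} \<subseteq> N"
    using assms unfolding eventually_ae_filter by blast
  then have [measurable]: "N \<in> sets borel" using sets_\<mu> by (auto simp: null_sets_def)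
  let ?q = "\<lambda>p. (fst p, orth_proj (snd p)) :: (real^3) \<times> (real^3^3)"
  define W where "W = {w :: (real^3) \<times> (real^3^3). fst w \<in> N \<or> snd w \<noteq> hyper_proj (n (fst w))}"
  note [measurable] = borel_measurable_fst_snd
  have "W = fst -` N \<union> (\<lambda>w. snd w - hyper_proj (n (fst w))) -` (- {0})" by (auto simp: W_def)
  moreover have "fst -` N \<in> sets (borel :: ((real^3) \<times> (real^3^3)) measure)"
    using measurable_sets[OF borel_measurable_fst_snd(1), of N] by simp
  moreover have "(\<lambda>w :: (real^3) \<times> (real^3^3). snd w - hyper_proj (n (fst w))) \<in> borel_measurable borel" by measurable
  then have "(\<lambda>w. snd w - hyper_proj (n (fst w))) -` (- {0}) \<in> sets (borel :: ((real^3) \<times> (real^3^3)) measure)"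
    using measurable_sets[of _ borel borel "- {0}"] by fastforce
  ultimately have W: "W \<in> sets borel" by simp
  let ?B = "?q -` W \<inter> space (borel_of position_plane_topology)"
  have B: "?B \<in> sets (borel_of position_plane_topology)" by (rule measurable_sets[OF measurable_position_proj W])
  have "emeasure V ?B = emeasure \<mu> (lift -` ?B \<inter> space \<mu>)" unfolding V_def by (rule emeasure_distr[OF lift_meas B])
  also have "lift -` ?B \<inter> space \<mu> \<subseteq> N"
    by (auto simp: lift_def W_def orth_proj_hyperplane[OF n_nz])
  then have "emeasure \<mu> (lift -` ?B \<inter> space \<mu>) \<le> emeasure \<mu> N" using N by (intro emeasure_mono) auto
  also have "emeasure \<mu> N = 0" using N by auto
  finally have "?B \<in> null_sets V" using B by (auto simp: V_def)
  then show ?thesis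
  proof (rule AE_I')
    show "{p \<in> space V. snd p \<noteq> approx_tangent_cone 2 (weight V) (fst p)} \<subseteq> ?B"
    proof
      fix p assume p: "p \<in> {p \<in> space V. snd p \<noteq> approx_tangent_cone 2 (weight V) (fst p)}"
      then have s: "p \<in> space (borel_of position_plane_topology)" by (simp add: V_def)
      have "?q p \<in> W"
      proof (rule ccontr)
        assume "?q p \<notin> W"
        then have *: "fst p \<notin> N" "orth_proj (snd p) = orth_proj (hyperplane (n (fst p)))"
          by (auto simp: W_def orth_proj_hyperplane[OF n_nz])
        have "subspace (snd p)" using s unfolding space_borel_of topspace_position_plane by (auto simp: grassmannian_def)
        then have "snd p = hyperplane (n (fst p))" using *(2) by (intro orth_proj_inj subspace_hyperplane)
        then show False using * p N(2) by (auto simp: weight_V)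
      qed
      then show "p \<in> ?B" using s by simp
    qed
  qed
qed

lemma first_variation_integrable:
  assumes "\<theta> \<in> test_fields"
  shows "integrable \<mu> (\<lambda>z. hom_inner (hyper_proj (n z)) (jacobian \<theta> (at z)))"
    "(\<lambda>z. hom_inner (hyper_proj m) (jacobian \<theta> (at z))) \<in> borel_measurable borel"
    "(\<lambda>z. hom_inner (hyper_proj (n z)) (jacobian \<theta> (at z))) \<in> borel_measurable borel"
proof -
  have [measurable]: "(\<lambda>z. jacobian \<theta> (at z)) \<in> borel_measurable borel"
    by (intro borel_measurable_continuous_onI test_field_deriv assms)
  have h: "(\<lambda>z. hyper_proj (n z)) \<in> borel_measurable borel" by measurable
  show m: "(\<lambda>z. hom_inner (hyper_proj (n z)) (jacobian \<theta> (at z))) \<in> borel_measurable borel"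
    unfolding hom_inner_sum by (intro borel_measurable_sum borel_measurable_times measurable_matrix_nth h) measurable
  show "(\<lambda>z. hom_inner (hyper_proj m) (jacobian \<theta> (at z))) \<in> borel_measurable borel"
    unfolding hom_inner_sum by (intro borel_measurable_sum borel_measurable_times measurable_matrix_nth) measurable
  obtain B where B: "\<And>z i j. \<bar>jacobian \<theta> (at z) $ i $ j\<bar> \<le> B" using test_field_jacobian_bounded[OF assms] by blast
  have bd: "norm (hom_inner (hyper_proj (n z)) (jacobian \<theta> (at z))) \<le> (\<Sum>i\<in>(UNIV :: 3 set). \<Sum>j\<in>(UNIV :: 3 set). 2 * B)" for z
    unfolding hom_inner_sum real_norm_def
    by (intro order_trans[OF sum_abs] sum_mono) (auto simp: abs_mult intro!: mult_mono abs_hyper_proj_le B)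
  show "integrable \<mu> (\<lambda>z. hom_inner (hyper_proj (n z)) (jacobian \<theta> (at z)))"
    by (rule integrable_const_bound[OF AE_I2[OF bd]]) (use m in measurable)
qed

lemma first_variation_V:
  assumes "\<theta> \<in> test_fields"
  shows "first_variation V \<theta> = (\<integral>z. hom_inner (hyper_proj (n z)) (jacobian \<theta> (at z)) \<partial>\<mu>)"
proof -
  let ?g = "\<lambda>w :: (real^3) \<times> (real^3^3). hom_inner (snd w) (jacobian \<theta> (at (fst w)))"
  have [measurable]: "(\<lambda>z. jacobian \<theta> (at z)) \<in> borel_measurable borel"
    by (intro borel_measurable_continuous_onI test_field_deriv assms)
  have g: "?g \<in> borel_measurable borel"
    unfolding hom_inner_sum
    by (intro borel_measurable_sum borel_measurable_times measurable_matrix_nth borel_measurable_fst_snd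
        measurable_compose[OF borel_measurable_fst_snd(1), of "\<lambda>z. jacobian \<theta> (at z)"]) measurable
  have m: "(\<lambda>p. hom_inner (orth_proj (snd p)) (jacobian \<theta> (at (fst p)))) \<in> borel_measurable (borel_of position_plane_topology)"
    using measurable_compose[OF measurable_position_proj g] by simp
  show ?thesis
    unfolding first_variation_def V_def
    by (subst integral_distr[OF lift_meas m]) (simp add: lift_def orth_proj_hyperplane[OF n_nz])
qed

lemma first_variation_add:
  assumes "\<theta> \<in> test_fields" "\<eta> \<in> test_fields"
  shows "first_variation V (\<lambda>x. \<theta> x + \<eta> x) = first_variation V \<theta> + first_variation V \<eta>"
proof -
  have *: "hom_inner f (g + h) = hom_inner f g + hom_inner f h" for f g h :: "real^3^3"
    by (simp add: hom_inner_sum distrib_left sum.distrib)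
  show ?thesis
    by (simp add: first_variation_V test_fields_add assms jacobian_add * first_variation_integrable)
qed

end

section \<open>Harmonic conformal strips and surfaces of revolution\<close>

lemma integral_Ioo_FTC:
  fixes F f :: "real \<Rightarrow> real"
  assumes "a \<le> b" "\<And>x. (F has_real_derivative f x) (at x)" "continuous_on UNIV f"
  shows "(LINT x:{a<..<b}|lborel. f x) = F b - F a"
proof -
  have "(LINT x:{a<..<b}|lborel. f x) = (LINT x:{a..b}|lborel. f x)"
    using interval_integral_Ioo[of "ereal a" "ereal b" f] interval_integral_Icc[OF assms(1), of f] assms(1) by simp
  also have "\<dots> = (\<integral>x. f x * indicator {a..b} x \<partial>lborel)"
    by (simp add: set_lebesgue_integral_def mult.commute)
  also have "\<dots> = F b - F a"
    using assms by (intro integral_FTC_Icc_real) (auto simp: continuous_on_eq_continuous_at)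
  finally show ?thesis .
qed

lemma set_integrable_strip:
  fixes A :: "real \<times> real \<Rightarrow> real"
  assumes A: "continuous_on UNIV A"
  shows "set_integrable lborel ({s0<..<s1} \<times> {t0<..<t1}) A"
proof -
  have "set_integrable lborel ({s0..s1} \<times> {t0..t1}) A" unfolding set_integrable_def
    by (rule borel_integrable_compact) (auto intro: compact_Times continuous_on_subset[OF A])
  then show ?thesis
    by (rule set_integrable_subset) (auto intro!: borel_open open_Times)
qed

lemma integral_strip_s:
  fixes A :: "real \<times> real \<Rightarrow> real"
  assumes "s0 \<le> s1" and h: "\<And>s t. ((\<lambda>s. h (s, t)) has_real_derivative A (s, t)) (at s)"
    and A: "continuous_on UNIV A"
  shows "(LINT p:{s0<..<s1} \<times> {t0<..<t1}|lborel. A p) = (LINT t:{t0<..<t1}|lborel. h (s1, t) - h (s0, t))"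
proof -
  let ?U = "{s0<..<s1} \<times> {t0<..<t1}"
  have ind: "indicator ?U (s, t) *\<^sub>R A (s, t) = indicator {t0<..<t1} t * (indicator {s0<..<s1} s *\<^sub>R A (s, t))" for s t
    by (simp add: indicator_times ac_simps)
  have c: "continuous_on UNIV (\<lambda>s. A (s, t))" for t
    by (intro continuous_on_compose2[OF A] continuous_intros) auto
  have "(LINT p:?U|lborel. A p) = (\<integral>p. (\<lambda>(s, t). indicator ?U (s, t) *\<^sub>R A (s, t)) p \<partial>(lborel \<Otimes>\<^sub>M lborel))"
    unfolding set_lebesgue_integral_def lborel_prod by (simp add: split_beta)
  also have "\<dots> = (\<integral>t. (\<integral>s. indicator ?U (s, t) *\<^sub>R A (s, t) \<partial>lborel) \<partial>lborel)"
    using set_integrable_strip[OF A, of s0 s1 t0 t1]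
    by (intro lborel_pair.integral_snd[symmetric]) (simp add: set_integrable_def lborel_prod case_prod_unfold)
  also have "\<dots> = (LINT t:{t0<..<t1}|lborel. h (s1, t) - h (s0, t))"
    unfolding set_lebesgue_integral_def ind
    using integral_Ioo_FTC[OF assms(1) h c]
    by (intro Bochner_Integration.integral_cong) (simp_all add: set_lebesgue_integral_def)
  finally show ?thesis .
qed

lemma integral_strip_t:
  fixes A :: "real \<times> real \<Rightarrow> real"
  assumes "t0 \<le> t1" and h: "\<And>s t. ((\<lambda>t. h (s, t)) has_real_derivative A (s, t)) (at t)"
    and A: "continuous_on UNIV A"
  shows "(LINT p:{s0<..<s1} \<times> {t0<..<t1}|lborel. A p) = (LINT s:{s0<..<s1}|lborel. h (s, t1) - h (s, t0))"
proof -
  let ?U = "{s0<..<s1} \<times> {t0<..<t1}"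
  have ind: "indicator ?U (s, t) *\<^sub>R A (s, t) = indicator {s0<..<s1} s * (indicator {t0<..<t1} t *\<^sub>R A (s, t))" for s t
    by (simp add: indicator_times ac_simps)
  have c: "continuous_on UNIV (\<lambda>t. A (s, t))" for s
    by (intro continuous_on_compose2[OF A] continuous_intros) auto
  have "(LINT p:?U|lborel. A p) = (\<integral>p. (\<lambda>(s, t). indicator ?U (s, t) *\<^sub>R A (s, t)) p \<partial>(lborel \<Otimes>\<^sub>M lborel))"
    unfolding set_lebesgue_integral_def lborel_prod by (simp add: split_beta)
  also have "\<dots> = (\<integral>s. (\<integral>t. indicator ?U (s, t) *\<^sub>R A (s, t) \<partial>lborel) \<partial>lborel)"
    using set_integrable_strip[OF A, of s0 s1 t0 t1]
    by (intro lborel_pair.integral_fst[symmetric]) (simp add: set_integrable_def lborel_prod case_prod_unfold)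
  also have "\<dots> = (LINT s:{s0<..<s1}|lborel. h (s, t1) - h (s, t0))"
    unfolding set_lebesgue_integral_def ind
    using integral_Ioo_FTC[OF assms(1) h c]
    by (intro Bochner_Integration.integral_cong) (simp_all add: set_lebesgue_integral_def)
  finally show ?thesis .
qed

text \<open>Harmonicity is encoded by one function: \<open>\<phi>ss\<close> is the second derivative
  in \<open>s\<close>, and its negative the second derivative in \<open>t\<close>.\<close>

locale harmonic_strip = conformal_chart "{s0<..<s1} \<times> {t0<..<t1}" \<phi> \<phi>s \<phi>t \<sigma>
  for s0 s1 t0 t1 :: real and \<phi> \<phi>s \<phi>t :: "real \<times> real \<Rightarrow> real^3" and \<sigma> :: "real \<times> real \<Rightarrow> real" +
  fixes \<phi>ss :: "real \<times> real \<Rightarrow> real^3"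
  assumes s01: "s0 \<le> s1" and t01: "t0 \<le> t1"
    and deriv_ss: "((\<lambda>s. \<phi>s (s, t)) has_derivative (\<lambda>h. h *\<^sub>R \<phi>ss (s, t))) (at s)"
    and deriv_tt: "((\<lambda>t. \<phi>t (s, t)) has_derivative (\<lambda>h. h *\<^sub>R (- \<phi>ss (s, t)))) (at t)"
    and cont_ss: "continuous_on UNIV \<phi>ss"
begin

abbreviation "strip \<equiv> {s0<..<s1} \<times> {t0<..<t1}"

lemma first_variation_strip:
  assumes \<theta>: "\<theta> \<in> test_fields"
    and n[measurable]: "n \<in> borel_measurable borel"
    and proj: "\<And>p i j. p \<in> strip \<Longrightarrow>
      (\<sigma> p)\<^sup>2 * hyper_proj (n (\<phi> p)) $ i $ j = \<phi>s p $ i * \<phi>s p $ j + \<phi>t p $ i * \<phi>t p $ j"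
  shows "(LINT z:\<phi> ` strip|hausdorff_measure 2. hom_inner (hyper_proj (n z)) (jacobian \<theta> (at z))) =
    area_const * ((LINT t:{t0<..<t1}|lborel. \<phi>s (s1, t) \<bullet> \<theta> (\<phi> (s1, t)) - \<phi>s (s0, t) \<bullet> \<theta> (\<phi> (s0, t)))
      + (LINT s:{s0<..<s1}|lborel. \<phi>t (s, t1) \<bullet> \<theta> (\<phi> (s, t1)) - \<phi>t (s, t0) \<bullet> \<theta> (\<phi> (s, t0))))"
proof -
  let ?J = "\<lambda>z. jacobian \<theta> (at z)"
  note cJ = test_field_deriv(2)[OF \<theta>]
  have J_meas[measurable]: "?J \<in> borel_measurable borel" by (intro borel_measurable_continuous_onI cJ)
  have gm: "(\<lambda>z. hom_inner (hyper_proj (n z)) (?J z)) \<in> borel_measurable borel"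
    unfolding hom_inner_sum by (intro borel_measurable_sum borel_measurable_times measurable_matrix_nth) measurable
  have c\<theta>: "continuous_on UNIV \<theta>"
    using test_field_deriv(1)[OF \<theta>] has_derivative_continuous
    by (fastforce simp: continuous_on_eq_continuous_within)
  \<comment> \<open>The terms with \<open>\<phi>ss\<close> cancel in \<open>A + B\<close>. With them
    \<open>A\<close> is the \<open>s\<close>-derivative of the inner product of
    \<open>\<phi>s\<close> and \<open>\<theta>\<close>, and \<open>B\<close> is the
    \<open>t\<close>-derivative of that of \<open>\<phi>t\<close> and
    \<open>\<theta>\<close>.\<close>
  define A where "A p = \<phi>s p \<bullet> (?J (\<phi> p) *v \<phi>s p) + \<phi>ss p \<bullet> \<theta> (\<phi> p)" for p
  define B where "B p = \<phi>t p \<bullet> (?J (\<phi> p) *v \<phi>t p) - \<phi>ss p \<bullet> \<theta> (\<phi> p)" for p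
  have cm: "continuous_on UNIV (\<lambda>p. ?J (\<phi> p) *v f p)" if f: "continuous_on UNIV f" for f :: "real \<times> real \<Rightarrow> real^3"
    unfolding matrix_vector_mult_def
    by (intro continuous_on_vec_lambda continuous_intros f continuous_on_compose2[OF cJ cont_\<phi>]) auto
  have c\<theta>\<phi>: "continuous_on UNIV (\<lambda>p. \<theta> (\<phi> p))" by (rule continuous_on_compose2[OF c\<theta> cont_\<phi>]) auto
  have cA: "continuous_on UNIV A" and cB: "continuous_on UNIV B"
    unfolding A_def B_def by (intro continuous_intros cm cont cont_ss c\<theta>\<phi>)+
  have d\<phi>s: "((\<lambda>s. \<theta> (\<phi> (s, t))) has_derivative (\<lambda>h. ?J (\<phi> (s, t)) *v (h *\<^sub>R \<phi>s (s, t)))) (at s)" for s t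
  proof -
    have "((\<lambda>s. \<phi> (s, t)) has_derivative (\<lambda>h. fst (h, 0 :: real) *\<^sub>R \<phi>s (s, t) + snd (h, 0 :: real) *\<^sub>R \<phi>t (s, t))) (at s)"
      by (rule has_derivative_compose[OF _ deriv, of "\<lambda>s. (s, t)" "\<lambda>h. (h, 0)"]) (auto intro!: derivative_eq_intros)
    then have "((\<lambda>s. \<phi> (s, t)) has_derivative (\<lambda>h. h *\<^sub>R \<phi>s (s, t))) (at s)" by simp
    from has_derivative_compose[OF this test_field_deriv(1)[OF \<theta>]] show ?thesis .
  qed
  have d\<phi>t: "((\<lambda>t. \<theta> (\<phi> (s, t))) has_derivative (\<lambda>h. ?J (\<phi> (s, t)) *v (h *\<^sub>R \<phi>t (s, t)))) (at t)" for s t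
  proof -
    have "((\<lambda>t. \<phi> (s, t)) has_derivative (\<lambda>h. fst (0 :: real, h) *\<^sub>R \<phi>s (s, t) + snd (0 :: real, h) *\<^sub>R \<phi>t (s, t))) (at t)"
      by (rule has_derivative_compose[OF _ deriv, of "\<lambda>t. (s, t)" "\<lambda>h. (0, h)"]) (auto intro!: derivative_eq_intros)
    then have "((\<lambda>t. \<phi> (s, t)) has_derivative (\<lambda>h. h *\<^sub>R \<phi>t (s, t))) (at t)" by simp
    from has_derivative_compose[OF this test_field_deriv(1)[OF \<theta>]] show ?thesis .
  qed
  have dA: "((\<lambda>s. \<phi>s (s, t) \<bullet> \<theta> (\<phi> (s, t))) has_real_derivative A (s, t)) (at s)" for s t
    unfolding has_field_derivative_def
    by (rule has_derivative_eq_rhs[OF has_derivative_inner[OF deriv_ss[of t s] d\<phi>s[of t s]]])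
       (auto simp: fun_eq_iff A_def matrix_vector_mult_scaleR algebra_simps)
  have dB: "((\<lambda>t. \<phi>t (s, t) \<bullet> \<theta> (\<phi> (s, t))) has_real_derivative B (s, t)) (at t)" for s t
    unfolding has_field_derivative_def
    by (rule has_derivative_eq_rhs[OF has_derivative_inner[OF deriv_tt[of s t] d\<phi>t[of s t]]])
       (auto simp: fun_eq_iff B_def matrix_vector_mult_scaleR algebra_simps)
  have "(LINT z:\<phi> ` strip|hausdorff_measure 2. hom_inner (hyper_proj (n z)) (?J z)) =
      area_const * (LINT p:strip|lborel. (\<sigma> p)\<^sup>2 * hom_inner (hyper_proj (n (\<phi> p))) (?J (\<phi> p)))"
    by (rule integral_image[OF gm])
  also have "(LINT p:strip|lborel. (\<sigma> p)\<^sup>2 * hom_inner (hyper_proj (n (\<phi> p))) (?J (\<phi> p))) = (LINT p:strip|lborel. A p + B p)"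
    by (rule set_lebesgue_integral_cong) (auto simp: hom_inner_hyper_proj[OF proj] A_def B_def)
  also have "\<dots> = (LINT p:strip|lborel. A p) + (LINT p:strip|lborel. B p)"
    by (intro set_integral_add set_integrable_strip cA cB)
  also have "(LINT p:strip|lborel. A p) = (LINT t:{t0<..<t1}|lborel. \<phi>s (s1, t) \<bullet> \<theta> (\<phi> (s1, t)) - \<phi>s (s0, t) \<bullet> \<theta> (\<phi> (s0, t)))"
    by (rule integral_strip_s[OF s01 dA cA])
  also have "(LINT p:strip|lborel. B p) = (LINT s:{s0<..<s1}|lborel. \<phi>t (s, t1) \<bullet> \<theta> (\<phi> (s, t1)) - \<phi>t (s, t0) \<bullet> \<theta> (\<phi> (s, t0)))"
    by (rule integral_strip_t[OF t01 dB cB])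
  finally show ?thesis .
qed

end

section \<open>Surfaces of revolution in conformal coordinates\<close>

lemma abs_integral_Ioo_le:
  fixes f :: "real \<Rightarrow> real"
  assumes "a \<le> b" "\<And>x. \<bar>f x\<bar> \<le> B"
  shows "\<bar>LINT x:{a<..<b}|lborel. f x\<bar> \<le> B * (b - a)"
proof (cases "set_integrable lborel {a<..<b} f")
  case True
  have "\<bar>LINT x:{a<..<b}|lborel. f x\<bar> \<le> (LINT x:{a<..<b}|lborel. \<bar>f x\<bar>)"
    using set_integral_norm_bound[OF True] by simp
  also have "\<dots> \<le> (LINT x:{a<..<b}|lborel. B)"
    using True assms by (intro set_integral_mono set_integrable_abs) (auto simp: set_integrable_def)
  also have "\<dots> = B * (b - a)" using assms by (simp add: set_lebesgue_integral_def)
  finally show ?thesis .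
next
  case False
  \<comment> \<open>The integral of a function that is not integrable is 0 by convention, so the
    bound holds as soon as \<open>B\<close> is nonnegative.\<close>
  have "0 \<le> B" using assms(2)[of 0] by linarith
  then show ?thesis using False assms by (simp add: set_lebesgue_integral_def set_integrable_def not_integrable_integral_eq)
qed

lemma inner_vec3: "x \<bullet> y = x $ 1 * y $ 1 + x $ 2 * y $ 2 + x $ 3 * y $ 3" for x y :: "real^3"
  by (simp add: inner_vec_def sum_3)

lemma circle_inj:
  assumes "0 < t" "t < 2 * pi" "0 < t'" "t' < 2 * pi" "cos t = cos t'" "sin t = sin t'"
  shows "t = t'"
proof -
  obtain m :: int where m: "t = t' + 2 * pi * m" using sin_cos_eq_iff[of t t'] assms by auto
  have "\<bar>2 * pi * real_of_int m\<bar> < 2 * pi" using m assms by linarith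
  then have "\<bar>real_of_int m\<bar> < 1" by (simp add: abs_mult)
  then show ?thesis using m by simp
qed

text \<open>The second derivative of \<open>f\<close> being \<open>f\<close> makes the chart
  harmonic, and \<open>conf\<close> makes it conformal. The instances are the catenoid, with
  \<open>f\<close> a multiple of cosh, and the annulus in logarithmic polar coordinates, with
  \<open>f = exp\<close> and \<open>k = 0\<close>. \<open>fg_inj\<close> serves both: the height
  separates the circles of the former, the radius those of the latter.\<close>

locale revolution =
  fixes a :: "real \<times> real" and f f' g :: "real \<Rightarrow> real" and k s0 s1 :: real
  assumes df: "\<And>s. (f has_real_derivative f' s) (at s)" "\<And>s. (f' has_real_derivative f s) (at s)"
    and dg: "\<And>s. (g has_real_derivative k) (at s)"
    and conf: "\<And>s. (f' s)\<^sup>2 + k\<^sup>2 = (f s)\<^sup>2" and f_pos: "\<And>s. 0 < f s"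
    and fg_inj: "\<And>s s'. f s = f s' \<Longrightarrow> g s = g s' \<Longrightarrow> s0 < s \<Longrightarrow> s0 < s' \<Longrightarrow> s = s'" and s_le: "s0 \<le> s1"
begin

definition \<phi> :: "real \<times> real \<Rightarrow> real^3" where
  "\<phi> p = vector [fst a + f (fst p) * cos (snd p), snd a + f (fst p) * sin (snd p), g (fst p)]"
definition \<phi>s :: "real \<times> real \<Rightarrow> real^3" where
  "\<phi>s p = vector [f' (fst p) * cos (snd p), f' (fst p) * sin (snd p), k]"
definition \<phi>t :: "real \<times> real \<Rightarrow> real^3" where
  "\<phi>t p = vector [- (f (fst p) * sin (snd p)), f (fst p) * cos (snd p), 0]"
definition \<phi>ss :: "real \<times> real \<Rightarrow> real^3" where
  "\<phi>ss p = vector [f (fst p) * cos (snd p), f (fst p) * sin (snd p), 0]"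

text \<open>The cross product of \<open>\<phi>t p\<close> and \<open>\<phi>s p\<close> divided by
  \<open>f (fst p)\<close>; its length is \<open>f (fst p)\<close>.\<close>

definition normal :: "real \<times> real \<Rightarrow> real^3" where
  "normal p = vector [k * cos (snd p), k * sin (snd p), - f' (fst p)]"

lemmas chart_defs = \<phi>_def \<phi>s_def \<phi>t_def \<phi>ss_def normal_def

lemma cont_f: "continuous_on UNIV f" "continuous_on UNIV f'" "continuous_on UNIV g"
  by (rule DERIV_continuous_on[OF has_field_derivative_at_within[OF df(1)]]
      DERIV_continuous_on[OF has_field_derivative_at_within[OF df(2)]]
      DERIV_continuous_on[OF has_field_derivative_at_within[OF dg]])+

lemma inj_\<phi>: "inj_on \<phi> ({s0<..<s1} \<times> {0<..<2 * pi})"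
proof (rule inj_onI)
  fix p q assume p: "p \<in> {s0<..<s1} \<times> {0<..<2 * pi}" and q: "q \<in> {s0<..<s1} \<times> {0<..<2 * pi}" and eq: "\<phi> p = \<phi> q"
  have c: "f (fst p) * cos (snd p) = f (fst q) * cos (snd q)" "f (fst p) * sin (snd p) = f (fst q) * sin (snd q)"
    "g (fst p) = g (fst q)"
    using eq by (simp_all add: \<phi>_def vec_eq_iff forall_3 vector_3)
  have sq: "(f (fst x))\<^sup>2 = (f (fst x) * cos (snd x))\<^sup>2 + (f (fst x) * sin (snd x))\<^sup>2" for x :: "real \<times> real"
    by (simp add: power_mult_distrib distrib_left[symmetric])
  have "(f (fst p))\<^sup>2 = (f (fst q))\<^sup>2" unfolding sq c ..
  then have f: "f (fst p) = f (fst q)" using f_pos[of "fst p"] f_pos[of "fst q"] by (simp add: power2_eq_iff_nonneg)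
  then have s: "fst p = fst q" using fg_inj[OF f c(3)] p q by auto
  have cs: "cos (snd p) = cos (snd q)" "sin (snd p) = sin (snd q)"
    using c f f_pos[of "fst q"] by auto
  have "snd p = snd q" using p q by (intro circle_inj[OF _ _ _ _ cs]) auto
  then show "p = q" using s by (simp add: prod_eq_iff)
qed

sublocale harmonic_strip s0 s1 0 "2 * pi" \<phi> \<phi>s \<phi>t "\<lambda>p. f (fst p)" \<phi>ss
proof
  show "open ({s0<..<s1} \<times> {0<..<2 * pi})" by (intro open_Times) auto
  show "inj_on \<phi> ({s0<..<s1} \<times> {0<..<2 * pi})" by (rule inj_\<phi>)
  show "\<phi>s p \<bullet> \<phi>t p = 0" for p by (simp add: inner_vec3 chart_defs vector_3)
  have "(f' (fst p) * cos (snd p))\<^sup>2 + (f' (fst p) * sin (snd p))\<^sup>2 + k\<^sup>2 = (f (fst p))\<^sup>2" for p :: "real \<times> real"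
    by (simp add: power_mult_distrib distrib_left[symmetric] conf)
  then show "norm (\<phi>s p) = f (fst p)" for p
    using f_pos[of "fst p"] by (simp add: norm_vec3 chart_defs vector_3)
  have "(f (fst p) * sin (snd p))\<^sup>2 + (f (fst p) * cos (snd p))\<^sup>2 = (f (fst p))\<^sup>2" for p :: "real \<times> real"
    by (simp add: power_mult_distrib distrib_left[symmetric])
  then show "norm (\<phi>t p) = f (fst p)" for p
    using f_pos[of "fst p"] by (simp add: norm_vec3 chart_defs vector_3)
  show "0 < f (fst p)" for p :: "real \<times> real" by (rule f_pos)
  note cc = continuous_on_compose2[OF cont_f(1) continuous_on_fst[OF continuous_on_id]]
    continuous_on_compose2[OF cont_f(2) continuous_on_fst[OF continuous_on_id]]
  have vec: "continuous_on UNIV F"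
    if "\<And>i. continuous_on UNIV (\<lambda>p. F p $ i)" for F :: "real \<times> real \<Rightarrow> real^3"
    using continuous_on_vec_lambda[of UNIV "\<lambda>i p. F p $ i"] that by simp
  have vec3: "continuous_on UNIV F"
    if "continuous_on UNIV (\<lambda>p. F p $ 1)" "continuous_on UNIV (\<lambda>p. F p $ 2)" "continuous_on UNIV (\<lambda>p. F p $ 3)"
    for F :: "real \<times> real \<Rightarrow> real^3"
  proof (rule vec)
    fix i :: 3
    show "continuous_on UNIV (\<lambda>p. F p $ i)" using exhaust_3[of i] that by (elim disjE) simp_all
  qed
  show "continuous_on UNIV \<phi>s" "continuous_on UNIV \<phi>t" "continuous_on UNIV \<phi>ss"
    by (rule vec3; simp add: chart_defs; intro continuous_intros cc; simp)+
  have dvec: "(F has_derivative F') (at x)"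
    if "\<And>i. ((\<lambda>x. F x $ i) has_derivative (\<lambda>h. F' h $ i)) (at x)" for F :: "'z::real_normed_vector \<Rightarrow> real^3" and F' x
    using that by (subst has_derivative_componentwise_within) (auto simp: Basis_vec_def inner_axis)
  have dvec3: "(F has_derivative F') (at x)"
    if "((\<lambda>x. F x $ 1) has_derivative (\<lambda>h. F' h $ 1)) (at x)" "((\<lambda>x. F x $ 2) has_derivative (\<lambda>h. F' h $ 2)) (at x)"
      "((\<lambda>x. F x $ 3) has_derivative (\<lambda>h. F' h $ 3)) (at x)" for F :: "'z::real_normed_vector \<Rightarrow> real^3" and F' x
  proof (rule dvec)
    fix i :: 3
    show "((\<lambda>x. F x $ i) has_derivative (\<lambda>h. F' h $ i)) (at x)"
      using exhaust_3[of i] that by (elim disjE) simp_all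
  qed
  have dfst: "((\<lambda>p. F (fst p)) has_derivative (\<lambda>v. F' (fst p) * fst v)) (at p)"
    if "\<And>s. (F has_real_derivative F' s) (at s)" for F F' and p :: "real \<times> real"
    using has_derivative_compose[OF has_derivative_fst[OF has_derivative_ident] that[of "fst p", unfolded has_field_derivative_def]] .
  have dsnd: "((\<lambda>p. F (snd p)) has_derivative (\<lambda>v. F' (snd p) * snd v)) (at p)"
    if "\<And>s. (F has_real_derivative F' s) (at s)" for F F' and p :: "real \<times> real"
    using has_derivative_compose[OF has_derivative_snd[OF has_derivative_ident] that[of "snd p", unfolded has_field_derivative_def]] .
  note dd = dfst[of f f', OF df(1)] dfst[of g "\<lambda>_. k", OF dg] dsnd[of cos "\<lambda>x. - sin x", OF DERIV_cos] dsnd[of sin cos, OF DERIV_sin]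
  show "(\<phi> has_derivative (\<lambda>v. fst v *\<^sub>R \<phi>s p + snd v *\<^sub>R \<phi>t p)) (at p)" for p
  proof (rule dvec3)
    show "((\<lambda>x. \<phi> x $ 1) has_derivative (\<lambda>v. (fst v *\<^sub>R \<phi>s p + snd v *\<^sub>R \<phi>t p) $ 1)) (at p)"
      unfolding \<phi>_def vector_3
      by (rule has_derivative_eq_rhs[OF has_derivative_add[OF has_derivative_const has_derivative_mult[OF dd(1) dd(3)]]])
         (auto simp: fun_eq_iff chart_defs vector_3)
    show "((\<lambda>x. \<phi> x $ 2) has_derivative (\<lambda>v. (fst v *\<^sub>R \<phi>s p + snd v *\<^sub>R \<phi>t p) $ 2)) (at p)"
      unfolding \<phi>_def vector_3
      by (rule has_derivative_eq_rhs[OF has_derivative_add[OF has_derivative_const has_derivative_mult[OF dd(1) dd(4)]]])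
         (auto simp: fun_eq_iff chart_defs vector_3)
    show "((\<lambda>x. \<phi> x $ 3) has_derivative (\<lambda>v. (fst v *\<^sub>R \<phi>s p + snd v *\<^sub>R \<phi>t p) $ 3)) (at p)"
      unfolding \<phi>_def vector_3
      by (rule has_derivative_eq_rhs[OF dd(2)]) (auto simp: fun_eq_iff chart_defs vector_3)
  qed
  have d1: "((\<lambda>s. f' s * c) has_derivative (\<lambda>h. h * (f s * c))) (at s)" for s c
    by (rule has_derivative_eq_rhs[OF has_derivative_mult_left[OF df(2)[unfolded has_field_derivative_def]]]) (auto simp: fun_eq_iff)
  show "((\<lambda>s. \<phi>s (s, t)) has_derivative (\<lambda>h. h *\<^sub>R \<phi>ss (s, t))) (at s)" for s t
    by (rule dvec3) (simp_all add: chart_defs d1)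
  have d2: "((\<lambda>t. c * cos t) has_derivative (\<lambda>h. - (h * (c * sin t)))) (at t)"
    "((\<lambda>t. c * sin t) has_derivative (\<lambda>h. h * (c * cos t))) (at t)" for t c :: real
    by (auto intro!: derivative_eq_intros simp: fun_eq_iff)
  show "((\<lambda>t. \<phi>t (s, t)) has_derivative (\<lambda>h. h *\<^sub>R (- \<phi>ss (s, t)))) (at t)" for s t
    by (rule dvec3) (use has_derivative_minus[OF d2(2)] in \<open>simp_all add: chart_defs d2\<close>)
qed (use s_le in auto)

text \<open>\<open>\<phi>s p\<close>, \<open>\<phi>t p\<close> and \<open>normal p\<close> are
  orthogonal and of equal length \<open>f (fst p)\<close>, so the sum of their dyadic squares is
  \<open>(f (fst p))\<^sup>2\<close> times the identity. The entries are verified one by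
  one.\<close>

lemma normal_proj:
  assumes "m = c *\<^sub>R normal p" "c \<noteq> 0"
  shows "(f (fst p))\<^sup>2 * hyper_proj m $ i $ j = \<phi>s p $ i * \<phi>s p $ j + \<phi>t p $ i * \<phi>t p $ j"
proof -
  have "normal p \<bullet> normal p = (f (fst p))\<^sup>2"
    by (simp add: inner_vec3 normal_def vector_3 conf[symmetric])
       (simp add: power2_eq_square[symmetric] power_mult_distrib distrib_left[symmetric] add.commute)
  then have "(f (fst p))\<^sup>2 * hyper_proj m $ i $ j = (if i = j then (f (fst p))\<^sup>2 else 0) - normal p $ i * normal p $ j"
    using assms f_pos[of "fst p"] by (simp add: hyper_proj_def right_diff_distrib)
  moreover have s2: "(sin (snd p))\<^sup>2 = 1 - (cos (snd p))\<^sup>2" by (simp add: sin_squared_eq)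
  moreover have "i = 1 \<or> i = 2 \<or> i = 3" "j = 1 \<or> j = 2 \<or> j = 3" by (rule exhaust_3)+
  moreover have "(f' (fst p))\<^sup>2 = (f (fst p))\<^sup>2 - k\<^sup>2" using conf[of "fst p"] by simp
  moreover have alg: "F * F - k * c * (k * c) = F' * c * (F' * c) + F * s * (F * s)"
    "- (k * c * (k * s)) = F' * c * (F' * s) - F * s * (F * c)"
    "- (k * s * (k * c)) = F' * s * (F' * c) - F * c * (F * s)"
    "F * F - k * s * (k * s) = F' * s * (F' * s) + F * c * (F * c)"
    if "s * s = 1 - c * c" "F' * F' = F * F - k * k" for F F' c s :: real
    using that by algebra+
  ultimately show ?thesis
    by (auto simp: normal_def \<phi>s_def \<phi>t_def vector_3 power2_eq_square intro!: alg)
qed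

text \<open>The chart is periodic in \<open>t\<close>, so the two sides of the slit cancel and only
  the boundary circles contribute.\<close>

lemma first_variation_revolution:
  assumes \<theta>: "\<theta> \<in> test_fields"
    and n: "n \<in> borel_measurable borel" "\<And>p. p \<in> strip \<Longrightarrow> \<exists>c. c \<noteq> 0 \<and> n (\<phi> p) = c *\<^sub>R normal p"
  shows "(LINT z:\<phi> ` strip|hausdorff_measure 2. hom_inner (hyper_proj (n z)) (jacobian \<theta> (at z))) =
    area_const * (LINT t:{0<..<2 * pi}|lborel. \<phi>s (s1, t) \<bullet> \<theta> (\<phi> (s1, t)) - \<phi>s (s0, t) \<bullet> \<theta> (\<phi> (s0, t)))"
proof -
  have per: "\<phi> (s, 2 * pi) = \<phi> (s, 0)" "\<phi>t (s, 2 * pi) = \<phi>t (s, 0)" for s by (simp_all add: \<phi>_def \<phi>t_def)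
  have pr: "(f (fst p))\<^sup>2 * hyper_proj (n (\<phi> p)) $ i $ j = \<phi>s p $ i * \<phi>s p $ j + \<phi>t p $ i * \<phi>t p $ j"
    if "p \<in> strip" for p i j
    using n(2)[OF that] normal_proj by blast
  show ?thesis
    using first_variation_strip[OF \<theta> n(1) pr] by (simp add: per set_lebesgue_integral_def)
qed

end

section \<open>Lower densities along tangent directions of a chart\<close>

context conformal_chart
begin

text \<open>The set \<open>Y\<close> is the image of the disk of radius \<open>\<eta> * r\<close>
  about \<open>p + r *\<^sub>R w\<close>. Its area is of order \<open>r\<^sup>2\<close>, since
  \<open>\<sigma>\<close> is at least half of \<open>\<sigma> p\<close> there. The statement has the
  shape that \<open>approx_tangent_coneI\<close> asks for.\<close>

lemma lower_density:
  assumes p: "p \<in> U" and e: "0 < e"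
  shows "\<exists>c>0. \<exists>R>0. \<forall>r. 0 < r \<and> r < R \<longrightarrow>
      (\<exists>Y\<in>sets borel. Y \<subseteq> \<phi> ` U \<and> (\<forall>y\<in>Y. norm (y - \<phi> p - r *\<^sub>R D p w) < e * r) \<and>
        ennreal (c * r\<^sup>2) \<le> emeasure (hausdorff_measure 2) Y)"
proof -
  define m where "m = \<sigma> p / 2"
  have m: "0 < m" using pos[of p] by (simp add: m_def)
  obtain d1 where d1: "d1 > 0" "\<And>q. dist q p < d1 \<Longrightarrow> dist (\<sigma> q) (\<sigma> p) < m"
    using cont_\<sigma> m unfolding continuous_on_iff by (metis UNIV_I)
  obtain d2 where d2: "d2 > 0" "ball p d2 \<subseteq> U" using open_U p by (meson openE)
  \<comment> \<open>Error budget per unit of \<open>r\<close>: \<open>e / 4\<close> for the size of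
    the disk and \<open>e / 2\<close> for the linearisation, which leaves a strict
    inequality.\<close>
  define \<eta> where "\<eta> = e / (4 * \<sigma> p)"
  have \<eta>: "0 < \<eta>" "\<sigma> p * \<eta> = e / 4" using e pos[of p] by (simp_all add: \<eta>_def)
  define b where "b = norm w + \<eta>"
  have b: "0 < b" using \<eta> by (simp add: b_def add_nonneg_pos)
  define e' where "e' = e / (2 * b)"
  have e': "0 < e'" "e' * b = e / 2" using e b by (simp_all add: e'_def)
  obtain d3 where d3: "d3 > 0" "\<And>q. norm (q - p) < d3 \<Longrightarrow> norm (\<phi> q - \<phi> p - D p (q - p)) \<le> e' * norm (q - p)"
    using deriv[of p] e'(1) unfolding has_derivative_at_alt by blast
  define d where "d = min d1 (min d2 d3)"
  have d: "0 < d" "d \<le> d1" "d \<le> d2" "d \<le> d3" using d1 d2 d3 by (auto simp: d_def)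
  define c where "c = area_const * m\<^sup>2 * (unit_ball_vol 2 * \<eta>\<^sup>2)"
  have c: "0 < c" using area_const(1) m \<eta> by (simp add: c_def)
  have "\<exists>Y\<in>sets borel. Y \<subseteq> \<phi> ` U \<and> (\<forall>y\<in>Y. norm (y - \<phi> p - r *\<^sub>R D p w) < e * r) \<and>
        ennreal (c * r\<^sup>2) \<le> emeasure (hausdorff_measure 2) Y" if r: "0 < r" "r < d / b" for r
  proof -
    define F where "F = cball (p + r *\<^sub>R w) (\<eta> * r)"
    have rb: "r * b < d" using r b by (simp add: field_simps)
    have Fn: "norm (q - p) \<le> r * b" if "q \<in> F" for q
    proof -
      have "norm (q - p) \<le> norm (q - (p + r *\<^sub>R w)) + norm (r *\<^sub>R w)"
        using norm_triangle_ineq[of "q - (p + r *\<^sub>R w)" "r *\<^sub>R w"] by (simp add: algebra_simps)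
      also have "\<dots> \<le> \<eta> * r + r * norm w"
        using that r by (intro add_mono) (auto simp: F_def dist_norm norm_minus_commute)
      finally show ?thesis by (simp add: b_def algebra_simps)
    qed
    then have Fd: "norm (q - p) < d" if "q \<in> F" for q using that rb by fastforce
    have FU: "F \<subseteq> U"
    proof
      fix q assume "q \<in> F"
      then have "q \<in> ball p d2" using Fd[of q] d by (simp add: dist_norm norm_minus_commute)
      then show "q \<in> U" using d2 by blast
    qed
    have Fm: "m \<le> \<sigma> q" if "q \<in> F" for q
      using d1(2)[of q] Fd[OF that] d by (auto simp: dist_norm m_def abs_if split: if_splits)
    let ?Y = "\<phi> ` F"
    have FF: "U \<inter> F = F" using FU by blast
    have Ym[measurable]: "?Y \<in> sets borel" using borel_image(1)[of F] unfolding FF by (simp add: F_def)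
    have "norm (y - \<phi> p - r *\<^sub>R D p w) < e * r" if "y \<in> ?Y" for y
    proof -
      obtain q where q: "q \<in> F" "y = \<phi> q" using \<open>y \<in> ?Y\<close> by blast
      define h where "h = q - (p + r *\<^sub>R w)"
      have h: "norm h \<le> \<eta> * r" using q(1) by (simp add: h_def F_def dist_norm norm_minus_commute)
      have "D p (q - p) = r *\<^sub>R D p w + D p h"
        by (simp add: h_def algebra_simps)
      then have "y - \<phi> p - r *\<^sub>R D p w = (\<phi> q - \<phi> p - D p (q - p)) + D p h" using q by simp
      then have "norm (y - \<phi> p - r *\<^sub>R D p w) \<le> norm (\<phi> q - \<phi> p - D p (q - p)) + norm (D p h)"
        by (metis norm_triangle_ineq)
      also have "norm (\<phi> q - \<phi> p - D p (q - p)) \<le> e' * norm (q - p)"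
        using Fd[OF q(1)] d by (intro d3) auto
      also have "e' * norm (q - p) \<le> e' * (r * b)" using Fn[OF q(1)] e' by (intro mult_left_mono) auto
      also have "e' * (r * b) = e / 2 * r" using e'(2) by (metis mult.assoc mult.commute)
      also have "norm (D p h) \<le> e / 4 * r"
      proof -
        have "norm (D p h) \<le> \<sigma> p * (\<eta> * r)" unfolding norm_D using h pos[of p] by (intro mult_left_mono) auto
        also have "\<dots> = e / 4 * r" using \<eta>(2) by (metis mult.assoc)
        finally show ?thesis .
      qed
      finally have "norm (y - \<phi> p - r *\<^sub>R D p w) \<le> e / 2 * r + e / 4 * r" by simp
      also have "\<dots> < e * r" using e r by simp
      finally show ?thesis .
    qed
    moreover have "ennreal (c * r\<^sup>2) \<le> emeasure (hausdorff_measure 2) ?Y"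
    proof -
      have "U \<inter> \<phi> -` ?Y = F" using inj FU by (auto simp: inj_on_def)
      moreover have "?Y \<inter> \<phi> ` U = ?Y" using FU by blast
      ultimately have "emeasure (hausdorff_measure 2) ?Y = emeasure param_measure F"
        using emeasure_image[OF Ym] by simp
      also have "\<dots> = (\<integral>\<^sup>+q. ennreal (area_const * (\<sigma> q)\<^sup>2) * indicator F q \<partial>lborel)"
        unfolding param_measure_def by (subst emeasure_density) (auto simp: F_def)
      also have "\<dots> \<ge> (\<integral>\<^sup>+q. ennreal (area_const * m\<^sup>2) * indicator F q \<partial>lborel)"
      proof (intro nn_integral_mono)
        fix q
        show "ennreal (area_const * m\<^sup>2) * indicator F q \<le> ennreal (area_const * (\<sigma> q)\<^sup>2) * indicator F q"
          using Fm[of q] m area_const(1) by (cases "q \<in> F") (auto intro!: ennreal_leI power_mono)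
      qed
      also have "(\<integral>\<^sup>+q. ennreal (area_const * m\<^sup>2) * indicator F q \<partial>lborel) = ennreal (area_const * m\<^sup>2) * emeasure lborel F"
        by (subst nn_integral_cmult_indicator) (auto simp: F_def)
      also have "emeasure lborel F = ennreal (unit_ball_vol 2 * (\<eta> * r)\<^sup>2)"
        using \<eta>(1) r(1) by (simp add: F_def emeasure_cball) (simp add: power2_eq_square)
      also have "ennreal (area_const * m\<^sup>2) * ennreal (unit_ball_vol 2 * (\<eta> * r)\<^sup>2) = ennreal (c * r\<^sup>2)"
        using area_const(1) by (subst ennreal_mult[symmetric]) (auto simp: c_def power_mult_distrib ac_simps)
      finally show ?thesis .
    qed
    ultimately show ?thesis using Ym FU by (intro bexI[of _ ?Y]) auto
  qed
  note main = this
  show ?thesis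
  proof (rule exI[of _ c], rule conjI[OF c], rule exI[of _ "d / b"], intro conjI allI impI)
    fix r assume "0 < r \<and> r < d / b"
    then show "\<exists>Y\<in>sets borel. Y \<subseteq> \<phi> ` U \<and> (\<forall>y\<in>Y. norm (y - \<phi> p - r *\<^sub>R D p w) < e * r) \<and>
        ennreal (c * r\<^sup>2) \<le> emeasure (hausdorff_measure 2) Y" by (intro main) simp_all
  qed (use c d b in simp_all)
qed

end

context revolution
begin

text \<open>A vector orthogonal to \<open>m\<close> is fixed by the projection, and
  \<open>normal_proj\<close> expands the projection in the partial derivatives.\<close>

lemma hyperplane_in_range:
  assumes "m = c *\<^sub>R normal p" "c \<noteq> 0" "v \<in> hyperplane m"
  shows "\<exists>w. v = D p w"
proof -
  let ?F = "(f (fst p))\<^sup>2"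
  have F: "0 < ?F" using f_pos[of "fst p"] by simp
  \<comment> \<open>For \<open>m = 0\<close> the matrix would be the identity, by the convention on
    division by zero. Taking traces in \<open>normal_proj\<close> would then give
    \<open>3 * ?F = 2 * ?F\<close>.\<close>
  have m0: "m \<noteq> 0"
  proof
    assume "m = 0"
    then have "hyper_proj m $ i $ i = 1" for i by (simp add: hyper_proj_def)
    then have "?F = (\<phi>s p $ i)\<^sup>2 + (\<phi>t p $ i)\<^sup>2" for i
      using normal_proj[OF assms(1,2), of i i] by (simp add: power2_eq_square)
    from this[of 1] this[of 2] this[of 3] have "3 * ?F = \<phi>s p \<bullet> \<phi>s p + \<phi>t p \<bullet> \<phi>t p"
      by (simp add: inner_vec3 power2_eq_square)
    also have "\<dots> = ?F + ?F" by (simp add: norm_s norm_t power2_norm_eq_inner[symmetric])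
    finally show False using F by simp
  qed
  have "hyper_proj m *v v = v"
  proof -
    have "(hyper_proj m *v v) $ i = v $ i - (m $ i / (m \<bullet> m)) * (m \<bullet> v)" for i
      by (simp add: matrix_vector_mult_def hyper_proj_def left_diff_distrib sum_subtractf inner_vec_def[of m v]
          sum_distrib_left if_distrib[of "\<lambda>x. x * _"] cong: if_cong) (simp add: field_simps)
    then show ?thesis using assms(3) by (simp add: hyperplane_def vec_eq_iff)
  qed
  then have "?F * v $ i = (\<phi>s p \<bullet> v) * \<phi>s p $ i + (\<phi>t p \<bullet> v) * \<phi>t p $ i" for i
  proof -
    have "?F * v $ i = ?F * (hyper_proj m *v v) $ i" using \<open>hyper_proj m *v v = v\<close> by simp
    also have "\<dots> = (\<Sum>j\<in>UNIV. (?F * hyper_proj m $ i $ j) * v $ j)"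
      by (simp add: matrix_vector_mult_def sum_distrib_left mult.assoc)
    also have "\<dots> = (\<phi>s p \<bullet> v) * \<phi>s p $ i + (\<phi>t p \<bullet> v) * \<phi>t p $ i"
      unfolding normal_proj[OF assms(1,2)] by (simp add: inner_vec3 sum_3 algebra_simps)
    finally show ?thesis .
  qed
  then have "v = D p ((\<phi>s p \<bullet> v) / ?F, (\<phi>t p \<bullet> v) / ?F)"
    using F by (simp add: vec_eq_iff field_simps)
  then show ?thesis by blast
qed

end

section \<open>Half catenoids\<close>

lemma set_integrable_Ioo:
  fixes f :: "real \<Rightarrow> real"
  assumes "continuous_on UNIV f" shows "set_integrable lborel {a<..<b} f"
proof (rule set_integrable_subset)
  show "set_integrable lborel {a..b} f" unfolding set_integrable_def
    by (rule borel_integrable_compact) (use assms in \<open>auto intro: continuous_on_subset\<close>)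
qed auto

abbreviation e3 :: "real^3" where "e3 \<equiv> axis 3 1"

lemma emeasure_strip: "emeasure lborel ({s0<..<s1} \<times> {t0<..<t1}) = ennreal (s1 - s0) * ennreal (t1 - t0)"
  if "s0 \<le> s1" "t0 \<le> t1" for s0 s1 t0 t1 :: real
  unfolding lborel_prod[symmetric] using that by (subst lborel.emeasure_pair_measure_Times) auto

lemma hyper_proj_e3: "hyper_proj e3 $ i $ j = (if i = j then 1 else 0) - e3 $ i * e3 $ j"
  by (simp add: hyper_proj_def inner_axis_axis)

text \<open>
  The half catenoid \<open>C\<close> lies below the flat annulus \<open>A\<close> with radii \<open>\<epsilon>\<close> and \<open>R\<close>, which it replaces, and
  meets it along the circle of radius \<open>R\<close>. Both are images of open strips on which the charts are
  injective; thus they lack a meridian, which is an \<open>H\<^sup>2\<close> null set.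
\<close>

locale hat =
  fixes a :: "real \<times> real" and \<epsilon> L :: real
  assumes \<epsilon>: "0 < \<epsilon>" and L: "0 < L"
begin

definition R :: real where "R = \<epsilon> * cosh L"

lemma R_pos: "0 < R" and \<epsilon>_le_R: "\<epsilon> \<le> R" and \<epsilon>_less_R: "\<epsilon> < R"
proof -
  have "1 < cosh L" using cosh_real_strict_mono[of 0 L] L by simp
  then show "\<epsilon> < R" "\<epsilon> \<le> R" "0 < R" using \<epsilon> by (simp_all add: R_def)
qed

text \<open>The shift by \<open>L\<close> puts the outer circle at height 0, into the plane of the
  annulus; the neck \<open>s = 0\<close> lies at depth \<open>\<epsilon> * L\<close>.\<close>

sublocale cat: revolution a "\<lambda>s. \<epsilon> * cosh s" "\<lambda>s. \<epsilon> * sinh s" "\<lambda>s. \<epsilon> * (s - L)" \<epsilon> 0 L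
proof
  show "(\<epsilon> * sinh s)\<^sup>2 + \<epsilon>\<^sup>2 = (\<epsilon> * cosh s)\<^sup>2" for s
    by (simp add: power_mult_distrib cosh_square_eq algebra_simps)
  show "0 < \<epsilon> * cosh s" for s using \<epsilon> by simp
qed (use \<epsilon> L in \<open>auto intro!: derivative_eq_intros\<close>)

sublocale ann: revolution a exp exp "\<lambda>_. 0" 0 "ln \<epsilon>" "ln R"
proof
  show "ln \<epsilon> \<le> ln R" using \<epsilon> \<epsilon>_le_R by simp
qed (auto intro!: derivative_eq_intros)

definition C :: "(real^3) set" where "C = cat.\<phi> ` cat.strip"
definition A :: "(real^3) set" where "A = ann.\<phi> ` ann.strip"

text \<open>Half the gradient of a function that vanishes on the catenoid: the squared distance from
  the axis minus the squared catenary radius at the height \<open>z $ 3\<close>. In contrast to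
  \<open>cat.normal\<close> it is a function of the point instead of the parameters.\<close>

definition N :: "real^3 \<Rightarrow> real^3" where
  "N z = vector [z $ 1 - fst a, z $ 2 - snd a, - (\<epsilon> * cosh (z $ 3 / \<epsilon> + L) * sinh (z $ 3 / \<epsilon> + L))]"

lemma sets_C [measurable]: "C \<in> sets borel" and sets_A [measurable]: "A \<in> sets borel"
  unfolding C_def A_def by (rule cat.borel_image ann.borel_image)+

lemma measurable_N [measurable]: "N \<in> borel_measurable borel"
proof -
  have "continuous_on UNIV (\<lambda>z. N z $ i)" for i
    using exhaust_3[of i] by (elim disjE) (simp_all add: N_def, (intro continuous_intros; use \<epsilon> in simp)+)
  then have "continuous_on UNIV N"
    using continuous_on_vec_lambda[of UNIV "\<lambda>i z. N z $ i"] by simp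
  then show ?thesis by (rule borel_measurable_continuous_onI)
qed

lemma N_cat: "N (cat.\<phi> p) = cosh (fst p) *\<^sub>R cat.normal p"
  using \<epsilon> by (simp add: N_def cat.\<phi>_def cat.normal_def vec_eq_iff forall_3)

lemma N_C: "z \<in> C \<Longrightarrow> \<exists>p c. p \<in> cat.strip \<and> z = cat.\<phi> p \<and> c \<noteq> 0 \<and> N z = c *\<^sub>R cat.normal p"
  using N_cat cosh_real_nonzero unfolding C_def by blast

lemma N_nz: assumes "z \<in> C" shows "N z \<noteq> 0"
proof
  assume "N z = 0"
  obtain p c where "c \<noteq> 0" "N z = c *\<^sub>R cat.normal p" using N_C[OF assms] by blast
  then have "cat.normal p = 0" using \<open>N z = 0\<close> by simp
  then have "\<epsilon> * cos (snd p) = 0" "\<epsilon> * sin (snd p) = 0"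
    by (simp_all add: cat.normal_def vec_eq_iff forall_3)
  then show False using \<epsilon> by (metis mult_eq_0_iff less_irrefl sin_zero_norm_cos_one zero_neq_one norm_zero)
qed

lemma dist_rev: "dist a (fst a + x * cos t, snd a + x * sin t) = \<bar>x\<bar>"
proof -
  have "(x * cos t)\<^sup>2 + (x * sin t)\<^sup>2 = x\<^sup>2" by (simp add: power_mult_distrib distrib_left[symmetric])
  then show ?thesis by (simp add: dist_prod_def dist_real_def)
qed

lemma C_bounds:
  assumes "z \<in> C"
  shows "z $ 3 < 0" "- R < z $ 3" "dist a (shadow z) < R"
proof -
  obtain p where p: "p \<in> cat.strip" "z = cat.\<phi> p" using assms by (auto simp: C_def)
  \<comment> \<open>This bounds the depth \<open>\<epsilon> * L\<close> of the hat by its outer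
    radius \<open>R\<close>, so that the whole hat stays close to its disk.\<close>
  have "L \<le> cosh L"
  proof -
    have 1: "1 + L + L\<^sup>2 / 2 \<le> exp L" using L by (intro exp_lower_Taylor_quadratic) simp
    have 2: "exp L \<le> 2 * cosh L" by (simp add: cosh_field_def)
    have 3: "2 * L \<le> L\<^sup>2 + 1" using zero_le_power2[of "L - 1"] by (simp add: power2_diff)
    show ?thesis using 1 2 3 by linarith
  qed
  then have LR: "\<epsilon> * L \<le> R" using \<epsilon> by (simp add: R_def)
  have s: "0 < fst p" "fst p < L" using p(1) by auto
  show "z $ 3 < 0" using s \<epsilon> by (simp add: p(2) cat.\<phi>_def mult_less_0_iff)
  have "- (\<epsilon> * L) < \<epsilon> * (fst p - L)" using s \<epsilon> by (simp add: algebra_simps)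
  then show "- R < z $ 3" using LR by (simp add: p(2) cat.\<phi>_def)
  have "cosh (fst p) < cosh L" using s by (simp add: cosh_real_strict_mono)
  then show "dist a (shadow z) < R" using \<epsilon>
    by (simp add: p(2) cat.\<phi>_def shadow_def dist_rev R_def abs_mult)
qed

lemma A_bounds:
  assumes "z \<in> A"
  shows "z $ 3 = 0" "dist a (shadow z) < R"
proof -
  obtain p where p: "p \<in> ann.strip" "z = ann.\<phi> p" using assms by (auto simp: A_def)
  show "z $ 3 = 0" by (simp add: p(2) ann.\<phi>_def)
  have "exp (fst p) < R" using p(1) R_pos by (auto simp: exp_less_cancel_iff[of _ "ln R", symmetric] simp del: exp_less_cancel_iff)
  then show "dist a (shadow z) < R" by (simp add: p(2) ann.\<phi>_def shadow_def dist_rev)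
qed

text \<open>No catenoid hangs below the part of the square that stays flat; the density argument at
  flat points rests on this.\<close>

lemma shadow_C: "shadow ` C \<subseteq> shadow ` A"
proof
  fix x assume "x \<in> shadow ` C"
  then obtain p where p: "p \<in> cat.strip" "x = shadow (cat.\<phi> p)" by (auto simp: C_def)
  have pos: "0 < \<epsilon> * cosh (fst p)" using \<epsilon> by simp
  have c: "1 < cosh (fst p)" "cosh (fst p) < cosh L"
    using p(1) cosh_real_strict_mono[of 0 "fst p"] by (auto simp: cosh_real_strict_mono)
  have "(ln (\<epsilon> * cosh (fst p)), snd p) \<in> ann.strip"
    using p(1) c \<epsilon> pos R_pos by (auto simp: R_def)
  moreover have "x = shadow (ann.\<phi> (ln (\<epsilon> * cosh (fst p)), snd p))"
    using pos by (simp add: p(2) shadow_def cat.\<phi>_def ann.\<phi>_def)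
  ultimately show "x \<in> shadow ` A" unfolding A_def by blast
qed

lemma emeasure_C_le: "emeasure (hausdorff_measure 2) C \<le> ennreal (area_const * (2 * pi * R\<^sup>2))"
proof -
  \<comment> \<open>The square of cosh is enlarged to the sum of the squares of cosh and sinh, which
    is the derivative of \<open>sinh s * cosh s\<close>.\<close>
  define G where "G p = area_const * (\<epsilon>\<^sup>2 * ((cosh (fst p))\<^sup>2 + (sinh (fst p))\<^sup>2))" for p :: "real \<times> real"
  have G0: "0 \<le> G p" for p using area_const(1) by (simp add: G_def)
  have cG: "continuous_on UNIV G" unfolding G_def by (intro continuous_intros)
  have "emeasure (hausdorff_measure 2) C = (\<integral>\<^sup>+z\<in>C. 1 \<partial>hausdorff_measure 2)" by simp
  also have "\<dots> = (\<integral>\<^sup>+p\<in>cat.strip. ennreal (area_const * (\<epsilon> * cosh (fst p))\<^sup>2) * 1 \<partial>lborel)"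
    unfolding C_def by (rule cat.nn_integral_image) simp
  also have "\<dots> \<le> (\<integral>\<^sup>+p. ennreal (indicator cat.strip p *\<^sub>R G p) \<partial>lborel)"
    using area_const(1)
    by (intro nn_integral_mono) (auto simp: G_def indicator_def power_mult_distrib intro!: ennreal_leI mult_left_mono)
  also have "\<dots> = ennreal (LINT p:cat.strip|lborel. G p)"
    unfolding set_lebesgue_integral_def
    using set_integrable_strip[OF cG] G0 by (intro nn_integral_eq_integral) (auto simp: set_integrable_def)
  also have "(LINT p:cat.strip|lborel. G p) = (LINT t:{0<..<2 * pi}|lborel. area_const * (\<epsilon>\<^sup>2 * (sinh L * cosh L)) - area_const * (\<epsilon>\<^sup>2 * (sinh 0 * cosh 0)))"
  proof -
    have "((\<lambda>s. area_const * (\<epsilon>\<^sup>2 * (sinh s * cosh s))) has_real_derivative G (s, t)) (at s)" for s t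
      by (auto intro!: derivative_eq_intros simp: G_def power2_eq_square algebra_simps)
    from integral_strip_s[of 0 L "\<lambda>p. area_const * (\<epsilon>\<^sup>2 * (sinh (fst p) * cosh (fst p)))" G 0 "2 * pi", simplified, OF _ this cG] L
    show ?thesis by simp
  qed
  also have "\<dots> = area_const * (2 * pi * (\<epsilon>\<^sup>2 * (sinh L * cosh L)))" by (simp add: set_lebesgue_integral_def)
  also have "\<dots> \<le> area_const * (2 * pi * R\<^sup>2)"
  proof -
    have "sinh L * cosh L \<le> cosh L * cosh L" using sinh_le_cosh_real[of L] by (intro mult_right_mono) auto
    then have "\<epsilon>\<^sup>2 * (sinh L * cosh L) \<le> R\<^sup>2" using \<epsilon> by (simp add: R_def power_mult_distrib power2_eq_square)
    then show ?thesis using area_const(1) by (intro mult_left_mono) auto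
  qed
  finally show ?thesis by (simp add: ennreal_leI)
qed

text \<open>With \<open>u\<close> the unit normal, the squared distance of the projections is
  \<open>2 * (1 - (u 3)\<^sup>2)\<close>. Multiplied by the area element it is constant because cosh
  and sinh have squares differing by 1. Hence the excess of the whole half catenoid grows linearly
  with \<open>L\<close>.\<close>

lemma tilt_point:
  assumes "p \<in> cat.strip"
  shows "(\<epsilon> * cosh (fst p))\<^sup>2 * (hom_norm (hyper_proj (N (cat.\<phi> p)) - hyper_proj e3))\<^sup>2 = 2 * \<epsilon>\<^sup>2"
proof -
  define F where "F = \<epsilon> * cosh (fst p)"
  define u where "u i = cat.normal p $ i / F" for i
  have F: "0 < F" using \<epsilon> by (simp add: F_def)
  have nn: "cat.normal p \<bullet> cat.normal p = F\<^sup>2"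
    by (simp add: inner_vec3 cat.normal_def F_def cosh_square_eq power_mult_distrib)
       (simp add: power2_eq_square[symmetric] power_mult_distrib distrib_left[symmetric] algebra_simps)
  then have "(cat.normal p $ 1)\<^sup>2 + (cat.normal p $ 2)\<^sup>2 + (cat.normal p $ 3)\<^sup>2 = F\<^sup>2"
    by (simp add: inner_vec3 power2_eq_square)
  then have u1: "(u 1)\<^sup>2 + (u 2)\<^sup>2 + (u 3)\<^sup>2 = 1"
    using F by (simp add: u_def power_divide add_divide_distrib[symmetric])
  have P: "hyper_proj (N (cat.\<phi> p)) $ i $ j = (if i = j then 1 else 0) - u i * u j" for i j
    unfolding N_cat using F by (simp add: hyper_proj_def nn u_def power2_eq_square)
  have "(hom_norm (hyper_proj (N (cat.\<phi> p)) - hyper_proj e3))\<^sup>2 = (\<Sum>i\<in>UNIV. \<Sum>j\<in>UNIV. (e3 $ i * e3 $ j - u i * u j)\<^sup>2)"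
    by (simp add: hom_norm_square P hyper_proj_e3)
  also have "\<dots> = 2 * (1 - (u 3)\<^sup>2)"
    using u1 by (simp add: sum_3 axis_def power2_eq_square) algebra
  finally have "F\<^sup>2 * (hom_norm (hyper_proj (N (cat.\<phi> p)) - hyper_proj e3))\<^sup>2 = F\<^sup>2 * (2 * (1 - (u 3)\<^sup>2))"
    by (rule arg_cong)
  also have "\<dots> = 2 * (F\<^sup>2 - (F * u 3)\<^sup>2)" by (simp add: power_mult_distrib algebra_simps)
  also have "F * u 3 = - (\<epsilon> * sinh (fst p))" using F by (simp add: u_def cat.normal_def)
  also have "2 * (F\<^sup>2 - (- (\<epsilon> * sinh (fst p)))\<^sup>2) = 2 * \<epsilon>\<^sup>2"
    by (simp add: F_def power_mult_distrib cosh_square_eq algebra_simps)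
  finally show ?thesis by (simp add: F_def)
qed

lemma measurable_hom_norm: "(\<lambda>z. hom_norm (hyper_proj (N z) - hyper_proj e3)) \<in> borel_measurable borel"
proof -
  have [measurable]: "(\<lambda>z. hyper_proj (N z) - hyper_proj e3) \<in> borel_measurable borel" by measurable
  show ?thesis unfolding hom_norm_def hom_inner_sum by measurable
qed

lemma tilt_C:
  "(\<integral>\<^sup>+z\<in>C. ennreal ((hom_norm (hyper_proj (N z) - hyper_proj e3))\<^sup>2) \<partial>hausdorff_measure 2)
    = ennreal (area_const * (4 * pi * \<epsilon>\<^sup>2 * L))"
proof -
  note [measurable] = measurable_hom_norm
  have "(\<integral>\<^sup>+z\<in>C. ennreal ((hom_norm (hyper_proj (N z) - hyper_proj e3))\<^sup>2) \<partial>hausdorff_measure 2) =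
    (\<integral>\<^sup>+p\<in>cat.strip. ennreal (area_const * (\<epsilon> * cosh (fst p))\<^sup>2) *
       ennreal ((hom_norm (hyper_proj (N (cat.\<phi> p)) - hyper_proj e3))\<^sup>2) \<partial>lborel)"
    unfolding C_def by (rule cat.nn_integral_image) measurable
  also have "\<dots> = (\<integral>\<^sup>+p\<in>cat.strip. ennreal (area_const * (2 * \<epsilon>\<^sup>2)) \<partial>lborel)"
  proof (intro nn_integral_cong)
    fix p :: "real \<times> real"
    show "ennreal (area_const * (\<epsilon> * cosh (fst p))\<^sup>2) * ennreal ((hom_norm (hyper_proj (N (cat.\<phi> p)) - hyper_proj e3))\<^sup>2) * indicator cat.strip p
      = ennreal (area_const * (2 * \<epsilon>\<^sup>2)) * indicator cat.strip p"
      using tilt_point[of p] area_const(1)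
      by (cases "p \<in> cat.strip") (simp_all add: ennreal_mult[symmetric] mult.assoc)
  qed
  also have "\<dots> = ennreal (area_const * (2 * \<epsilon>\<^sup>2)) * (ennreal (L - 0) * ennreal (2 * pi - 0))"
    using L by (subst nn_integral_cmult_indicator) (simp_all add: emeasure_strip borel_open open_Times del: diff_zero)
  also have "\<dots> = ennreal (area_const * (4 * pi * \<epsilon>\<^sup>2 * L))"
    using area_const(1) L by (simp add: ennreal_mult[symmetric] ac_simps)
  finally show ?thesis .
qed

lemma tangent_C:
  assumes z: "z \<in> C" shows "tangent_cone C z \<subseteq> hyperplane (N z)"
proof -
  define F where "F x = (x $ 1 - fst a)\<^sup>2 + (x $ 2 - snd a)\<^sup>2 - \<epsilon>\<^sup>2 * (cosh (x $ 3 / \<epsilon> + L))\<^sup>2" for x :: "real^3"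
  have 0: "F x = 0" if x: "x \<in> C" for x
  proof -
    obtain p where p: "x = cat.\<phi> p" using x by (auto simp: C_def)
    have "(\<epsilon> * cosh (fst p) * cos (snd p))\<^sup>2 + (\<epsilon> * cosh (fst p) * sin (snd p))\<^sup>2 = \<epsilon>\<^sup>2 * (cosh (fst p))\<^sup>2"
      by (simp add: power_mult_distrib distrib_left[symmetric])
    then show ?thesis using \<epsilon> by (simp add: F_def p cat.\<phi>_def)
  qed
  have nth: "((\<lambda>x :: real^3. x $ i) has_derivative (\<lambda>h. h $ i)) (at x)" for i x
    by (rule bounded_linear_imp_has_derivative) (rule bounded_linear_vec_nth)
  have dsq: "((\<lambda>x :: real^3. (x $ i - c)\<^sup>2) has_derivative (\<lambda>h. 2 * (x $ i - c) * h $ i)) (at x)" for i c x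
    by (rule has_derivative_eq_rhs, (rule derivative_eq_intros nth refl)+) (simp add: fun_eq_iff)
  have dcosh: "((\<lambda>y. \<epsilon>\<^sup>2 * (cosh (y / \<epsilon> + L))\<^sup>2) has_real_derivative 2 * \<epsilon> * cosh (y / \<epsilon> + L) * sinh (y / \<epsilon> + L)) (at y)" for y
    using \<epsilon> by (auto intro!: derivative_eq_intros simp: power2_eq_square field_simps)
  have d3: "((\<lambda>x :: real^3. \<epsilon>\<^sup>2 * (cosh (x $ 3 / \<epsilon> + L))\<^sup>2) has_derivative
      (\<lambda>h. 2 * \<epsilon> * cosh (z $ 3 / \<epsilon> + L) * sinh (z $ 3 / \<epsilon> + L) * h $ 3)) (at z)"
    using has_derivative_compose[OF nth dcosh[unfolded has_field_derivative_def]] .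
  have "(F has_derivative (\<lambda>h. (2 *\<^sub>R N z) \<bullet> h)) (at z)"
    unfolding F_def
    by (rule has_derivative_eq_rhs[OF has_derivative_diff[OF has_derivative_add[OF dsq dsq] d3]])
       (simp add: fun_eq_iff inner_vec3 N_def algebra_simps)
  from tangent_cone_level_set[OF this 0[OF z] 0] have "tangent_cone C z \<subseteq> hyperplane (2 *\<^sub>R N z)" .
  then show ?thesis by (simp add: hyperplane_def)
qed

lemma lower_density_C:
  assumes z: "z \<in> C" and v: "v \<in> hyperplane (N z)" and e: "0 < e"
  shows "\<exists>c>0. \<exists>R>0. \<forall>r. 0 < r \<and> r < R \<longrightarrow>
      (\<exists>Y\<in>sets borel. Y \<subseteq> C \<and> (\<forall>y\<in>Y. norm (y - z - r *\<^sub>R v) < e * r) \<and>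
        ennreal (c * r\<^sup>2) \<le> emeasure (hausdorff_measure 2) Y)"
proof -
  obtain p c where p: "p \<in> cat.strip" "z = cat.\<phi> p" "c \<noteq> 0" "N z = c *\<^sub>R cat.normal p"
    using N_C[OF z] by blast
  obtain w where w: "v = cat.D p w" using cat.hyperplane_in_range[OF p(4,3) v] by blast
  show ?thesis unfolding p(2) w C_def by (rule cat.lower_density[OF p(1) e])
qed

text \<open>
  Along the outer circle the conormals \<open>(\<epsilon> sinh L, \<epsilon>)\<close> of \<open>C\<close> and \<open>(\<epsilon> cosh L, 0)\<close> of \<open>A\<close>, scaled by the
  arc length, differ by at most \<open>2\<epsilon>\<close>; the inner circles have radius \<open>\<epsilon>\<close>.
\<close>

lemma first_variation_hat:
  assumes \<theta>: "\<theta> \<in> test_fields" and \<theta>1: "\<And>x. norm (\<theta> x) \<le> 1"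
  shows "\<bar>(LINT z:C|hausdorff_measure 2. hom_inner (hyper_proj (N z)) (jacobian \<theta> (at z)))
     - (LINT z:A|hausdorff_measure 2. hom_inner (hyper_proj e3) (jacobian \<theta> (at z)))\<bar> \<le> area_const * (8 * pi * \<epsilon>)"
proof -
  define fc where "fc s t = cat.\<phi>s (s, t) \<bullet> \<theta> (cat.\<phi> (s, t))" for s t
  define fa where "fa s t = ann.\<phi>s (s, t) \<bullet> \<theta> (ann.\<phi> (s, t))" for s t
  have nC: "\<exists>c. c \<noteq> 0 \<and> N (cat.\<phi> p) = c *\<^sub>R cat.normal p" for p
    using N_cat cosh_real_nonzero by blast
  have eC: "(LINT z:C|hausdorff_measure 2. hom_inner (hyper_proj (N z)) (jacobian \<theta> (at z))) =
    area_const * (LINT t:{0<..<2 * pi}|lborel. fc L t - fc 0 t)"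
    unfolding C_def fc_def by (rule cat.first_variation_revolution[OF \<theta> measurable_N nC])
  have nA: "\<exists>c. c \<noteq> 0 \<and> e3 = c *\<^sub>R ann.normal p" for p
    by (intro exI[of _ "- exp (- fst p)"]) (simp add: ann.normal_def vec_eq_iff forall_3 axis_def exp_minus)
  have eA: "(LINT z:A|hausdorff_measure 2. hom_inner (hyper_proj e3) (jacobian \<theta> (at z))) =
    area_const * (LINT t:{0<..<2 * pi}|lborel. fa (ln R) t - fa (ln \<epsilon>) t)"
    unfolding A_def fa_def by (rule ann.first_variation_revolution[OF \<theta> _ nA]) simp
  have c\<theta>: "continuous_on UNIV \<theta>"
    using test_field_deriv(1)[OF \<theta>] has_derivative_continuous
    by (fastforce simp: continuous_on_eq_continuous_within)
  have pair: "continuous_on UNIV (\<lambda>t. (s, t) :: real \<times> real)" for s by (intro continuous_intros)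
  have "continuous_on UNIV (fc s)" for s unfolding fc_def
    by (intro continuous_on_inner continuous_on_compose2[OF cat.cont(1) pair] continuous_on_compose2[OF c\<theta>]
        continuous_on_compose2[OF cat.cont_\<phi> pair]) auto
  moreover have "continuous_on UNIV (fa s)" for s unfolding fa_def
    by (intro continuous_on_inner continuous_on_compose2[OF ann.cont(1) pair] continuous_on_compose2[OF c\<theta>]
        continuous_on_compose2[OF ann.cont_\<phi> pair]) auto
  ultimately have int: "set_integrable lborel {0<..<2 * pi} (\<lambda>t. fc L t - fc 0 t)"
    "set_integrable lborel {0<..<2 * pi} (\<lambda>t. fa (ln R) t - fa (ln \<epsilon>) t)"
    by (intro set_integrable_Ioo continuous_on_diff; simp)+
  have bound: "\<bar>(fc L t - fc 0 t) - (fa (ln R) t - fa (ln \<epsilon>) t)\<bar> \<le> 4 * \<epsilon>" for t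
  proof -
    have cs: "\<bar>x \<bullet> \<theta> y\<bar> \<le> norm x" for x y
      using Cauchy_Schwarz_ineq2[of x "\<theta> y"] mult_left_mono[OF \<theta>1[of y], of "norm x"] by simp
    have 1: "\<bar>fc 0 t\<bar> \<le> \<epsilon>" using cs[of "cat.\<phi>s (0, t)" "cat.\<phi> (0, t)"] \<epsilon> by (simp add: fc_def cat.norm_s)
    have 2: "\<bar>fa (ln \<epsilon>) t\<bar> \<le> \<epsilon>" using cs[of "ann.\<phi>s (ln \<epsilon>, t)" "ann.\<phi> (ln \<epsilon>, t)"] \<epsilon> by (simp add: fa_def ann.norm_s)
    have "cat.\<phi> (L, t) = ann.\<phi> (ln R, t)" using R_pos by (simp add: cat.\<phi>_def ann.\<phi>_def R_def)
    then have "fc L t - fa (ln R) t = (cat.\<phi>s (L, t) - ann.\<phi>s (ln R, t)) \<bullet> \<theta> (cat.\<phi> (L, t))"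
      by (simp add: fc_def fa_def inner_diff_left)
    also have "\<bar>\<dots>\<bar> \<le> norm (cat.\<phi>s (L, t) - ann.\<phi>s (ln R, t))" by (rule cs)
    also have "\<dots> \<le> 2 * \<epsilon>"
    proof -
      define \<delta> where "\<delta> = \<epsilon> * sinh L - R"
      have "\<bar>\<delta>\<bar> \<le> \<epsilon>"
      proof -
        have "\<delta> = - (\<epsilon> * exp (- L))" by (simp add: \<delta>_def R_def sinh_field_def cosh_field_def field_simps)
        then show ?thesis using \<epsilon> L by simp
      qed
      have "norm (cat.\<phi>s (L, t) - ann.\<phi>s (ln R, t)) = sqrt ((\<delta> * cos t)\<^sup>2 + (\<delta> * sin t)\<^sup>2 + \<epsilon>\<^sup>2)"
        using R_pos by (simp add: norm_vec3 cat.\<phi>s_def ann.\<phi>s_def \<delta>_def left_diff_distrib)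
      also have "(\<delta> * cos t)\<^sup>2 + (\<delta> * sin t)\<^sup>2 + \<epsilon>\<^sup>2 = \<delta>\<^sup>2 + \<epsilon>\<^sup>2"
        by (simp add: power_mult_distrib distrib_left[symmetric])
      also have "sqrt (\<delta>\<^sup>2 + \<epsilon>\<^sup>2) \<le> \<bar>\<delta>\<bar> + \<bar>\<epsilon>\<bar>" by (rule sqrt_sum_squares_le_sum_abs)
      also have "\<dots> \<le> 2 * \<epsilon>" using \<open>\<bar>\<delta>\<bar> \<le> \<epsilon>\<close> \<epsilon> by simp
      finally show ?thesis .
    qed
    finally have 3: "\<bar>fc L t - fa (ln R) t\<bar> \<le> 2 * \<epsilon>" .
    show ?thesis using 1 2 3 by linarith
  qed
  have "(LINT t:{0<..<2 * pi}|lborel. fc L t - fc 0 t) - (LINT t:{0<..<2 * pi}|lborel. fa (ln R) t - fa (ln \<epsilon>) t)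
    = (LINT t:{0<..<2 * pi}|lborel. (fc L t - fc 0 t) - (fa (ln R) t - fa (ln \<epsilon>) t))"
    by (rule set_integral_diff(2)[OF int, symmetric])
  also have "\<bar>\<dots>\<bar> \<le> 4 * \<epsilon> * (2 * pi - 0)" by (rule abs_integral_Ioo_le[OF _ bound]) simp
  finally have "\<bar>(LINT t:{0<..<2 * pi}|lborel. fc L t - fc 0 t) - (LINT t:{0<..<2 * pi}|lborel. fa (ln R) t - fa (ln \<epsilon>) t)\<bar>
    \<le> 8 * pi * \<epsilon>" by (simp add: ac_simps)
  then have "area_const * \<bar>(LINT t:{0<..<2 * pi}|lborel. fc L t - fc 0 t) - (LINT t:{0<..<2 * pi}|lborel. fa (ln R) t - fa (ln \<epsilon>) t)\<bar>
    \<le> area_const * (8 * pi * \<epsilon>)" using area_const(1) by (intro mult_left_mono) auto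
  then show ?thesis unfolding eC eA right_diff_distrib[symmetric] using area_const(1) by (simp add: abs_mult)
qed

lemma C_lipschitz_image: "\<exists>K. K-lipschitz_on cat.strip cat.\<phi>"
proof -
  have "norm (cat.\<phi> p - cat.\<phi> q) \<le> R * norm (p - q)" if "p \<in> cat.strip" "q \<in> cat.strip" for p q
  proof (rule differentiable_bound[OF _ _ _ that(1) that(2)])
    show "convex cat.strip" by (intro convex_Times) auto
    show "(cat.\<phi> has_derivative cat.D x) (at x within cat.strip)" for x
      by (rule has_derivative_at_withinI[OF cat.deriv])
    show "onorm (cat.D x) \<le> R" if "x \<in> cat.strip" for x
    proof (rule onorm_bound)
      fix v
      have "cosh (fst x) \<le> cosh L" using that by (auto intro!: cosh_real_nonneg_le_iff[THEN iffD2])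
      then show "norm (cat.D x v) \<le> R * norm v" unfolding cat.norm_D R_def
        using \<epsilon> by (intro mult_right_mono) auto
    qed (use R_pos in simp)
  qed
  then show ?thesis using R_pos by (intro exI[of _ R] lipschitz_onI) (auto simp: dist_norm)
qed

end

section \<open>A flat square with annuli replaced by half catenoids\<close>

definition open_square :: "(real \<times> real) set" where "open_square = {0<..<1} \<times> {0<..<1}"

lemma open_open_square: "open open_square" by (simp add: open_square_def open_Times)

lemma sets_open_square [measurable]: "open_square \<in> sets borel" using open_open_square by simp

lemma emeasure_open_square: "emeasure lborel open_square = 1"
  using emeasure_strip[of 0 1 0 1] by (simp add: open_square_def)

interpretation square: harmonic_strip 0 1 0 1 flat "\<lambda>_. axis 1 1" "\<lambda>_. axis 2 1" "\<lambda>_. 1" "\<lambda>_. 0"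
proof
  show "inj_on flat ({0<..<1} \<times> {0<..<1})" using flat.inj by (rule inj_on_subset) simp
qed (auto simp: open_Times flat.deriv inner_axis_axis norm_axis_1)

lemma test_field_integrand_bounded:
  fixes \<theta> :: "real^3 \<Rightarrow> real^3"
  assumes "\<theta> \<in> test_fields"
  shows "\<exists>B. \<forall>m z. \<bar>hom_inner (hyper_proj m) (jacobian \<theta> (at z))\<bar> \<le> B"
proof -
  obtain B where B: "\<And>z i j. \<bar>jacobian \<theta> (at z) $ i $ j\<bar> \<le> B" using test_field_jacobian_bounded[OF assms] by blast
  have "\<bar>hom_inner (hyper_proj m) (jacobian \<theta> (at z))\<bar> \<le> (\<Sum>i\<in>(UNIV :: 3 set). \<Sum>j\<in>(UNIV :: 3 set). 2 * B)" for m z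
    unfolding hom_inner_sum
    by (intro order_trans[OF sum_abs] sum_mono) (auto simp: abs_mult intro!: mult_mono abs_hyper_proj_le B)
  then show ?thesis by blast
qed

lemma test_field_integrand_measurable:
  fixes \<theta> :: "real^3 \<Rightarrow> real^3"
  assumes "\<theta> \<in> test_fields" and [measurable]: "n \<in> borel_measurable borel"
  shows "(\<lambda>z. hom_inner (hyper_proj (n z)) (jacobian \<theta> (at z))) \<in> borel_measurable borel"
proof -
  have [measurable]: "(\<lambda>z. jacobian \<theta> (at z)) \<in> borel_measurable borel"
    by (intro borel_measurable_continuous_onI test_field_deriv assms)
  show ?thesis unfolding hom_inner_sum
    by (intro borel_measurable_sum borel_measurable_times measurable_matrix_nth) measurable
qed

lemma first_variation_square:
  assumes \<theta>: "\<theta> \<in> test_fields" "\<And>x. norm (\<theta> x) \<le> 1"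
  shows "\<bar>LINT z:flat ` open_square|hausdorff_measure 2. hom_inner (hyper_proj e3) (jacobian \<theta> (at z))\<bar> \<le> area_const * 4"
proof -
  define f1 where "f1 t = axis 1 1 \<bullet> \<theta> (flat (1, t)) - axis 1 1 \<bullet> \<theta> (flat (0, t))" for t
  define f2 where "f2 s = axis 2 1 \<bullet> \<theta> (flat (s, 1)) - axis 2 1 \<bullet> \<theta> (flat (s, 0))" for s
  have proj: "(1::real)\<^sup>2 * hyper_proj e3 $ i $ j = axis 1 1 $ i * axis 1 1 $ j + axis 2 1 $ i * axis 2 1 $ j" for i j :: 3
    unfolding hyper_proj_e3 using exhaust_3[of i] exhaust_3[of j] by (elim disjE) (simp_all add: axis_def)
  have eq: "(LINT z:flat ` open_square|hausdorff_measure 2. hom_inner (hyper_proj e3) (jacobian \<theta> (at z))) =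
    area_const * ((LINT t:{0<..<1}|lborel. f1 t) + (LINT s:{0<..<1}|lborel. f2 s))"
    unfolding open_square_def f1_def f2_def
    by (rule square.first_variation_strip[OF \<theta>(1), of "\<lambda>_. e3"]) (use proj in auto)
  have cs: "\<bar>axis i 1 \<bullet> \<theta> y\<bar> \<le> 1" for i y
    using component_le_norm_cart[of "\<theta> y" i] \<theta>(2)[of y] by (simp add: inner_axis')
  have b1: "\<bar>f1 t\<bar> \<le> 2" for t
    using cs[of 1 "flat (1, t)"] cs[of 1 "flat (0, t)"] unfolding f1_def by linarith
  have b2: "\<bar>f2 s\<bar> \<le> 2" for s
    using cs[of 2 "flat (s, 1)"] cs[of 2 "flat (s, 0)"] unfolding f2_def by linarith
  have "\<bar>LINT t:{0<..<1}|lborel. f1 t\<bar> \<le> 2 * (1 - 0)" by (rule abs_integral_Ioo_le[OF _ b1]) simp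
  moreover have "\<bar>LINT t:{0<..<1}|lborel. f2 t\<bar> \<le> 2 * (1 - 0)" by (rule abs_integral_Ioo_le[OF _ b2]) simp
  moreover have "\<bar>x + y\<bar> \<le> 4" if "\<bar>x\<bar> \<le> 2 * (1 - 0)" "\<bar>y\<bar> \<le> 2 * (1 - 0)" for x y :: real
  proof -
    have "\<bar>x + y\<bar> \<le> \<bar>x\<bar> + \<bar>y\<bar>" by (rule abs_triangle_ineq)
    also have "\<dots> \<le> 2 + 2" using that by (intro add_mono) simp_all
    finally show ?thesis by simp
  qed
  ultimately have "\<bar>(LINT t:{0<..<1}|lborel. f1 t) + (LINT s:{0<..<1}|lborel. f2 s)\<bar> \<le> 4" by blast
  then show ?thesis unfolding eq abs_mult using area_const(1) by (simp add: mult_left_mono)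
qed

text \<open>Summability of \<open>\<epsilon>\<close> controls the first variation and summability of
  the squared radii the area. Disjointness is required of the disks in the plane, over which the
  hats lie.\<close>

locale hats =
  fixes J :: "nat set" and a :: "nat \<Rightarrow> real \<times> real" and \<epsilon> L :: "nat \<Rightarrow> real"
  assumes hat: "\<And>j. j \<in> J \<Longrightarrow> hat (\<epsilon> j) (L j)"
    and inside: "\<And>j. j \<in> J \<Longrightarrow> ball (a j) (hat.R (\<epsilon> j) (L j)) \<subseteq> open_square"
    and disj: "\<And>i j. i \<in> J \<Longrightarrow> j \<in> J \<Longrightarrow> i \<noteq> j \<Longrightarrow>
      ball (a i) (hat.R (\<epsilon> i) (L i)) \<inter> ball (a j) (hat.R (\<epsilon> j) (L j)) = {}"
    and sum_\<epsilon>: "summable (\<lambda>j. if j \<in> J then \<epsilon> j else 0)"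
    and sum_R: "summable (\<lambda>j. if j \<in> J then (hat.R (\<epsilon> j) (L j))\<^sup>2 else 0)"
begin

abbreviation H :: "(real^3) measure" where "H \<equiv> hausdorff_measure 2"

definition C :: "nat \<Rightarrow> (real^3) set" where "C j = (if j \<in> J then hat.C (a j) (\<epsilon> j) (L j) else {})"
definition A :: "nat \<Rightarrow> (real^3) set" where "A j = (if j \<in> J then hat.A (a j) (\<epsilon> j) (L j) else {})"
definition N :: "nat \<Rightarrow> real^3 \<Rightarrow> real^3" where "N j = hat.N (a j) (\<epsilon> j) (L j)"
abbreviation R :: "nat \<Rightarrow> real" where "R j \<equiv> hat.R (\<epsilon> j) (L j)"
definition Q :: "(real^3) set" where "Q = flat ` open_square"
text \<open>Only the open slit annuli \<open>A j\<close> are removed: the inner disks and the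
  boundary circles remain, and so do the missing meridians, which are null.\<close>

definition E :: "(real^3) set" where "E = (Q - (\<Union>j. A j)) \<union> (\<Union>j. C j)"
definition n :: "real^3 \<Rightarrow> real^3" where
  "n z = (if \<exists>j. z \<in> C j then N (THE j. z \<in> C j) z else e3)"
definition holes :: "(real \<times> real) set" where "holes = flat -` (\<Union>j. A j)"
definition \<mu> :: "(real^3) measure" where "\<mu> = density H (indicator E)"

lemma in_C: "z \<in> C j \<longleftrightarrow> j \<in> J \<and> z \<in> hat.C (a j) (\<epsilon> j) (L j)" by (simp add: C_def)
lemma in_A: "z \<in> A j \<longleftrightarrow> j \<in> J \<and> z \<in> hat.A (a j) (\<epsilon> j) (L j)" by (simp add: A_def)

lemma C_bounds:
  assumes "z \<in> C j" shows "z $ 3 < 0" "- R j < z $ 3" "shadow z \<in> ball (a j) (R j)"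
proof -
  have j: "j \<in> J" "z \<in> hat.C (a j) (\<epsilon> j) (L j)" using assms by (simp_all add: in_C)
  show "z $ 3 < 0" "- R j < z $ 3" by (rule hat.C_bounds[OF hat[OF j(1)] j(2)])+
  show "shadow z \<in> ball (a j) (R j)" unfolding mem_ball by (rule hat.C_bounds[OF hat[OF j(1)] j(2)])
qed

lemma A_bounds:
  assumes "z \<in> A j" shows "z $ 3 = 0" "shadow z \<in> ball (a j) (R j)"
proof -
  have j: "j \<in> J" "z \<in> hat.A (a j) (\<epsilon> j) (L j)" using assms by (simp_all add: in_A)
  show "z $ 3 = 0" by (rule hat.A_bounds[OF hat[OF j(1)] j(2)])
  show "shadow z \<in> ball (a j) (R j)" unfolding mem_ball by (rule hat.A_bounds[OF hat[OF j(1)] j(2)])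
qed

lemma sets_CA [measurable]: "C j \<in> sets borel" "A j \<in> sets borel"
  using hat.sets_C[OF hat] hat.sets_A[OF hat] by (auto simp: C_def A_def)

lemma C_disj: "z \<in> C i \<Longrightarrow> z \<in> C j \<Longrightarrow> i = j"
  using C_bounds(3)[of z i] C_bounds(3)[of z j] disj[of i j] in_C by blast

lemma A_disj: "z \<in> A i \<Longrightarrow> z \<in> A j \<Longrightarrow> i = j"
  using A_bounds(2)[of z i] A_bounds(2)[of z j] disj[of i j] in_A by blast

lemma in_Q: "z \<in> Q \<longleftrightarrow> z $ 3 = 0 \<and> shadow z \<in> open_square"
  unfolding Q_def flat_image_eq by auto

lemma A_Q: "A j \<subseteq> Q"
proof
  fix z assume z: "z \<in> A j"
  then have "j \<in> J" by (simp add: in_A)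
  then show "z \<in> Q" using A_bounds[OF z] inside in_Q by blast
qed

lemma C_Q: "z \<in> C j \<Longrightarrow> z \<notin> Q"
  using C_bounds(1)[of z j] by (auto simp: in_Q)

lemma sets_Q [measurable]: "Q \<in> sets borel" unfolding Q_def by (rule sets_flat_image) simp

lemma sets_E [measurable]: "E \<in> sets borel" unfolding E_def by measurable

lemma n_C: "z \<in> C j \<Longrightarrow> n z = N j z"
proof -
  assume z: "z \<in> C j"
  then have "(THE j. z \<in> C j) = j" using C_disj by (intro the_equality) auto
  then show ?thesis using z by (auto simp: n_def)
qed

lemma n_else: "(\<And>j. z \<notin> C j) \<Longrightarrow> n z = e3"
  by (simp add: n_def)

lemma n_nz: "n z \<noteq> 0"
proof (cases "\<exists>j. z \<in> C j")
  case True
  then obtain j where j: "z \<in> C j" by blast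
  then have "N j z \<noteq> 0" unfolding N_def using hat.N_nz[OF hat] in_C by blast
  then show ?thesis using n_C[OF j] by simp
qed (simp add: n_def axis_eq_0_iff)

lemma measurable_N [measurable]: "j \<in> J \<Longrightarrow> N j \<in> borel_measurable borel"
  unfolding N_def by (rule hat.measurable_N[OF hat])

lemma measurable_n [measurable]: "n \<in> borel_measurable borel"
proof (rule borel_measurableI)
  fix S :: "(real^3) set" assume S: "open S"
  have eq: "n -` S = (\<Union>j. C j \<inter> N j -` S) \<union> ((- (\<Union>j. C j)) \<inter> (if e3 \<in> S then UNIV else {}))"
  proof (intro set_eqI)
    fix z
    show "z \<in> n -` S \<longleftrightarrow> z \<in> (\<Union>j. C j \<inter> N j -` S) \<union> ((- (\<Union>j. C j)) \<inter> (if e3 \<in> S then UNIV else {}))"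
    proof (cases "\<exists>j. z \<in> C j")
      case True
      then obtain j where j: "z \<in> C j" by blast
      have u: "z \<in> C i \<longleftrightarrow> i = j" for i using C_disj[OF j, of i] j by blast
      show ?thesis by (simp add: u n_C[OF j])
    qed (use n_else[of z] in auto)
  qed
  have "C j \<inter> N j -` S \<in> sets borel" for j
  proof (cases "j \<in> J")
    case True
    then show ?thesis using measurable_sets[OF measurable_N[OF True], of S] S by auto
  qed (simp add: C_def)
  then have "n -` S \<in> sets borel" unfolding eq by (intro sets.Un sets.Int sets.countable_UN borel_comp) auto
  then show "n -` S \<inter> space borel \<in> sets borel" by simp
qed

lemma emeasure_Q: "emeasure H Q = ennreal area_const"
  using hausdorff_flat[of open_square] by (simp add: emeasure_hausdorff_measure Q_def emeasure_open_square)

lemma emeasure_UC: "emeasure H (\<Union>j. C j) < \<infinity>"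
proof -
  let ?r = "\<lambda>j. if j \<in> J then (R j)\<^sup>2 else 0"
  have s: "summable (\<lambda>j. area_const * (2 * pi * ?r j))" by (intro summable_mult sum_R)
  have "emeasure H (\<Union>j. C j) \<le> (\<Sum>j. emeasure H (C j))" by (intro emeasure_subadditive_countably) auto
  also have "\<dots> \<le> (\<Sum>j. ennreal (area_const * (2 * pi * ?r j)))"
    using hat.emeasure_C_le[OF hat] by (intro suminf_le summableI) (auto simp: C_def)
  also have "\<dots> = ennreal (\<Sum>j. area_const * (2 * pi * ?r j))"
    using area_const(1) by (intro suminf_ennreal2 s) auto
  finally show ?thesis by (simp add: le_less_trans)
qed

lemma emeasure_E: "emeasure H E < \<infinity>"
proof -
  have "emeasure H E \<le> emeasure H (Q \<union> (\<Union>j. C j))" by (intro emeasure_mono) (auto simp: E_def)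
  also have "\<dots> \<le> emeasure H Q + emeasure H (\<Union>j. C j)" by (intro emeasure_subadditive) auto
  also have "\<dots> < \<infinity>" using emeasure_UC by (simp add: emeasure_Q)
  finally show ?thesis .
qed

lemma sets_\<mu> [simp]: "sets \<mu> = sets borel" by (simp add: \<mu>_def)

lemma emeasure_\<mu>: "B \<in> sets borel \<Longrightarrow> emeasure \<mu> B = emeasure H (E \<inter> B)"
  unfolding \<mu>_def
  by (subst emeasure_density)
     (auto simp: nn_integral_indicator[symmetric] indicator_inter_arith simp del: nn_integral_indicator)

lemma finite_measure_\<mu>: "finite_measure \<mu>"
proof (rule finite_measureI)
  have "space \<mu> = UNIV" by (simp add: \<mu>_def)
  then show "emeasure \<mu> (space \<mu>) \<noteq> \<infinity>" using emeasure_E by (simp add: emeasure_\<mu>)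
qed

sublocale normal_field \<mu> n
  by (rule normal_field.intro[OF sets_\<mu> finite_measure_\<mu> measurable_n n_nz])

lemma set_integrable_bounded:
  fixes f :: "real^3 \<Rightarrow> real"
  assumes "f \<in> borel_measurable borel" "\<And>z. \<bar>f z\<bar> \<le> B" "S \<in> sets borel" "emeasure H S < \<infinity>"
  shows "set_integrable H S f"
  unfolding set_integrable_def
  by (rule integrableI_bounded_set_indicator[where B=B]) (use assms in auto)

text \<open>The integral over \<open>E\<close> is that over the full square plus, for every hat, the
  difference between \<open>C j\<close> and \<open>A j\<close>. The first is bounded by
  \<open>first_variation_square\<close>, each difference by
  \<open>first_variation_hat\<close>.\<close>

lemma first_variation_bound:
  assumes \<theta>: "\<theta> \<in> test_fields" "\<And>x. norm (\<theta> x) \<le> 1"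
  shows "first_variation V \<theta> \<le> area_const * 4 + (\<Sum>j. area_const * (8 * pi * (if j \<in> J then \<epsilon> j else 0)))"
proof -
  define g where "g z = hom_inner (hyper_proj (n z)) (jacobian \<theta> (at z))" for z
  define g0 where "g0 z = hom_inner (hyper_proj e3) (jacobian \<theta> (at z))" for z
  obtain B where B: "\<And>m z. \<bar>hom_inner (hyper_proj m) (jacobian \<theta> (at z))\<bar> \<le> B"
    using test_field_integrand_bounded[OF \<theta>(1)] by blast
  have gm[measurable]: "g \<in> borel_measurable borel" "g0 \<in> borel_measurable borel"
    unfolding g_def g0_def by (intro test_field_integrand_measurable \<theta>; simp)+
  have gB: "\<bar>g z\<bar> \<le> B" "\<bar>g0 z\<bar> \<le> B" for z using B by (auto simp: g_def g0_def)
  \<comment> \<open>One signed integrand for both pieces of a hat: it counts \<open>C j\<close>,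
    where \<open>z $ 3 < 0\<close>, positively and \<open>A j\<close>, where
    \<open>z $ 3 = 0\<close>, negatively.\<close>
  define f where "f z = (if z $ 3 < 0 then g z else - g0 z)" for z :: "real^3"
  have fB: "\<bar>f z\<bar> \<le> B" for z using gB by (simp add: f_def)
  have fm[measurable]: "f \<in> borel_measurable borel" unfolding f_def
    by (intro measurable_If gm borel_measurable_uminus) (auto intro!: borel_open open_Collect_less continuous_intros)
  define W where "W j = A j \<union> C j" for j
  have Wm: "W j \<in> sets borel" for j unfolding W_def by simp
  have Wdisj: "W i \<inter> W j = {}" if "i \<noteq> j" for i j
    using that A_disj C_disj A_Q C_Q unfolding W_def by blast
  have finU: "emeasure H (\<Union>j. W j) < \<infinity>"
  proof -
    have "emeasure H (\<Union>j. W j) \<le> emeasure H (Q \<union> (\<Union>j. C j))"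
      by (intro emeasure_mono) (use A_Q in \<open>auto simp: W_def\<close>)
    also have "\<dots> \<le> emeasure H Q + emeasure H (\<Union>j. C j)" by (intro emeasure_subadditive) auto
    also have "\<dots> < \<infinity>" using emeasure_UC by (simp add: emeasure_Q)
    finally show ?thesis .
  qed
  have finW: "emeasure H S < \<infinity>" if "S \<subseteq> (\<Union>j. W j)" for S
    using emeasure_mono[OF that, of H] finU Wm by (simp add: le_less_trans sets.countable_UN)
  have iQ: "set_integrable H Q g0" by (rule set_integrable_bounded[OF gm(2) gB(2)]) (auto simp: emeasure_Q)
  have UWm: "(\<Union>j. W j) \<in> sets borel" using Wm by (intro sets.countable_UN) auto
  have iW: "set_integrable H (\<Union>j. W j) f" by (rule set_integrable_bounded[OF fm fB UWm finU])
  have "first_variation V \<theta> = (\<integral>z. g z \<partial>\<mu>)" using first_variation_V[OF \<theta>(1)] by (simp add: g_def)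
  also have "\<dots> = (\<integral>z. indicator E z *\<^sub>R g z \<partial>H)"
  proof -
    have ind: "indicator E = (\<lambda>z. ennreal (indicat_real E z))" by (auto simp: indicator_def)
    show ?thesis unfolding \<mu>_def ind by (subst integral_density) auto
  qed
  also have "\<dots> = (\<integral>z. indicator Q z *\<^sub>R g0 z + indicator (\<Union>j. W j) z *\<^sub>R f z \<partial>H)"
  proof (rule Bochner_Integration.integral_cong[OF refl])
    fix z
    show "indicator E z *\<^sub>R g z = indicator Q z *\<^sub>R g0 z + indicator (\<Union>j. W j) z *\<^sub>R f z"
    proof (cases "\<exists>j. z \<in> C j")
      case True
      then obtain j where j: "z \<in> C j" by blast
      then have "z \<in> E" "z \<notin> Q" "z \<in> (\<Union>j. W j)" "z $ 3 < 0" using C_Q C_bounds(1) by (auto simp: E_def W_def)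
      then show ?thesis by (simp add: f_def indicator_def)
    next
      case False
      then have nz: "n z = e3" by (intro n_else) auto
      show ?thesis
      proof (cases "\<exists>j. z \<in> A j")
        case True
        then obtain j where j: "z \<in> A j" by blast
        then have "z \<notin> E" "z \<in> Q" "z \<in> (\<Union>j. W j)" "z $ 3 = 0"
          using A_Q A_bounds(1) False by (auto simp: E_def W_def)
        then show ?thesis by (simp add: f_def indicator_def)
      next
        case no: False
        then have "z \<notin> (\<Union>j. W j)" "z \<in> E \<longleftrightarrow> z \<in> Q" using False by (auto simp: E_def W_def)
        then show ?thesis using nz by (simp add: indicator_def g_def g0_def)
      qed
    qed
  qed
  also have "\<dots> = (LINT z:Q|H. g0 z) + (LINT z:(\<Union>j. W j)|H. f z)"
    unfolding set_lebesgue_integral_def using iQ iW by (intro Bochner_Integration.integral_add) (auto simp: set_integrable_def)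
  also have "(LINT z:(\<Union>j. W j)|H. f z) = (\<Sum>j. (LINT z:W j|H. f z))"
    by (rule lebesgue_integral_countable_add[OF _ Wdisj iW]) (simp add: Wm)
  finally have fv: "first_variation V \<theta> = (LINT z:Q|H. g0 z) + (\<Sum>j. (LINT z:W j|H. f z))" .
  have dj: "norm (LINT z:W j|H. f z) \<le> area_const * (8 * pi * (if j \<in> J then \<epsilon> j else 0))" for j
  proof (cases "j \<in> J")
    case True
    note hj = hat[OF True]
    have iA: "set_integrable H (A j) f" and iC: "set_integrable H (C j) f"
      by (rule set_integrable_bounded[OF fm fB]; use finW in \<open>auto simp: W_def\<close>)+
    have "(LINT z:W j|H. f z) = (LINT z:A j|H. f z) + (LINT z:C j|H. f z)"
      unfolding W_def by (rule set_integral_Un[OF _ iA iC]) (use A_Q C_Q in blast)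
    also have "(LINT z:A j|H. f z) = (LINT z:A j|H. - g0 z)"
      by (rule set_lebesgue_integral_cong) (auto simp: f_def A_bounds)
    also have "\<dots> = - (LINT z:A j|H. g0 z)" by (simp add: set_lebesgue_integral_def)
    also have "(LINT z:A j|H. g0 z) = (LINT z:hat.A (a j) (\<epsilon> j) (L j)|H. hom_inner (hyper_proj e3) (jacobian \<theta> (at z)))"
      using True by (simp add: A_def g0_def)
    also have "(LINT z:C j|H. f z) = (LINT z:hat.C (a j) (\<epsilon> j) (L j)|H. hom_inner (hyper_proj (hat.N (a j) (\<epsilon> j) (L j) z)) (jacobian \<theta> (at z)))"
    proof -
      have "(LINT z:C j|H. f z) = (LINT z:C j|H. hom_inner (hyper_proj (N j z)) (jacobian \<theta> (at z)))"
        by (rule set_lebesgue_integral_cong) (auto simp: f_def C_bounds g_def n_C)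
      then show ?thesis using True by (simp add: C_def N_def)
    qed
    finally show ?thesis using hat.first_variation_hat[OF hj \<theta>, of "a j"] True by (simp add: algebra_simps)
  qed (simp add: W_def A_def C_def set_lebesgue_integral_def)
  have s: "summable (\<lambda>j. area_const * (8 * pi * (if j \<in> J then \<epsilon> j else 0)))" by (intro summable_mult sum_\<epsilon>)
  have "norm (\<Sum>j. (LINT z:W j|H. f z)) \<le> (\<Sum>j. area_const * (8 * pi * (if j \<in> J then \<epsilon> j else 0)))"
    by (rule norm_suminf_le[OF dj s])
  moreover have "\<bar>LINT z:Q|H. g0 z\<bar> \<le> area_const * 4"
    unfolding Q_def g0_def by (rule first_variation_square[OF \<theta>])
  ultimately show ?thesis unfolding fv real_norm_def by linarith
qed

lemma representable_V: "first_variation_representable V"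
  by (rule first_variation_representableI[OF first_variation_add first_variation_bound])

end

section \<open>Approximate tangent planes of the assembled surface\<close>

context hats
begin

lemma sets_holes [measurable]: "holes \<in> sets borel"
  unfolding holes_def using measurable_sets[OF measurable_flat, of "\<Union>j. A j"] by simp

lemma holes_subset: "holes \<subseteq> open_square"
proof
  fix x assume "x \<in> holes"
  then obtain j where "flat x \<in> A j" by (auto simp: holes_def)
  then have "flat x \<in> Q" using A_Q by blast
  then show "x \<in> open_square" by (simp add: in_Q)
qed

lemma flat_in_E: "flat x \<in> E \<longleftrightarrow> x \<in> open_square - holes"
proof -
  have "flat x \<notin> C j" for j using C_bounds(1)[of "flat x" j] by auto
  then show ?thesis by (auto simp: E_def in_Q holes_def)
qed

lemma shadow_C_holes: "z \<in> C j \<Longrightarrow> shadow z \<in> holes"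
proof -
  assume z: "z \<in> C j"
  then have j: "j \<in> J" "z \<in> hat.C (a j) (\<epsilon> j) (L j)" by (simp_all add: in_C)
  then have "shadow z \<in> shadow ` hat.A (a j) (\<epsilon> j) (L j)" using hat.shadow_C[OF hat[OF j(1)], of "a j"] by blast
  then obtain y where y: "y \<in> A j" "shadow z = shadow y" using j(1) by (auto simp: in_A)
  then have "flat (shadow z) = y" using A_bounds(1)[OF y(1)] by (simp add: vec_eq_iff forall_3 shadow_def)
  then show ?thesis using y(1) unfolding holes_def by blast
qed

lemma E_cases:
  assumes "z \<in> E"
  obtains (C) j where "z \<in> C j" | (flat) x where "z = flat x" "x \<in> open_square - holes"
proof (cases "\<exists>j. z \<in> C j")
  case False
  then have "z \<in> Q" using assms by (auto simp: E_def)
  then obtain x where "z = flat x" unfolding Q_def by blast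
  then show thesis using assms flat_in_E that(2) by blast
qed (use that(1) in blast)

text \<open>Near a point strictly below the plane only one hat is present. So \<open>C j\<close> is
  an admissible \<open>S\<close> and bounds the cone from above, while its lower density bounds the
  cone from below.\<close>

lemma tangent_C:
  assumes z: "z \<in> C j"
  shows "approx_tangent_cone 2 \<mu> z = hyperplane (N j z)"
proof
  have j: "j \<in> J" "z \<in> hat.C (a j) (\<epsilon> j) (L j)" using z by (simp_all add: in_C)
  have Cj: "C j = hat.C (a j) (\<epsilon> j) (L j)" using j by (simp add: C_def)
  \<comment> \<open>Within this distance of \<open>z\<close>, points remain below the plane and over
    the disk of hat \<open>j\<close>.\<close>
  define r0 where "r0 = min (- z $ 3) (R j - dist (a j) (shadow z))"
  have r0: "0 < r0" using C_bounds[OF z] by (simp add: r0_def)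
  have loc: "cball z r \<inter> E \<subseteq> C j" if r: "r < r0" for r
  proof
    fix y assume y: "y \<in> cball z r \<inter> E"
    have d: "dist z y \<le> r" using y by simp
    have "\<bar>z $ 3 - y $ 3\<bar> \<le> dist z y"
      using component_le_norm_cart[of "z - y" 3] by (simp add: dist_norm)
    then have "y $ 3 - z $ 3 \<le> dist z y" by (simp add: abs_le_iff)
    moreover have "r < - z $ 3" using r by (simp add: r0_def)
    ultimately have y3: "y $ 3 < 0" using d by linarith
    have "dist (a j) (shadow y) \<le> dist (a j) (shadow z) + dist z y"
      using dist_triangle[of "a j" "shadow y" "shadow z"] dist_shadow_le[of z y] by linarith
    then have yb: "shadow y \<in> ball (a j) (R j)" using d r by (simp add: r0_def)
    have "y \<in> E" using y by simp
    then show "y \<in> C j"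
    proof (cases rule: E_cases)
      case (C k)
      have "k = j" using disj[of k j] C_bounds(3)[OF C] yb j(1) in_C[of y k] C by blast
      then show ?thesis using C by simp
    qed (use y3 in simp)
  qed
  have "has_density 2 (\<lambda>B. outer_measure_of \<mu> (B \<inter> (UNIV - C j))) z 0"
    unfolding has_density_def
  proof (rule tendsto_eventually)
    have "outer_measure_of \<mu> (cball z r \<inter> (UNIV - C j)) = 0" if "r < r0" for r
    proof -
      have "outer_measure_of \<mu> (cball z r \<inter> (UNIV - C j)) = emeasure H (E \<inter> (cball z r \<inter> (UNIV - C j)))"
        by (subst outer_measure_of_eq) (auto simp: emeasure_\<mu>)
      also have "E \<inter> (cball z r \<inter> (UNIV - C j)) = {}" using loc[OF that] by blast
      finally show ?thesis by simp
    qed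
    then show "\<forall>\<^sub>F r in at_right 0. outer_measure_of \<mu> (cball z r \<inter> (UNIV - C j)) / ennreal (unit_ball_vol (real 2) * r ^ 2) = 0"
      unfolding eventually_at_right_field using r0 by (intro exI[of _ r0]) auto
  qed
  then have "approx_tangent_cone 2 \<mu> z \<subseteq> tangent_cone (C j) z"
    unfolding approx_tangent_cone_def by (intro Inter_lower) blast
  also have "\<dots> \<subseteq> hyperplane (N j z)"
    unfolding Cj N_def by (rule hat.tangent_C[OF hat[OF j(1)] j(2)])
  finally show "approx_tangent_cone 2 \<mu> z \<subseteq> hyperplane (N j z)" .
  show "hyperplane (N j z) \<subseteq> approx_tangent_cone 2 \<mu> z"
  proof
    fix v assume v: "v \<in> hyperplane (N j z)"
    show "v \<in> approx_tangent_cone 2 \<mu> z"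
    proof (rule approx_tangent_coneI[OF sets_\<mu>])
      fix e :: real assume e: "0 < e"
      obtain c R' where cR: "0 < c" "0 < R'" "\<And>r. 0 < r \<Longrightarrow> r < R' \<Longrightarrow>
        \<exists>Y\<in>sets borel. Y \<subseteq> C j \<and> (\<forall>y\<in>Y. norm (y - z - r *\<^sub>R v) < e * r) \<and> ennreal (c * r\<^sup>2) \<le> emeasure H Y"
        using hat.lower_density_C[OF hat[OF j(1)] j(2) v[unfolded N_def] e] unfolding Cj by blast
      have "\<exists>Y\<in>sets borel. (\<forall>y\<in>Y. norm (y - z - r *\<^sub>R v) < e * r) \<and> ennreal (c * r\<^sup>2) \<le> emeasure \<mu> Y"
        if r: "0 < r" "r < R'" for r
      proof -
        obtain Y where Y: "Y \<in> sets borel" "Y \<subseteq> C j" "\<forall>y\<in>Y. norm (y - z - r *\<^sub>R v) < e * r" "ennreal (c * r\<^sup>2) \<le> emeasure H Y"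
          using cR(3)[OF r] by blast
        have "E \<inter> Y = Y" using Y(2) by (auto simp: E_def)
        then show ?thesis using Y by (intro bexI[OF _ Y(1)]) (simp add: emeasure_\<mu>)
      qed
      then show "\<exists>c>0. \<exists>R>0. \<forall>r. 0 < r \<and> r < R \<longrightarrow>
        (\<exists>Y\<in>sets borel. (\<forall>y\<in>Y. norm (y - z - r *\<^sub>R v) < e * r) \<and> ennreal (c * r\<^sup>2) \<le> emeasure \<mu> Y)"
        using cR(1,2) by blast
    qed
  qed
qed

definition hole_measure :: "(real \<times> real) measure" where
  "hole_measure = density lborel (indicator holes)"

text \<open>Projected to the plane, the catenoids become accessible to
  \<open>null_set_density\<close>: by \<open>shadow_C_holes\<close> their image measure vanishes on
  the flat part.\<close>

definition catenoid_shadow :: "(real \<times> real) measure" where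
  "catenoid_shadow = distr (density H (indicator (\<Union>j. C j))) borel shadow"

lemma emeasure_hole_measure: "B \<in> sets borel \<Longrightarrow> emeasure hole_measure B = emeasure lborel (holes \<inter> B)"
  unfolding hole_measure_def
  by (subst emeasure_density)
     (auto simp: nn_integral_indicator[symmetric] indicator_inter_arith simp del: nn_integral_indicator)

lemma emeasure_catenoid_shadow:
  assumes [measurable]: "B \<in> sets borel"
  shows "emeasure catenoid_shadow B = emeasure H ((\<Union>j. C j) \<inter> shadow -` B)"
proof -
  have [measurable]: "shadow -` B \<in> sets borel" using measurable_sets[OF measurable_shadow assms] by simp
  show ?thesis unfolding catenoid_shadow_def
    by (subst emeasure_distr, simp, simp, subst emeasure_density)
       (auto simp: nn_integral_indicator[symmetric] indicator_inter_arith simp del: nn_integral_indicator)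
qed

lemma finite_hole_measure: "finite_measure hole_measure"
proof (rule finite_measureI)
  have "emeasure hole_measure UNIV \<le> emeasure lborel open_square"
    using holes_subset by (simp add: emeasure_hole_measure emeasure_mono)
  then show "emeasure hole_measure (space hole_measure) \<noteq> \<infinity>"
    by (auto simp: hole_measure_def emeasure_open_square top_unique)
qed

lemma finite_catenoid_shadow: "finite_measure catenoid_shadow"
proof (rule finite_measureI)
  show "emeasure catenoid_shadow (space catenoid_shadow) \<noteq> \<infinity>"
    using emeasure_UC emeasure_catenoid_shadow[of UNIV] by (simp add: catenoid_shadow_def)
qed

text \<open>
  At such points neither the removed annuli nor the catenoids have positive density, because
  \<^const>\<open>shadow\<close> does not increase distances; hence the approximate tangent plane is horizontal.
\<close>

definition good :: "real \<times> real \<Rightarrow> bool" where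
  "good x \<longleftrightarrow> ((\<lambda>r. measure hole_measure (cball x r) / r\<^sup>2) \<longlongrightarrow> 0) (at_right 0) \<and>
     ((\<lambda>r. measure catenoid_shadow (cball x r) / r\<^sup>2) \<longlongrightarrow> 0) (at_right 0)"

lemma AE_good: "AE x in lborel. x \<in> open_square - holes \<longrightarrow> good x"
proof -
  have B: "open_square - holes \<in> sets borel" by measurable
  have n1: "emeasure hole_measure (open_square - holes) = 0"
  proof -
    have "holes \<inter> (open_square - holes) = {}" by blast
    then show ?thesis by (simp only: emeasure_hole_measure[OF B]) simp
  qed
  have n2: "emeasure catenoid_shadow (open_square - holes) = 0"
  proof -
    have "(\<Union>j. C j) \<inter> shadow -` (open_square - holes) = {}" using shadow_C_holes by blast
    then show ?thesis by (simp only: emeasure_catenoid_shadow[OF B]) simp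
  qed
  have dim: "DIM(real \<times> real) = 2" by simp
  have "AE x in lborel. x \<in> open_square - holes \<longrightarrow> ((\<lambda>r. measure hole_measure (cball x r) / r\<^sup>2) \<longlongrightarrow> 0) (at_right 0)"
    by (rule null_set_density[OF _ finite_hole_measure B n1, unfolded dim]) (simp add: hole_measure_def)
  moreover have "AE x in lborel. x \<in> open_square - holes \<longrightarrow> ((\<lambda>r. measure catenoid_shadow (cball x r) / r\<^sup>2) \<longlongrightarrow> 0) (at_right 0)"
    by (rule null_set_density[OF _ finite_catenoid_shadow B n2, unfolded dim]) (simp add: catenoid_shadow_def)
  ultimately show ?thesis by eventually_elim (simp add: good_def)
qed

text \<open>From above, the cone is tested with \<open>S = Q\<close>, off which only catenoid mass
  is found. From below, a small horizontal disk in any horizontal direction retains a fixed share of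
  its area after the holes are removed.\<close>

lemma tangent_flat:
  assumes x: "x \<in> open_square - holes" and g: "good x"
  shows "approx_tangent_cone 2 \<mu> (flat x) = hyperplane e3"
proof
  have "has_density 2 (\<lambda>B. outer_measure_of \<mu> (B \<inter> (UNIV - Q))) (flat x) 0"
    unfolding has_density_def
  proof (rule tendsto_sandwich[of "\<lambda>_. 0"])
    have "((\<lambda>r. ennreal (measure catenoid_shadow (cball x r) / r\<^sup>2 * (1 / unit_ball_vol 2))) \<longlongrightarrow> ennreal (0 * (1 / unit_ball_vol 2))) (at_right 0)"
      using g unfolding good_def by (intro tendsto_ennrealI tendsto_mult tendsto_const) simp
    then show "((\<lambda>r. ennreal (measure catenoid_shadow (cball x r) / r\<^sup>2 * (1 / unit_ball_vol 2))) \<longlongrightarrow> 0) (at_right 0)" by simp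
    have "outer_measure_of \<mu> (cball (flat x) r \<inter> (UNIV - Q)) / ennreal (unit_ball_vol (real 2) * r\<^sup>2)
      \<le> ennreal (measure catenoid_shadow (cball x r) / r\<^sup>2 * (1 / unit_ball_vol 2))" if r: "0 < r" for r
    proof -
      have "outer_measure_of \<mu> (cball (flat x) r \<inter> (UNIV - Q)) = emeasure H (E \<inter> (cball (flat x) r \<inter> (UNIV - Q)))"
        by (subst outer_measure_of_eq) (auto simp: emeasure_\<mu>)
      also have "\<dots> \<le> emeasure H ((\<Union>j. C j) \<inter> shadow -` cball x r)"
      proof (rule emeasure_mono)
        show "E \<inter> (cball (flat x) r \<inter> (UNIV - Q)) \<subseteq> (\<Union>j. C j) \<inter> shadow -` cball x r"
        proof
          fix y assume y: "y \<in> E \<inter> (cball (flat x) r \<inter> (UNIV - Q))"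
          have "dist x (shadow y) \<le> dist (flat x) y" using dist_shadow_le[of "flat x" y] by simp
          also have "\<dots> \<le> r" using y by simp
          finally show "y \<in> (\<Union>j. C j) \<inter> shadow -` cball x r" using y by (auto simp: E_def)
        qed
        show "(\<Union>j. C j) \<inter> shadow -` cball x r \<in> sets H"
          using measurable_sets[OF measurable_shadow, of "cball x r"] by auto
      qed
      also have "\<dots> = emeasure catenoid_shadow (cball x r)" by (simp add: emeasure_catenoid_shadow)
      also have "\<dots> = ennreal (measure catenoid_shadow (cball x r))"
        by (rule finite_measure.emeasure_eq_measure[OF finite_catenoid_shadow])
      finally have "outer_measure_of \<mu> (cball (flat x) r \<inter> (UNIV - Q)) / ennreal (unit_ball_vol (real 2) * r\<^sup>2)
        \<le> ennreal (measure catenoid_shadow (cball x r)) / ennreal (unit_ball_vol (real 2) * r\<^sup>2)"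
        by (rule divide_right_mono_ennreal)
      also have "\<dots> = ennreal (measure catenoid_shadow (cball x r) / (unit_ball_vol (real 2) * r\<^sup>2))"
        using r by (intro divide_ennreal) auto
      finally show ?thesis by (simp add: ac_simps)
    qed
    then show "\<forall>\<^sub>F r in at_right 0. outer_measure_of \<mu> (cball (flat x) r \<inter> (UNIV - Q)) / ennreal (unit_ball_vol (real 2) * r ^ 2)
      \<le> ennreal (measure catenoid_shadow (cball x r) / r\<^sup>2 * (1 / unit_ball_vol 2))"
      unfolding eventually_at_right_field by (intro exI[of _ 1]) auto
  qed auto
  then have "approx_tangent_cone 2 \<mu> (flat x) \<subseteq> tangent_cone Q (flat x)"
    unfolding approx_tangent_cone_def by (intro Inter_lower) blast
  also have "\<dots> \<subseteq> hyperplane e3"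
  proof (rule tangent_cone_level_set[where F="\<lambda>z. z $ 3"])
    have eq: "(\<bullet>) e3 = (\<lambda>h. h $ 3)" by (simp add: fun_eq_iff inner_axis')
    show "((\<lambda>z. z $ 3) has_derivative (\<bullet>) e3) (at (flat x))"
      unfolding eq by (rule bounded_linear_imp_has_derivative[OF bounded_linear_vec_nth])
  qed (auto simp: in_Q)
  finally show "approx_tangent_cone 2 \<mu> (flat x) \<subseteq> hyperplane e3" .
  show "hyperplane e3 \<subseteq> approx_tangent_cone 2 \<mu> (flat x)"
  proof
    fix v assume "v \<in> hyperplane e3"
    then have v: "v = flat (shadow v)"
      by (simp add: hyperplane_def inner_axis' vec_eq_iff forall_3 shadow_def)
    define w where "w = shadow v"
    have vw: "v = flat w" using v by (simp add: w_def)
    show "v \<in> approx_tangent_cone 2 \<mu> (flat x)"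
    proof (rule approx_tangent_coneI[OF sets_\<mu>])
      fix e :: real assume e: "0 < e"
      define b where "b = norm w + e / 2"
      have b: "0 < b" using e by (simp add: b_def add_nonneg_pos)
      define \<alpha> where "\<alpha> = unit_ball_vol 2"
      have \<alpha>: "0 < \<alpha>" by (simp add: \<alpha>_def)
      \<comment> \<open>With hole density below \<open>\<tau>\<close>, the holes in the ball of
        radius \<open>r * b\<close> have at most half the area of the disk \<open>F\<close> below,
        even if all of them lie in \<open>F\<close>.\<close>
      define \<tau> where "\<tau> = \<alpha> * (e / 2)\<^sup>2 / (2 * b\<^sup>2)"
      have \<tau>: "0 < \<tau>" "\<tau> * b\<^sup>2 = \<alpha> * (e / 2)\<^sup>2 / 2" using \<alpha> e b by (simp_all add: \<tau>_def)
      have "\<forall>\<^sub>F r in at_right 0. measure hole_measure (cball x r) / r\<^sup>2 < \<tau>"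
        using g \<tau>(1) unfolding good_def by (intro order_tendstoD) auto
      then obtain \<rho> where \<rho>: "0 < \<rho>" "\<And>r. 0 < r \<Longrightarrow> r < \<rho> \<Longrightarrow> measure hole_measure (cball x r) / r\<^sup>2 < \<tau>"
        unfolding eventually_at_right_field by auto
      obtain d where d: "0 < d" "cball x d \<subseteq> open_square" using x open_open_square by (meson DiffD1 open_contains_cball)
      define R' where "R' = min \<rho> d / b"
      have R': "0 < R'" using \<rho> d b by (simp add: R'_def)
      define c where "c = area_const * (\<alpha> * (e / 2)\<^sup>2 / 2)"
      have c: "0 < c" using area_const(1) \<alpha> e by (simp add: c_def)
      have main: "\<exists>Y\<in>sets borel. (\<forall>y\<in>Y. norm (y - flat x - r *\<^sub>R v) < e * r) \<and> ennreal (c * r\<^sup>2) \<le> emeasure \<mu> Y"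
        if r: "0 < r" "r < R'" for r
      proof -
        have rb: "r * b < \<rho>" "r * b < d" using r b by (simp_all add: R'_def field_simps)
        define F where "F = cball (x + r *\<^sub>R w) (r * (e / 2))"
        have F_sub: "F \<subseteq> cball x (r * b)"
        proof
          fix y assume "y \<in> F"
          then have "dist (x + r *\<^sub>R w) y \<le> r * (e / 2)" by (simp add: F_def)
          moreover have "dist x y \<le> dist x (x + r *\<^sub>R w) + dist (x + r *\<^sub>R w) y" by (rule dist_triangle)
          moreover have "dist x (x + r *\<^sub>R w) = r * norm w" using r by (simp add: dist_norm)
          ultimately show "y \<in> cball x (r * b)" by (simp add: b_def distrib_left)
        qed
        have F_sq: "F \<subseteq> open_square"
        proof -
          have "cball x (r * b) \<subseteq> cball x d" using rb by (intro subset_cball) simp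
          then show ?thesis using F_sub d(2) by blast
        qed
        have Fm[measurable]: "F \<in> sets borel" by (simp add: F_def)
        let ?Y = "flat ` (F - holes)"
        have Ym: "?Y \<in> sets borel" by (intro sets_flat_image) measurable
        have "norm (y - flat x - r *\<^sub>R v) < e * r" if "y \<in> ?Y" for y
        proof -
          obtain q where q: "q \<in> F" "y = flat q" using \<open>y \<in> ?Y\<close> by blast
          have "norm (y - flat x - r *\<^sub>R v) = norm (q - (x + r *\<^sub>R w))"
            by (simp add: q vw flat_arith algebra_simps)
          also have "\<dots> \<le> r * (e / 2)" using q(1) by (simp add: F_def dist_norm norm_minus_commute)
          also have "\<dots> < e * r" using e r by simp
          finally show ?thesis .
        qed
        moreover have "ennreal (c * r\<^sup>2) \<le> emeasure \<mu> ?Y"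
        proof -
          have "E \<inter> ?Y = ?Y" using F_sq flat_in_E by blast
          then have "emeasure \<mu> ?Y = ennreal area_const * emeasure lborel (F - holes)"
            using Ym by (simp add: emeasure_\<mu> emeasure_hausdorff_measure hausdorff_flat)
          moreover have "ennreal (\<alpha> * (e / 2)\<^sup>2 / 2 * r\<^sup>2) \<le> emeasure lborel (F - holes)"
          proof -
            have eF: "emeasure lborel F = ennreal (\<alpha> * (r * (e / 2))\<^sup>2)"
              using e r(1) by (simp add: F_def emeasure_cball \<alpha>_def) (simp add: power2_eq_square)
            have "emeasure lborel (holes \<inter> F) \<le> emeasure hole_measure (cball x (r * b))"
              using F_sub by (simp add: emeasure_hole_measure) (intro emeasure_mono, auto)
            also have "\<dots> = ennreal (measure hole_measure (cball x (r * b)))"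
              by (rule finite_measure.emeasure_eq_measure[OF finite_hole_measure])
            also have "\<dots> \<le> ennreal (\<tau> * (r * b)\<^sup>2)"
            proof (rule ennreal_leI)
              have rb0: "0 < r * b" using r b by simp
              then have "0 < (r * b)\<^sup>2" by (rule zero_less_power)
              from \<rho>(2)[OF rb0 rb(1), unfolded pos_divide_less_eq[OF this]]
              show "measure hole_measure (cball x (r * b)) \<le> \<tau> * (r * b)\<^sup>2" by (rule less_imp_le)
            qed
            also have "\<tau> * (r * b)\<^sup>2 = \<alpha> * (e / 2)\<^sup>2 / 2 * r\<^sup>2"
              using \<tau>(2) by (simp add: power_mult_distrib mult.left_commute)
            finally have h: "emeasure lborel (holes \<inter> F) \<le> ennreal (\<alpha> * (e / 2)\<^sup>2 / 2 * r\<^sup>2)" .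
            have "F - holes = F - (holes \<inter> F)" by blast
            then have "emeasure lborel (F - holes) = emeasure lborel F - emeasure lborel (holes \<inter> F)"
              using h by (simp only:) (subst emeasure_Diff, auto simp: top_unique)
            also have "\<dots> \<ge> ennreal (\<alpha> * (r * (e / 2))\<^sup>2) - ennreal (\<alpha> * (e / 2)\<^sup>2 / 2 * r\<^sup>2)"
              unfolding eF using h by (intro ennreal_minus_mono) auto
            also have "ennreal (\<alpha> * (r * (e / 2))\<^sup>2) - ennreal (\<alpha> * (e / 2)\<^sup>2 / 2 * r\<^sup>2) =
                ennreal (\<alpha> * (r * (e / 2))\<^sup>2 - \<alpha> * (e / 2)\<^sup>2 / 2 * r\<^sup>2)"
              using \<alpha> by (intro ennreal_minus) auto
            also have "\<alpha> * (r * (e / 2))\<^sup>2 - \<alpha> * (e / 2)\<^sup>2 / 2 * r\<^sup>2 = \<alpha> * (e / 2)\<^sup>2 / 2 * r\<^sup>2"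
              unfolding power_mult_distrib[of r] by (simp add: field_simps)
            finally show ?thesis .
          qed
          ultimately have "ennreal area_const * ennreal (\<alpha> * (e / 2)\<^sup>2 / 2 * r\<^sup>2) \<le> emeasure \<mu> ?Y"
            by (simp add: mult_left_mono)
          moreover have "ennreal area_const * ennreal (\<alpha> * (e / 2)\<^sup>2 / 2 * r\<^sup>2) = ennreal (c * r\<^sup>2)"
            using area_const(1) \<alpha> by (subst ennreal_mult[symmetric]) (auto simp: c_def ac_simps)
          ultimately show ?thesis by simp
        qed
        ultimately show ?thesis using Ym by blast
      qed
      show "\<exists>c>0. \<exists>R>0. \<forall>r. 0 < r \<and> r < R \<longrightarrow>
        (\<exists>Y\<in>sets borel. (\<forall>y\<in>Y. norm (y - flat x - r *\<^sub>R v) < e * r) \<and> ennreal (c * r\<^sup>2) \<le> emeasure \<mu> Y)"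
        using c R' main by blast
    qed
  qed
qed

lemma AE_tangent_\<mu>: "AE z in \<mu>. approx_tangent_cone 2 \<mu> z = hyperplane (n z)"
proof -
  obtain Z where Z: "Z \<in> null_sets lborel" "{x \<in> space lborel. \<not> (x \<in> open_square - holes \<longrightarrow> good x)} \<subseteq> Z"
    using AE_good unfolding eventually_ae_filter by blast
  have Zm[measurable]: "Z \<in> sets borel" using Z(1) by (simp add: null_sets_def)
  have "emeasure \<mu> (flat ` Z) \<le> emeasure H (flat ` Z)"
    by (simp add: emeasure_\<mu>) (intro emeasure_mono, auto)
  also have "\<dots> = 0" using Z(1) by (simp add: emeasure_hausdorff_measure hausdorff_flat null_sets_def)
  finally have nZ: "flat ` Z \<in> null_sets \<mu>" by (simp add: null_sets_def)
  have nE: "- E \<in> null_sets \<mu>" by (simp add: null_sets_def emeasure_\<mu>)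
  show ?thesis
  proof (rule AE_I')
    show "flat ` Z \<union> - E \<in> null_sets \<mu>" using nZ nE by (rule null_sets.Un)
    show "{z \<in> space \<mu>. approx_tangent_cone 2 \<mu> z \<noteq> hyperplane (n z)} \<subseteq> flat ` Z \<union> - E"
    proof
      fix z assume z: "z \<in> {z \<in> space \<mu>. approx_tangent_cone 2 \<mu> z \<noteq> hyperplane (n z)}"
      show "z \<in> flat ` Z \<union> - E"
      proof (rule ccontr)
        assume "z \<notin> flat ` Z \<union> - E"
        then have zE: "z \<in> E" "z \<notin> flat ` Z" by auto
        from zE(1) show False
        proof (cases rule: E_cases)
          case (C j)
          then show False using z tangent_C[OF C] n_C[OF C] by simp
        next
          case (flat x)
          have "z \<notin> C j" for j using C_bounds(1)[of z j] flat by auto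
          then have nz: "n z = e3" by (rule n_else)
          have "good x" using Z(2) zE(2) flat by auto
          then show False using z tangent_flat[OF flat(2)] flat(1) nz by simp
        qed
      qed
    qed
  qed
qed

section \<open>Rectifiability, integrality and tilt excess of the assembled surface\<close>

lemma norm_pair: "norm (p $ 1, p $ 2) = norm p" for p :: "real^2"
  by (simp add: norm_prod_def norm_vec_def L2_set_def sum_2)

lemma rectifiable_E: "countably_rectifiable TYPE(2) E"
proof -
  define pr where "pr p = (p $ 1, p $ 2)" for p :: "real^2"
  have pr_surj: "pr ` (pr -` S) = S" for S
  proof -
    have "surj pr" by (rule surjI[of pr "\<lambda>x. vector [fst x, snd x]"]) (simp add: pr_def)
    then show ?thesis by (rule surj_image_vimage_eq)
  qed
  have pr_dist: "dist (pr p) (pr q) = dist p q" for p q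
    using norm_pair[of "p - q"] by (simp add: pr_def dist_norm)
  have bd: "bounded (pr -` S)" if S: "bounded S" for S
  proof -
    obtain K where K: "\<forall>x\<in>S. norm x \<le> K" using S[unfolded bounded_iff] ..
    show ?thesis unfolding bounded_iff
    proof (intro exI[of _ K] ballI)
      fix p assume "p \<in> pr -` S"
      then have "norm (pr p) \<le> K" using K by blast
      then show "norm p \<le> K" using norm_pair[of p] by (simp add: pr_def)
    qed
  qed
  \<comment> \<open>Piece 0 is the flat part and piece \<open>Suc j\<close> is the hat
    \<open>j\<close>, empty if \<open>j\<close> is not in \<open>J\<close>.\<close>
  define S where "S i = (case i of 0 \<Rightarrow> open_square - holes | Suc j \<Rightarrow> if j \<in> J then {0<..<L j} \<times> {0<..<2 * pi} else {})" for i
  define f where "f i = (case i of 0 \<Rightarrow> flat | Suc j \<Rightarrow> revolution.\<phi> (a j) (\<lambda>s. \<epsilon> j * cosh s) (\<lambda>s. \<epsilon> j * (s - L j)))" for i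
  have bS: "bounded (S i)" for i
  proof (cases i)
    case 0
    have "bounded open_square" unfolding open_square_def by (intro bounded_Times bounded_subset[OF bounded_closed_interval[of 0 1]]) auto
    then show ?thesis using 0 by (auto simp: S_def intro: bounded_subset)
  next
    case (Suc j)
    have "bounded ({0<..<L j} \<times> {0<..<2 * pi})"
      by (intro bounded_Times bounded_subset[OF bounded_closed_interval[of 0 "L j"]] bounded_subset[OF bounded_closed_interval[of 0 "2 * pi"]]) auto
    then show ?thesis by (simp add: S_def Suc)
  qed
  have lip: "\<exists>K. K-lipschitz_on (S i) (f i)" for i
  proof (cases i)
    case 0
    have "1-lipschitz_on (S i) (f i)" by (rule lipschitz_onI) (simp_all add: f_def 0)
    then show ?thesis by blast
  next
    case (Suc j)
    show ?thesis
    proof (cases "j \<in> J")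
      case True
      then show ?thesis using hat.C_lipschitz_image[OF hat[OF True], of "a j"] by (simp add: S_def f_def Suc)
    qed (auto simp: S_def Suc)
  qed
  have "E = (\<Union>i. f i ` S i)"
  proof -
    have "f (Suc j) ` S (Suc j) = C j" for j
      using hat.C_def[OF hat, of j "a j"] by (auto simp: f_def S_def C_def)
    moreover have "f 0 ` S 0 = Q - (\<Union>j. A j)" by (simp add: f_def S_def Q_def holes_def) blast
    moreover have "(\<Union>i. f i ` S i) = f 0 ` S 0 \<union> (\<Union>j. f (Suc j) ` S (Suc j))"
    proof (intro equalityI UN_least Un_least)
      show "f i ` S i \<subseteq> f 0 ` S 0 \<union> (\<Union>j. f (Suc j) ` S (Suc j))" for i by (cases i) auto
    qed auto
    ultimately show ?thesis by (simp add: E_def)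
  qed
  also have "\<dots> = (\<Union>i. (\<lambda>p. f i (pr p)) ` (pr -` S i))"
    using pr_surj by (simp add: image_image[of _ pr, symmetric])
  finally have eq: "E = (\<Union>i. (\<lambda>p. f i (pr p)) ` (pr -` S i))" .
  have "\<exists>K. K-lipschitz_on (pr -` S i) (\<lambda>p. f i (pr p))" for i
  proof -
    obtain K where K: "K-lipschitz_on (S i) (f i)" using lip by blast
    have "K-lipschitz_on (pr -` S i) (\<lambda>p. f i (pr p))"
      using lipschitz_onD[OF K] lipschitz_on_nonneg[OF K] by (intro lipschitz_onI) (auto simp: pr_dist[symmetric])
    then show ?thesis by blast
  qed
  then show ?thesis unfolding countably_rectifiable_def using eq bd[OF bS]
    by (intro exI[of _ "\<lambda>i. pr -` S i"] exI[of _ "\<lambda>i p. f i (pr p)"]) blast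
qed

lemma integral_V: "integral_varifold TYPE(2) V"
  unfolding integral_varifold_def
proof (intro conjI)
  show "varifold CARD(2) V" using varifold_V by simp
  show "AE p in V. snd p = approx_tangent_cone CARD(2) (weight V) (fst p)"
    using AE_tangent[OF AE_tangent_\<mu>] by simp
  show "\<exists>E\<in>sets borel. \<exists>\<theta>::real^3 \<Rightarrow> nat. countably_rectifiable TYPE(2) E \<and>
      \<theta> \<in> borel \<rightarrow>\<^sub>M count_space UNIV \<and> (\<forall>z\<in>E. 0 < \<theta> z) \<and>
      (\<forall>K. compact K \<longrightarrow> (\<integral>\<^sup>+z\<in>E \<inter> K. of_nat (\<theta> z) \<partial>hausdorff_measure CARD(2)) < \<infinity>) \<and>
      weight V = density (hausdorff_measure CARD(2)) (\<lambda>z. of_nat (\<theta> z) * indicator E z)"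
  proof (intro bexI[OF _ sets_E] exI[of _ "\<lambda>_. 1"] conjI allI impI ballI)
    fix K :: "(real^3) set"
    have "(\<integral>\<^sup>+z\<in>E \<inter> K. of_nat 1 \<partial>H) \<le> (\<integral>\<^sup>+z. indicator E z \<partial>H)"
      by (intro nn_integral_mono) (auto simp: indicator_def)
    also have "\<dots> < \<infinity>" using emeasure_E by simp
    finally show "(\<integral>\<^sup>+z\<in>E \<inter> K. of_nat 1 \<partial>hausdorff_measure CARD(2)) < \<infinity>" by simp
    show "weight V = density (hausdorff_measure CARD(2)) (\<lambda>z. of_nat 1 * indicator E z)"
      by (simp add: weight_V) (simp add: \<mu>_def)
  qed (use rectifiable_E in simp_all)
qed

lemma tangent_domain_C:
  assumes "z \<in> C j"
  shows "z \<in> tangent_domain 2 \<mu>" "tangent_map 2 \<mu> z = hyper_proj (N j z)"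
  using tangent_C[OF assms] hyperplane_in[of z] n_nz[of z]
  by (simp_all add: tangent_domain_def tangent_map_def n_C[OF assms] orth_proj_hyperplane)

lemma tangent_domain_flat:
  assumes "x \<in> open_square - holes" "good x"
  shows "flat x \<in> tangent_domain 2 \<mu>" "tangent_map 2 \<mu> (flat x) = hyper_proj e3"
proof -
  have "e3 \<noteq> (0 :: real^3)" by (simp add: axis_eq_0_iff)
  then show "flat x \<in> tangent_domain 2 \<mu>" "tangent_map 2 \<mu> (flat x) = hyper_proj e3"
    using tangent_flat[OF assms] hyperplane_grassmannian[of "e3"]
    by (simp_all add: tangent_domain_def tangent_map_def orth_proj_hyperplane)
qed

lemma tilt_ge:
  assumes j: "j \<in> J" and x: "x \<in> open_square - holes" "good x" and r: "C j \<subseteq> cball (flat x) r"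
  shows "ennreal (area_const * (4 * pi * (\<epsilon> j)\<^sup>2 * L j)) \<le>
    (\<integral>\<^sup>+z\<in>cball (flat x) r \<inter> tangent_domain 2 \<mu>.
       ennreal ((hom_norm (tangent_map 2 \<mu> z - tangent_map 2 \<mu> (flat x)))\<^sup>2) \<partial>\<mu>)"
proof -
  let ?g = "\<lambda>z. ennreal ((hom_norm (hyper_proj (N j z) - hyper_proj e3))\<^sup>2)"
  have [measurable]: "(\<lambda>z. hom_norm (hyper_proj (N j z) - hyper_proj e3)) \<in> borel_measurable borel"
    unfolding N_def by (rule hat.measurable_hom_norm[OF hat[OF j]])
  have "ennreal (area_const * (4 * pi * (\<epsilon> j)\<^sup>2 * L j)) = (\<integral>\<^sup>+z\<in>C j. ?g z \<partial>H)"
    using hat.tilt_C[OF hat[OF j], of "a j"] j by (simp add: C_def N_def)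
  also have "\<dots> = (\<integral>\<^sup>+z. indicator E z * (?g z * indicator (C j) z) \<partial>H)"
    by (intro nn_integral_cong) (auto simp: indicator_def E_def)
  also have "\<dots> = (\<integral>\<^sup>+z\<in>C j. ?g z \<partial>\<mu>)"
    unfolding \<mu>_def by (subst nn_integral_density) auto
  also have "\<dots> \<le> (\<integral>\<^sup>+z\<in>cball (flat x) r \<inter> tangent_domain 2 \<mu>.
       ennreal ((hom_norm (tangent_map 2 \<mu> z - tangent_map 2 \<mu> (flat x)))\<^sup>2) \<partial>\<mu>)"
  proof (intro nn_integral_mono)
    fix z
    show "?g z * indicator (C j) z \<le> ennreal ((hom_norm (tangent_map 2 \<mu> z - tangent_map 2 \<mu> (flat x)))\<^sup>2)
        * indicator (cball (flat x) r \<inter> tangent_domain 2 \<mu>) z"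
    proof (cases "z \<in> C j")
      case True
      then have "z \<in> cball (flat x) r \<inter> tangent_domain 2 \<mu>" using r tangent_domain_C(1) by blast
      then show ?thesis using True tangent_domain_C(2)[OF True] tangent_domain_flat(2)[OF x] by simp
    qed simp
  qed
  finally show ?thesis .
qed

end

section \<open>The choice of the scales\<close>

text \<open>The shift by 4 makes the infinite sum \<open>1 / 8\<close>, so that the doubled disks
  cover at most half of the square, and every term at most \<open>1 / 16\<close>, so that a disk
  fits well inside its cell.\<close>

definition weight_seq :: "nat \<Rightarrow> real" where "weight_seq i = (1 / 2) ^ (i + 4)"

lemma weight_seq: "0 < weight_seq i" "weight_seq i \<le> 1 / 16" "(\<Sum>i<M. weight_seq i) \<le> 1 / 8"
proof -
  show "0 < weight_seq i" by (simp add: weight_seq_def)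
  have "(1 / 2 :: real) ^ i \<le> 1" by (simp add: power_le_one)
  moreover have "weight_seq i = (1 / 2) ^ i / 16" by (simp add: weight_seq_def power_add power_divide)
  ultimately show "weight_seq i \<le> 1 / 16" by simp
  have "(\<Sum>i<M. weight_seq i) = 1 / 8 - (1 / 2) ^ (M + 3)"
    by (induction M) (simp_all add: weight_seq_def power_add power3_eq_cube power4_eq_xxxx)
  then show "(\<Sum>i<M. weight_seq i) \<le> 1 / 8" by simp
qed

text \<open>
  At stage \<open>i\<close> the unit square is divided into cells of side \<open>1 / m i\<close>, and each cell receives at its
  centre a hat of outer radius \<open>rad i\<close>, unless it would meet the disk of an earlier stage. The index \<open>j\<close>
  of a hat encodes its stage and its cell. The length \<open>len i\<close> is chosen such that
  \<open>eps i * cosh (len i) = rad i\<close>. The stage contributes at most a multiple of \<open>(m i)\<^sup>2 * eps i = 4 * s i\<close> to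
  the total variation, and its disks have total area at most \<open>4 * pi * (s i)\<^sup>2\<close>.
\<close>

locale stages =
  fixes m :: "nat \<Rightarrow> nat"
  assumes m3: "3 \<le> m i" and growth: "real (m i) \<le> real (m (Suc i)) * weight_seq i"
begin

abbreviation s :: "nat \<Rightarrow> real" where "s \<equiv> weight_seq"
definition r :: "nat \<Rightarrow> real" where "r i = 2 / real (m i)"
definition eps :: "nat \<Rightarrow> real" where "eps i = s i * (r i)\<^sup>2"
definition rad :: "nat \<Rightarrow> real" where "rad i = s i * r i"
definition len :: "nat \<Rightarrow> real" where "len i = arcosh (1 / r i)"
definition centre :: "nat \<Rightarrow> nat \<Rightarrow> nat \<Rightarrow> real \<times> real" where
  "centre i k l = ((real k + 1 / 2) / real (m i), (real l + 1 / 2) / real (m i))"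

definition st :: "nat \<Rightarrow> nat" where "st j = fst (prod_decode j)"
definition row :: "nat \<Rightarrow> nat" where "row j = fst (prod_decode (snd (prod_decode j)))"
definition col :: "nat \<Rightarrow> nat" where "col j = snd (prod_decode (snd (prod_decode j)))"
definition code :: "nat \<Rightarrow> nat \<Rightarrow> nat \<Rightarrow> nat" where "code i k l = prod_encode (i, prod_encode (k, l))"

text \<open>A hat is dropped if it meets a disk of an earlier stage, whether or not the hat of that
  disk was kept itself. This makes the definition explicit instead of recursive.\<close>

definition J :: "nat set" where
  "J = {j. row j < m (st j) \<and> col j < m (st j) \<and>
     (\<forall>i<st j. \<forall>k<m i. \<forall>l<m i.
        ball (centre (st j) (row j) (col j)) (rad (st j)) \<inter> ball (centre i k l) (rad i) = {})}"

lemma code [simp]: "st (code i k l) = i" "row (code i k l) = k" "col (code i k l) = l"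
  by (simp_all add: st_def row_def col_def code_def)

lemma code_inj: "st i = st j \<Longrightarrow> row i = row j \<Longrightarrow> col i = col j \<Longrightarrow> i = j"
proof -
  have "code (st j) (row j) (col j) = j" for j by (simp add: code_def st_def row_def col_def)
  then show "st i = st j \<Longrightarrow> row i = row j \<Longrightarrow> col i = col j \<Longrightarrow> i = j" by metis
qed

lemma m_pos: "0 < real (m i)" using m3[of i] by simp

lemma r_bounds: "0 < r i" "r i < 1" using m3[of i] by (simp_all add: r_def)

lemma rad_bounds: "0 < rad i" "rad i \<le> 1 / (8 * real (m i))"
proof -
  show "0 < rad i" using weight_seq(1) r_bounds by (simp add: rad_def)
  have "rad i \<le> 1 / 16 * r i" unfolding rad_def using weight_seq(2) r_bounds(1)[of i] by (intro mult_right_mono) auto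
  then show "rad i \<le> 1 / (8 * real (m i))" by (simp add: r_def)
qed

lemma len_bounds: "cosh (len i) = 1 / r i" "ln (1 / r i) \<le> len i" "0 < ln (1 / r i)"
proof -
  have ge: "1 < 1 / r i" using r_bounds[of i] by simp
  then show "cosh (len i) = 1 / r i" unfolding len_def by (intro cosh_arcosh_real) simp
  have "1 \<le> (1 / r i)\<^sup>2" using ge by (intro one_le_power) simp
  then have "ln (1 / r i) \<le> ln (1 / r i + sqrt ((1 / r i)\<^sup>2 - 1))" using ge r_bounds(1)[of i] by (intro ln_mono) auto
  then show "ln (1 / r i) \<le> len i" unfolding len_def using ge by (simp only: arcosh_real_def[OF less_imp_le])
  show "0 < ln (1 / r i)" using ge by (rule ln_gt_zero)
qed

lemma hat_stage: "hat (eps i) (len i)"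
proof
  show "0 < eps i" unfolding eps_def by (intro mult_pos_pos weight_seq(1) zero_less_power r_bounds)
  show "0 < len i" using len_bounds(3,2) by (rule less_le_trans)
qed

lemma hat_R_stage: "hat.R (eps i) (len i) = rad i"
  using r_bounds[of i] unfolding hat.R_def[OF hat_stage] len_bounds(1)
  by (simp add: eps_def rad_def power2_eq_square)

text \<open>For consecutive stages this is \<open>growth\<close> in terms of \<open>r\<close> and
  \<open>rad\<close>; the remaining cases follow since \<open>rad\<close> is decreasing.\<close>

lemma scale_le: "i < j \<Longrightarrow> r j \<le> rad i"
proof -
  have step: "r (Suc i) \<le> rad i" for i
    using growth[of i] m_pos[of i] m_pos[of "Suc i"] by (simp add: r_def rad_def field_simps)
  have mono: "rad (Suc i) \<le> rad i" for i
  proof -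
    have "rad (Suc i) \<le> 1 * r (Suc i)" unfolding rad_def
      using weight_seq(2)[of "Suc i"] r_bounds(1)[of "Suc i"] by (intro mult_right_mono) auto
    then show ?thesis using step[of i] by simp
  qed
  assume "i < j"
  then show ?thesis
  proof (induction j)
    case (Suc j)
    show ?case
    proof (cases "i = j")
      case False
      have "r (Suc j) \<le> rad j" by (rule step)
      also have "rad j \<le> rad i" using Suc.prems by (intro lift_Suc_antimono_le[of rad, OF mono]) simp
      finally show ?thesis .
    qed (use step in simp)
  qed simp
qed

lemma r_tendsto: "0 < b \<Longrightarrow> \<exists>i. r i < b"
proof -
  have "i + 3 \<le> m i" for i
  proof (induction i)
    case (Suc i)
    have "real (m (Suc i)) * s i \<le> real (m (Suc i)) * (1 / 16)" using weight_seq(2) by (intro mult_left_mono) auto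
    then have "16 * real (m i) \<le> real (m (Suc i))" using growth[of i] by linarith
    then have "16 * m i \<le> m (Suc i)" by (metis of_nat_le_iff of_nat_mult of_nat_numeral)
    then show ?case using Suc by linarith
  qed (simp add: m3)
  assume b: "0 < b"
  obtain i :: nat where i: "2 / b < real i" using reals_Archimedean2 by blast
  have "real i \<le> real (m i)" using \<open>\<And>i. i + 3 \<le> m i\<close>[of i] by simp
  then have "2 / b < real (m i)" using i by linarith
  then have "r i < b" using b m_pos[of i] by (simp add: r_def field_simps)
  then show ?thesis ..
qed

lemma coord_le_dist: "\<bar>fst p - fst q\<bar> \<le> dist p q" "\<bar>snd p - snd q\<bar> \<le> dist p q" for p q :: "real \<times> real"
  using dist_fst_le[of p q] dist_snd_le[of p q] by (simp_all add: dist_real_def)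

lemma ball_inside:
  assumes "k < m i" "l < m i"
  shows "ball (centre i k l) (rad i) \<subseteq> open_square"
proof
  fix y assume "y \<in> ball (centre i k l) (rad i)"
  then have d: "dist (centre i k l) y < rad i" by simp
  have *: "rad i < 1 / 2 / real (m i)"
    using rad_bounds(2)[of i] m_pos[of i] by (simp add: field_simps)
  have one: "0 < y' \<and> y' < 1" if a: "\<bar>(real q + 1 / 2) / real (m i) - y'\<bar> < rad i" and q: "q < m i" for q y'
  proof -
    have "(real q + 1 / 2) / real (m i) = real q / real (m i) + 1 / 2 / real (m i)"
      by (simp add: add_divide_distrib)
    moreover have "0 \<le> real q / real (m i)" by simp
    moreover have "real q / real (m i) + 2 * (1 / 2 / real (m i)) \<le> 1"
      using q m_pos[of i] by (simp add: field_simps)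
    ultimately show ?thesis using a * by (simp only: abs_less_iff) linarith
  qed
  have "0 < fst y \<and> fst y < 1" "0 < snd y \<and> snd y < 1"
    using coord_le_dist[of "centre i k l" y] d assms
    by (auto intro!: one[of k "fst y"] one[of l "snd y"] simp: centre_def)
  then show "y \<in> open_square" by (cases y) (auto simp: open_square_def)
qed

lemma balls_disjoint:
  assumes "(k, l) \<noteq> (k', l')"
  shows "ball (centre i k l) (rad i) \<inter> ball (centre i k' l') (rad i) = {}"
proof (rule ccontr)
  assume "ball (centre i k l) (rad i) \<inter> ball (centre i k' l') (rad i) \<noteq> {}"
  then obtain y where "dist (centre i k l) y < rad i" "dist (centre i k' l') y < rad i" by auto
  then have d: "dist (centre i k l) (centre i k' l') < 2 * rad i"
    using dist_triangle2[of "centre i k l" "centre i k' l'" y] by linarith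
  have 8: "2 * rad i < 1 / real (m i)" using rad_bounds(2)[of i] m_pos[of i] by (simp add: field_simps)
  have one: "q = q'" if "\<bar>(real q + 1 / 2) / real (m i) - (real q' + 1 / 2) / real (m i)\<bar> < 1 / real (m i)" for q q'
  proof -
    have "(real q + 1 / 2) / real (m i) - (real q' + 1 / 2) / real (m i) = (real q - real q') / real (m i)"
      by (simp add: diff_divide_distrib[symmetric])
    then have "\<bar>real q - real q'\<bar> < 1" using that m_pos[of i] by (simp add: abs_divide divide_less_cancel)
    then show ?thesis by (simp add: abs_less_iff)
  qed
  have "k = k'" "l = l'"
    using coord_le_dist[of "centre i k l" "centre i k' l'"] d 8
    by (auto intro!: one simp: centre_def)
  then show False using assms by simp
qed

text \<open>Stage \<open>i\<close> has at most \<open>(m i)\<^sup>2\<close> indices. An index below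
  \<open>M\<close> belongs to a stage below \<open>M\<close>, because a pairing code is at least as
  large as its first component.\<close>

lemma summable_stages:
  assumes h: "\<And>i. 0 \<le> h i" and B: "\<And>M. (\<Sum>i<M. (real (m i))\<^sup>2 * h i) \<le> B"
  shows "summable (\<lambda>j. if j \<in> J then h (st j) else 0)"
proof (rule summableI_nonneg_bounded)
  fix M
  let ?T = "SIGMA i:{..<M}. {..<m i} \<times> {..<m i}"
  define c where "c j = (st j, row j, col j)" for j
  have "(\<Sum>j<M. if j \<in> J then h (st j) else 0) = (\<Sum>j\<in>{..<M} \<inter> J. h (st j))"
    by (simp add: sum.inter_restrict)
  also have "\<dots> = (\<Sum>p\<in>c ` ({..<M} \<inter> J). h (fst p))"
    by (subst sum.reindex) (auto simp: c_def inj_on_def intro: code_inj)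
  also have "\<dots> \<le> (\<Sum>p\<in>?T. h (fst p))"
  proof (rule sum_mono2)
    show "finite ?T" by auto
    have "st j \<le> j" for j by (metis le_prod_encode_1 prod.collapse prod_decode_inverse st_def)
    then show "c ` ({..<M} \<inter> J) \<subseteq> ?T" by (auto simp: c_def J_def intro: le_less_trans)
  qed (use h in auto)
  also have "\<dots> = (\<Sum>i<M. \<Sum>q\<in>{..<m i} \<times> {..<m i}. h i)" by (subst sum.Sigma) (auto simp: split_beta)
  also have "\<dots> = (\<Sum>i<M. (real (m i))\<^sup>2 * h i)" by (simp add: card_cartesian_product power2_eq_square)
  also have "\<dots> \<le> B" by (rule B)
  finally show "(\<Sum>j<M. if j \<in> J then h (st j) else 0) \<le> B" .
qed (use h in simp)

lemma hats_stages: "hats J (\<lambda>j. centre (st j) (row j) (col j)) (\<lambda>j. eps (st j)) (\<lambda>j. len (st j))"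
proof (rule hats.intro)
  show "hat (eps (st j)) (len (st j))" for j by (rule hat_stage)
  show "ball (centre (st j) (row j) (col j)) (hat.R (eps (st j)) (len (st j))) \<subseteq> open_square" if "j \<in> J" for j
    unfolding hat_R_stage using that by (intro ball_inside) (auto simp: J_def)
  show "ball (centre (st i) (row i) (col i)) (hat.R (eps (st i)) (len (st i))) \<inter>
      ball (centre (st j) (row j) (col j)) (hat.R (eps (st j)) (len (st j))) = {}" if ij: "i \<in> J" "j \<in> J" "i \<noteq> j" for i j
    unfolding hat_R_stage
  proof (cases "st i" "st j" rule: linorder_cases)
    case less
    then show "ball (centre (st i) (row i) (col i)) (rad (st i)) \<inter> ball (centre (st j) (row j) (col j)) (rad (st j)) = {}"
      using ij(1,2) unfolding J_def by blast
  next
    case equal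
    have "(row i, col i) \<noteq> (row j, col j)" using code_inj[of i j] equal ij(3) by auto
    then show "ball (centre (st i) (row i) (col i)) (rad (st i)) \<inter> ball (centre (st j) (row j) (col j)) (rad (st j)) = {}"
      using balls_disjoint equal by metis
  next
    case greater
    then show "ball (centre (st i) (row i) (col i)) (rad (st i)) \<inter> ball (centre (st j) (row j) (col j)) (rad (st j)) = {}"
      using ij(1,2) unfolding J_def by blast
  qed
  show "summable (\<lambda>j. if j \<in> J then eps (st j) else 0)"
  proof (rule summable_stages)
    have "(real (m i))\<^sup>2 * eps i = 4 * s i" for i using m_pos[of i] by (simp add: eps_def r_def power_divide)
    then show "(\<Sum>i<M. (real (m i))\<^sup>2 * eps i) \<le> 1 / 2" for M
      using weight_seq(3)[of M] by (simp add: sum_distrib_left[symmetric])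
  qed (use weight_seq(1) in \<open>simp add: eps_def less_imp_le\<close>)
  show "summable (\<lambda>j. if j \<in> J then (hat.R (eps (st j)) (len (st j)))\<^sup>2 else 0)"
    unfolding hat_R_stage
  proof (rule summable_stages)
    have "(real (m i))\<^sup>2 * (rad i)\<^sup>2 \<le> s i" for i
    proof -
      have "(real (m i))\<^sup>2 * (rad i)\<^sup>2 = 4 * (s i)\<^sup>2"
        using m_pos[of i] by (simp add: rad_def r_def power_divide power_mult_distrib)
      also have "\<dots> \<le> s i" using weight_seq(1,2)[of i] by (simp add: power2_eq_square)
      finally show ?thesis .
    qed
    then have "(\<Sum>i<M. (real (m i))\<^sup>2 * (rad i)\<^sup>2) \<le> (\<Sum>i<M. s i)" for M by (intro sum_mono)
    then show "(\<Sum>i<M. (real (m i))\<^sup>2 * (rad i)\<^sup>2) \<le> 1 / 8" for M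
      using weight_seq(3)[of M] by (meson order_trans)
  qed simp
qed

sublocale hats J "\<lambda>j. centre (st j) (row j) (col j)" "\<lambda>j. eps (st j)" "\<lambda>j. len (st j)"
  by (rule hats_stages)

text \<open>
  The disks are doubled so that, for a point outside, the hat of its cell at stage \<open>i\<close> cannot have
  been omitted: that hat lies within \<open>r i\<close> of the point, and \<open>r i\<close> is at most the radius of every earlier disk.
\<close>

definition doubled :: "(real \<times> real) set" where
  "doubled = (\<Union>i. \<Union>q\<in>{..<m i} \<times> {..<m i}. cball (centre i (fst q) (snd q)) (2 * rad i))"

lemma sets_doubled [measurable]: "doubled \<in> sets borel"
  unfolding doubled_def by (intro sets.countable_UN sets.finite_UN) auto

lemma emeasure_doubled: "emeasure lborel doubled \<le> ennreal (1 / 2)"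
proof -
  let ?c = "\<lambda>i q. cball (centre i (fst q) (snd q)) (2 * rad i)"
  have "emeasure lborel doubled \<le> (\<Sum>i. emeasure lborel (\<Union>q\<in>{..<m i} \<times> {..<m i}. ?c i q))"
    unfolding doubled_def by (intro emeasure_subadditive_countably) (auto intro!: sets.finite_UN)
  also have "\<dots> \<le> (\<Sum>i. ennreal (4 * s i))"
  proof (intro suminf_le summableI)
    fix i
    have "emeasure lborel (\<Union>q\<in>{..<m i} \<times> {..<m i}. ?c i q) \<le> (\<Sum>q\<in>{..<m i} \<times> {..<m i}. emeasure lborel (?c i q))"
      by (intro emeasure_subadditive_finite) auto
    also have "\<dots> = (\<Sum>q\<in>{..<m i} \<times> {..<m i}. ennreal (pi * (2 * rad i)\<^sup>2))"
      using rad_bounds(1)[of i] by (intro sum.cong refl) (simp add: emeasure_cball unit_ball_vol_2 power2_eq_square)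
    also have "\<dots> = ennreal ((real (m i))\<^sup>2 * (pi * (2 * rad i)\<^sup>2))"
      by (simp add: card_cartesian_product ennreal_of_nat_eq_real_of_nat ennreal_mult[symmetric] power2_eq_square)
    also have "\<dots> \<le> ennreal (4 * s i)"
    proof (rule ennreal_leI)
      \<comment> \<open>Here \<open>rad i * m i\<close> is \<open>2 * s i\<close>; then
        \<open>pi < 4\<close> and one factor \<open>s i \<le> 1 / 16\<close> give the bound.\<close>
      have "(real (m i))\<^sup>2 * (pi * (2 * rad i)\<^sup>2) = 16 * pi * (s i)\<^sup>2"
        using m_pos[of i] by (simp add: rad_def r_def power_divide power_mult_distrib)
      also have "\<dots> \<le> 16 * 4 * (s i * (1 / 16))"
        unfolding power2_eq_square using pi_less_4 weight_seq(1,2)[of i] by (intro mult_mono) auto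
      finally show "(real (m i))\<^sup>2 * (pi * (2 * rad i)\<^sup>2) \<le> 4 * s i" by simp
    qed
    finally show "emeasure lborel (\<Union>q\<in>{..<m i} \<times> {..<m i}. ?c i q) \<le> ennreal (4 * s i)" .
  qed
  also have "\<dots> \<le> ennreal (1 / 2)"
  proof (intro suminf_le_const summableI)
    fix M
    have "(\<Sum>i<M. ennreal (4 * s i)) = ennreal (\<Sum>i<M. 4 * s i)"
      using weight_seq(1) by (intro sum_ennreal) (simp add: less_imp_le)
    also have "\<dots> \<le> ennreal (1 / 2)"
      using weight_seq(3)[of M] by (intro ennreal_leI) (simp add: sum_distrib_left[symmetric])
    finally show "(\<Sum>i<M. ennreal (4 * s i)) \<le> ennreal (1 / 2)" .
  qed
  finally show ?thesis .
qed

lemma holes_doubled: "holes \<subseteq> doubled"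
proof
  fix x assume "x \<in> holes"
  then obtain j where j: "flat x \<in> A j" by (auto simp: holes_def)
  then have "j \<in> J" by (simp add: in_A)
  then have v: "row j < m (st j)" "col j < m (st j)" by (auto simp: J_def)
  have "dist (centre (st j) (row j) (col j)) x < rad (st j)" using A_bounds(2)[OF j] by (simp add: hat_R_stage)
  then have "x \<in> cball (centre (st j) (row j) (col j)) (2 * rad (st j))" using rad_bounds(1)[of "st j"] by simp
  then show "x \<in> doubled" unfolding doubled_def using v by (intro UN_I[of "st j"] UN_I[of "(row j, col j)"]) auto
qed

text \<open>The hat is that of the grid cell containing \<open>x\<close>. Its centre is within
  \<open>1 / m i\<close> of \<open>x\<close>, and its radius and its depth add at most
  \<open>rad i\<close> each, which stays below \<open>r i = 2 / m i\<close>.\<close>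

lemma nearby_hat:
  assumes x: "x \<in> open_square - doubled"
  obtains j where "j \<in> J" "st j = i" "C j \<subseteq> cball (flat x) (r i)"
proof -
  define k l where "k = nat \<lfloor>fst x * m i\<rfloor>" and "l = nat \<lfloor>snd x * m i\<rfloor>"
  have xb: "0 < fst x" "fst x < 1" "0 < snd x" "snd x < 1" using x by (auto simp: open_square_def)
  have cell: "q < m i \<and> \<bar>(real q + 1 / 2) / real (m i) - y\<bar> \<le> 1 / 2 / real (m i)"
    if y: "0 < y" "y < 1" and q: "q = nat \<lfloor>y * m i\<rfloor>" for y :: real and q :: nat
  proof -
    have "0 \<le> y * m i" using y by simp
    then have b: "real q \<le> y * m i" "y * m i < real q + 1" by (simp_all add: q of_nat_nat)
    have "y * m i < 1 * real (m i)" using y m_pos[of i] by (intro mult_strict_right_mono) auto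
    then have "real q < real (m i)" using b by linarith
    moreover have "(real q + 1 / 2) / real (m i) - y = (real q + 1 / 2 - y * m i) / real (m i)"
      using m_pos[of i] by (simp add: field_simps)
    moreover have "\<bar>real q + 1 / 2 - y * m i\<bar> \<le> 1 / 2" using b by (simp only: abs_le_iff) linarith
    ultimately show ?thesis
      using m_pos[of i] divide_right_mono[of "\<bar>real q + 1 / 2 - y * m i\<bar>" "1 / 2" "real (m i)"] by (simp add: abs_divide)
  qed
  have k: "k < m i" "\<bar>(real k + 1 / 2) / real (m i) - fst x\<bar> \<le> 1 / 2 / real (m i)"
    using cell[OF xb(1,2) k_def] by auto
  have l: "l < m i" "\<bar>(real l + 1 / 2) / real (m i) - snd x\<bar> \<le> 1 / 2 / real (m i)"
    using cell[OF xb(3,4) l_def] by auto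
  have dx: "dist (centre i k l) x \<le> 1 / real (m i)"
    using dist_prod_le[of "centre i k l" x] k(2) l(2) by (simp add: centre_def)
  have r4: "1 / real (m i) + 2 * rad i < r i"
    using rad_bounds(2)[of i] m_pos[of i] by (simp add: r_def field_simps)
  define j where "j = code i k l"
  have "ball (centre i k l) (rad i) \<inter> ball (centre i' k' l') (rad i') = {}"
    if i': "i' < i" "k' < m i'" "l' < m i'" for i' k' l'
  proof (rule ccontr)
    assume "ball (centre i k l) (rad i) \<inter> ball (centre i' k' l') (rad i') \<noteq> {}"
    then obtain y where y: "dist (centre i k l) y < rad i" "dist (centre i' k' l') y < rad i'" by auto
    have "dist x y < r i"
      using dist_triangle3[of x y "centre i k l"] dx y(1) r4 rad_bounds(1)[of i] by linarith
    also have "r i \<le> rad i'" by (rule scale_le[OF i'(1)])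
    finally have "dist (centre i' k' l') x \<le> 2 * rad i'"
      using dist_triangle2[of "centre i' k' l'" x y] y(2) by linarith
    then have "x \<in> doubled" unfolding doubled_def using i' by (intro UN_I[of i'] UN_I[of "(k', l')"]) auto
    then show False using x by simp
  qed
  then have j: "j \<in> J" using k(1) l(1) by (auto simp: J_def j_def)
  moreover have "C j \<subseteq> cball (flat x) (r i)"
  proof
    fix z assume z: "z \<in> C j"
    note b = C_bounds[OF z, unfolded hat_R_stage j_def code mem_ball]
    have "norm (flat (shadow z) - z) = \<bar>z $ 3\<bar>" by (simp add: norm_vec3 shadow_def)
    then have "dist (flat (shadow z)) z \<le> rad i" using b by (simp add: dist_norm)
    moreover have "dist (flat x) (flat (shadow z)) \<le> 1 / real (m i) + rad i"
      using dist_triangle3[of x "shadow z" "centre i k l"] dx b(3) by simp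
    ultimately show "z \<in> cball (flat x) (r i)"
      using dist_triangle[of "flat x" z "flat (shadow z)"] r4 by (simp only: mem_cball)
  qed
  ultimately show thesis by (intro that[of j]) (simp_all add: j_def)
qed

end

lemma Limsup_at_right_ge:
  fixes f :: "real \<Rightarrow> ennreal"
  assumes "\<And>b. 0 < b \<Longrightarrow> \<exists>r. 0 < r \<and> r < b \<and> c \<le> f r"
  shows "c \<le> Limsup (at_right 0) f"
  unfolding Limsup_def
proof (rule INF_greatest)
  fix P assume "P \<in> {P. eventually P (at_right (0 :: real))}"
  then obtain b where b: "0 < b" "\<And>y. 0 < y \<Longrightarrow> y < b \<Longrightarrow> P y" unfolding eventually_at_right_field by auto
  obtain r where r: "0 < r" "r < b" "c \<le> f r" using assms[OF b(1)] by blast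
  have "f r \<le> (SUP x\<in>Collect P. f x)" using b(2)[OF r(1,2)] by (intro SUP_upper) simp
  then show "c \<le> (SUP x\<in>Collect P. f x)" using r(3) by (meson order_trans)
qed

text \<open>Dependent choice: each \<open>m i\<close> only has to be large, relative to its
  predecessor and to the point below which \<open>\<omega>\<close> stays under the square of
  \<open>weight_seq i\<close>.\<close>

lemma stages_exist:
  assumes \<omega>: "(\<omega> \<longlongrightarrow> 0) (at_right (0 :: real))"
  shows "\<exists>m. stages m \<and> (\<forall>i. \<omega> (2 / real (m i)) \<le> (weight_seq i)\<^sup>2)"
proof -
  have ex: "\<exists>N. (3 \<le> N \<and> \<omega> (2 / real N) \<le> (weight_seq i)\<^sup>2) \<and> real N' \<le> real N * weight_seq i'" for i i' N'
  proof -
    have "\<forall>\<^sub>F t in at_right 0. \<omega> t < (weight_seq i)\<^sup>2"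
      using weight_seq(1)[of i] by (intro order_tendstoD[OF \<omega>]) auto
    then obtain b where b: "0 < b" "\<And>t. 0 < t \<Longrightarrow> t < b \<Longrightarrow> \<omega> t < (weight_seq i)\<^sup>2"
      unfolding eventually_at_right_field by auto
    obtain N :: nat where N: "max 3 (max (2 / b) (real N' / weight_seq i')) < real N" using reals_Archimedean2 by blast
    then have "0 < real N" "2 / b < real N" "real N' / weight_seq i' < real N" "3 \<le> N" by auto
    moreover from this have "2 / real N < b" using b(1) by (simp add: field_simps)
    ultimately show ?thesis using b(2)[of "2 / real N"] weight_seq(1)[of i']
      by (intro exI[of _ N]) (auto simp: field_simps intro: less_imp_le)
  qed
  have "\<exists>m. \<forall>i. (3 \<le> m i \<and> \<omega> (2 / real (m i)) \<le> (weight_seq i)\<^sup>2) \<and> real (m i) \<le> real (m (Suc i)) * weight_seq i"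
  proof (rule dependent_nat_choice)
    show "\<exists>N. 3 \<le> N \<and> \<omega> (2 / real N) \<le> (weight_seq 0)\<^sup>2" using ex by blast
  qed (use ex in blast)
  then show ?thesis unfolding stages_def by blast
qed

theorem theoremB:
  fixes \<omega> :: "real \<Rightarrow> real"
  assumes "modulus_of_continuity \<omega>"
  shows "\<exists>(V :: ((real^3) \<times> (real^3) set) measure) (C :: (real^3) set).
           integral_varifold TYPE(2) V \<and>
           first_variation_representable V \<and>
           C \<subseteq> tangent_domain 2 (weight V) \<and>
           emeasure (weight V) C > 0 \<and>
           (\<forall>c\<in>C.
              Limsup (at_right 0)
                (\<lambda>r. ennreal (inverse (\<omega> r) * inverse (r ^ 4) * inverse (ln (1 / r))) *
                     (\<integral>\<^sup>+z\<in>cball c r \<inter> tangent_domain 2 (weight V).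
                        ennreal ((hom_norm (tangent_map 2 (weight V) z
                                            - tangent_map 2 (weight V) c))\<^sup>2) \<partial>weight V)) > 0)"
proof -
  have \<omega>: "(\<omega> \<longlongrightarrow> 0) (at_right 0)" "\<And>t. t \<in> {0..1} \<Longrightarrow> 0 \<le> \<omega> t" "\<And>t. t \<in> {0..1} \<Longrightarrow> \<omega> t = 0 \<longleftrightarrow> t = 0"
    using assms unfolding modulus_of_continuity_def by (auto simp: image_subset_iff)
  obtain m where m: "stages m" "\<And>i. \<omega> (2 / real (m i)) \<le> (weight_seq i)\<^sup>2"
    using stages_exist[OF \<omega>(1)] by blast
  interpret stages m by (rule m(1))
  obtain Z where Z: "Z \<in> null_sets lborel" "{x \<in> space lborel. \<not> (x \<in> open_square - holes \<longrightarrow> good x)} \<subseteq> Z"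
    using AE_good unfolding eventually_ae_filter by blast
  have Zm[measurable]: "Z \<in> sets borel" using Z(1) by (simp add: null_sets_def)
  \<comment> \<open>Measurability of the set of good points is not established; removing the Borel
    null set \<open>Z\<close> leaves a Borel set of good points.\<close>
  define G where "G = open_square - doubled - Z"
  have Gm[measurable]: "G \<in> sets borel" unfolding G_def by measurable
  have G: "x \<in> open_square - doubled" "x \<in> open_square - holes" "good x" if "x \<in> G" for x
    using that holes_doubled Z(2) by (auto simp: G_def)
  have G_dom: "flat ` G \<subseteq> tangent_domain 2 \<mu>" using tangent_domain_flat(1) G by blast
  have G_pos: "0 < emeasure \<mu> (flat ` G)"
  proof -
    have "1 \<le> emeasure lborel (open_square - doubled) + ennreal (1 / 2)"
    proof -
      have "emeasure lborel open_square \<le> emeasure lborel ((open_square - doubled) \<union> doubled)"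
        by (intro emeasure_mono) auto
      also have "\<dots> \<le> emeasure lborel (open_square - doubled) + emeasure lborel doubled"
        by (intro emeasure_subadditive) auto
      also have "\<dots> \<le> emeasure lborel (open_square - doubled) + ennreal (1 / 2)"
        by (intro add_left_mono emeasure_doubled)
      finally show ?thesis by (simp add: emeasure_open_square)
    qed
    moreover have "emeasure lborel G = emeasure lborel (open_square - doubled)"
      unfolding G_def using Z(1) by (intro emeasure_Diff_null_set) auto
    ultimately have "emeasure lborel G \<noteq> 0"
    proof (intro notI)
      assume "1 \<le> emeasure lborel (open_square - doubled) + ennreal (1 / 2)"
        "emeasure lborel G = emeasure lborel (open_square - doubled)" "emeasure lborel G = 0"
      then have "ennreal 1 \<le> ennreal (1 / 2)" by simp
      then show False by (subst (asm) ennreal_le_iff) auto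
    qed
    moreover have "E \<inter> flat ` G = flat ` G" using G(2) flat_in_E by blast
    then have "emeasure \<mu> (flat ` G) = ennreal area_const * emeasure lborel G"
      by (simp add: emeasure_\<mu> emeasure_hausdorff_measure hausdorff_flat)
    ultimately show ?thesis using area_const(1) by (simp add: ennreal_zero_less_mult_iff zero_less_iff_neq_zero)
  qed
  have lim: "0 < Limsup (at_right 0)
      (\<lambda>r. ennreal (inverse (\<omega> r) * inverse (r ^ 4) * inverse (ln (1 / r))) *
           (\<integral>\<^sup>+z\<in>cball c r \<inter> tangent_domain 2 \<mu>.
              ennreal ((hom_norm (tangent_map 2 \<mu> z - tangent_map 2 \<mu> c))\<^sup>2) \<partial>\<mu>))" (is "0 < Limsup _ ?f")
    if "c \<in> flat ` G" for c
  proof -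
    obtain x where x: "c = flat x" "x \<in> G" using \<open>c \<in> flat ` G\<close> by blast
    have "ennreal (area_const * (4 * pi)) \<le> Limsup (at_right 0) ?f"
    proof (rule Limsup_at_right_ge)
      fix b :: real assume "0 < b"
      then obtain i where i: "r i < b" using r_tendsto by blast
      obtain j where j: "j \<in> J" "st j = i" "C j \<subseteq> cball (flat x) (r i)" using nearby_hat[OF G(1)[OF x(2)]] .
      note rb = r_bounds[of i] and lb = len_bounds[of i]
      have \<omega>r: "0 < \<omega> (r i)" "\<omega> (r i) \<le> (weight_seq i)\<^sup>2"
        using \<omega>(2,3)[of "r i"] rb m(2)[of i] by (auto simp: r_def)
      have "ennreal (area_const * (4 * pi)) \<le>
        ennreal (inverse (\<omega> (r i)) * inverse (r i ^ 4) * inverse (ln (1 / r i))) * ennreal (area_const * (4 * pi * (eps i)\<^sup>2 * len i))"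
      proof -
        \<comment> \<open>After the powers of \<open>r i\<close> cancel, the quotient is
          \<open>4 * pi * area_const\<close> times these two factors. The first is at least 1 by the
          choice of the scales, the second because arcosh dominates the logarithm.\<close>
        have "1 * 1 \<le> ((weight_seq i)\<^sup>2 / \<omega> (r i)) * (len i / ln (1 / r i))"
          using \<omega>r lb by (intro mult_mono) (simp_all add: pos_le_divide_eq)
        then have "area_const * (4 * pi) * 1 \<le> area_const * (4 * pi) * (((weight_seq i)\<^sup>2 / \<omega> (r i)) * (len i / ln (1 / r i)))"
          using area_const(1) by (intro mult_left_mono) auto
        also have "\<dots> = (inverse (\<omega> (r i)) * inverse (r i ^ 4) * inverse (ln (1 / r i))) * (area_const * (4 * pi * (eps i)\<^sup>2 * len i))"
        proof -
          have "(eps i)\<^sup>2 = (weight_seq i)\<^sup>2 * r i ^ 4" by (simp add: eps_def power_mult_distrib power_mult[symmetric])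
          then show ?thesis using rb(1) by (simp add: divide_inverse)
        qed
        finally show ?thesis
        proof (subst ennreal_mult[symmetric])
          show "0 \<le> inverse (\<omega> (r i)) * inverse (r i ^ 4) * inverse (ln (1 / r i))"
            using \<omega>r(1) lb(3) rb(1) by (intro mult_nonneg_nonneg) (simp_all add: less_imp_le)
          have "0 \<le> len i" using lb(2,3) by linarith
          then show "0 \<le> area_const * (4 * pi * (eps i)\<^sup>2 * len i)"
            using area_const(1) by (intro mult_nonneg_nonneg) simp_all
        qed (simp add: ennreal_leI)
      qed
      also have "\<dots> \<le> ?f (r i)"
        using tilt_ge[OF j(1) G(2,3)[OF x(2)] j(3)] by (intro mult_left_mono) (simp_all add: x(1) j(2))
      finally show "\<exists>r. 0 < r \<and> r < b \<and> ennreal (area_const * (4 * pi)) \<le> ?f r" using rb(1) i by blast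
    qed
    moreover have "0 < ennreal (area_const * (4 * pi))" using area_const(1) by simp
    ultimately show ?thesis by (rule order_less_le_trans[rotated])
  qed
  show ?thesis
    by (rule exI[of _ V], rule exI[of _ "flat ` G"], unfold weight_V)
       (use integral_V representable_V G_dom G_pos lim in blast)
qed

end
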